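(* Let $p\ge1$ and $\mathcal{X}=(X,d_X,\mu)$ with $\mu\in\mathcal{B}(X,d_X;p)$, where $(X,d_X)$ is a connected and locally path-connected Polish metric space, and let $(x_i)_{i=1}^\infty$ be independent samples from $\mu$. For $n>0$, let $\mu_n=\frac1n\sum_{i=1}^n\delta_{x_i}$ be the associated empirical measure and $\mathcal{X}_n=(X,d_X,\mu_n)$. Suppose $(X,d_X)$ has finite connectivity modulus and $\theta\colon X\times X\to\mathbb{R}$ is an $L$-admissible pseudo-metric, $L>0$; let $\mathcal{F}_p(\mathcal{X})$ and $\mathcal{F}_p(\mathcal{X}_n)$ be the functional barycentric merge trees of order $p$ with respect to $\theta$. Then: (i) (Consistency) $\lim_{n\to\infty}D_{KS,p}(\mathcal{F}_p(\mathcal{X}),\mathcal{F}_p(\mathcal{X}_n))=0$, $(\otimes_\infty\mu)$-almost surely. (ii) (Convergence rate) If $s>d_p^\ast(\mu)$, then there is a constant $C>0$ such that $$\mathbb{E}\,[D_{KS,p}(\mathcal{F}_p(\mathcal{X}),\mathcal{F}_p(\mathcal{X}_n))]\le C\,\mathrm{diam}(X)\,n^{-1/s},$$ where $C$ depends only on $s$, $p$, $L$ and the connectivity modulus of $(X,d_X)$.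
   Context: $\mathcal{B}(X,d_X;p)$ is the set of Borel probability measures $\mu$ on $X$ with $\int_X d_X^p(x_0,y)\,d\mu(y)<\infty$ for some (hence all) $x_0\in X$. A pseudo-metric $\theta$ on $X$ is $L$-admissible if $\theta(x,y)\le L\,d_X(x,y)$ for all $x,y$. $\vee$ denotes max; $I=[0,1]$; $\Gamma(x,y)$ is the set of continuous paths $\gamma\colon I\to(X,d_X)$ with $\gamma(0)=x$, $\gamma(1)=y$. Connectivity modulus: $K_X=\sup_{x\ne y} r_X(x,y)/d_X(x,y)$, where $r_X(x,y)=\inf_{\gamma\in\Gamma(x,y)}\sup_{t\in I} d_X(x,\gamma(t))\vee d_X(\gamma(t),y)$. Barycentric merge tree (BMT): for $\mu\in\mathcal{B}(X,d_X;p)$ the $p$-deviation function is $\sigma_p(x)=\big(\int_X\theta^p(x,y)\,d\mu(y)\big)^{1/p}$. Let $A(t)=\sigma_p^{-1}((-\infty,t])$. $T_p$ is the quotient of $X$ by: $x\sim y$ iff there is $t\in\mathbb{R}$ with $\sigma_p(x)=\sigma_p(y)=t$ and $x,y$ in the same connected component of $A(t)$. $\alpha_p\colon X\to T_p$ is the quotient map and $\kappa_p\colon T_p\to\mathbb{R}$ is the induced function, $\sigma_p=\kappa_p\circ\alpha_p$. For $a=\alpha_p(x)$, $C_a$ is the connected component of $A(\sigma_p(x))$ containing $x$; $a\preceq b$ iff $C_a\subseteq C_b$; $\Lambda(a,b)=\{c\in T_p: a\preceq c,\ b\preceq c\}$. $T_p$ carries the pseudo-metric $d_p(a,b)=\inf_{c\in\Lambda(a,b)}(\kappa_p(c)-\kappa_p(a))\vee(\kappa_p(c)-\kappa_p(b))$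 and the pushforward measure $\mu_p=(\alpha_p)_\sharp\mu$. The functional BMT of $\mathcal{X}=(X,d_X,\mu)$ is $\mathcal{F}_p(\mathcal{X})=(T_p,d_p,\mu_p,\kappa_p)$; $\mathcal{F}_p(\mathcal{X}_n)$ is the same construction with $\mu_n$ in place of $\mu$. Functional Kantorovich–Sturm distance: for (pseudo) metric measure spaces with functions $\mathcal{F}=(Z,d,\mu,f)$, $\mathcal{F}'=(Z',d',\mu',f')$, let $A,A'$ be the supports of $\mu,\mu'$. A metric coupling is a (pseudo) metric $\delta$ on $Z\sqcup Z'$ with $\delta|_{A\times A}=d|_{A\times A}$ and $\delta|_{A'\times A'}=d'|_{A'\times A'}$; $M(\mathcal{Z},\mathcal{Z}')$ is the set of these, and $C(\mu,\mu')$ is the set of Borel probability measures on $Z\times Z'$ with marginals $\mu,\mu'$. Then (possibly infinite) $$D_{KS,p}(\mathcal{F},\mathcal{F}')=\inf_{h\in C(\mu,\mu'),\,\delta\in M(\mathcal{Z},\mathcal{Z}')}\Big(\int_{Z\times Z'}\delta^p(z,z')\,dh\Big)^{1/p}\vee\Big(\int_{Z\times Z'}|f(z)-f'(z')|^p\,dh\Big)^{1/p}.$$ Upper $p$-Wasserstein dimension $d_p^\ast(\mu)$ (Weed–Bach): for $S\subseteq X$ let $N_\varepsilon(S)$ be the minimal number of closed balls of diameter $\varepsilon$ needed to cover $S$; for $\tau>0$ let $N_\varepsilon(\mu,\tau)=\inf\{N_\varepsilon(S):\mu(S)\ge 1-\tau\}$ and $d_\varepsilon(\mu,\tau)=\log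 N_\varepsilon(\mu,\tau)/(-\log\varepsilon)$. Then $d_p^\ast(\mu)=\inf\{s\in(2p,\infty):\limsup_{\varepsilon\to0}d_\varepsilon(\mu,\varepsilon^{sp/(s-2p)})\le s\}$.
   Formalization: In (ii), a C depending only on s, p, L and the connectivity modulus cannot serve all n (uniform measures on leaves of large stars refute it); proved instead: such a C for all sufficiently large n, and for all n > 0 a constant that may also depend on X, μ, θ. *)

theory Defs
  imports "HOL-Probability.Probability"
begin

section \<open>Pseudo-metrics\<close>

definition pseudo_metric_on :: "'b set \<Rightarrow> ('b \<Rightarrow> 'b \<Rightarrow> real) \<Rightarrow> bool" where
  "pseudo_metric_on Z d \<longleftrightarrow>
     (\<forall>x\<in>Z. \<forall>y\<in>Z. 0 \<le> d x y \<and> d x y = d y x) \<and>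
     (\<forall>x\<in>Z. d x x = 0) \<and>
     (\<forall>x\<in>Z. \<forall>y\<in>Z. \<forall>z\<in>Z. d x z \<le> d x y + d y z)"

definition admissible ::
    "real \<Rightarrow> 'a set \<Rightarrow> ('a \<Rightarrow> 'a \<Rightarrow> real) \<Rightarrow> ('a \<Rightarrow> 'a \<Rightarrow> real) \<Rightarrow> bool" where
  "admissible L M d \<theta> \<longleftrightarrow> pseudo_metric_on M \<theta> \<and> (\<forall>x\<in>M. \<forall>y\<in>M. \<theta> x y \<le> L * d x y)"

definition pm_topology :: "'b set \<Rightarrow> ('b \<Rightarrow> 'b \<Rightarrow> real) \<Rightarrow> 'b topology" where
  "pm_topology Z d =
     topology (\<lambda>U. U \<subseteq> Z \<and> (\<forall>x\<in>U. \<exists>r>0. {y \<in> Z. d x y < r} \<subseteq> U))"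

lemma openin_pm_topology:
  "openin (pm_topology Z d) U \<longleftrightarrow> U \<subseteq> Z \<and> (\<forall>x\<in>U. \<exists>r>0. {y \<in> Z. d x y < r} \<subseteq> U)"
proof -
  let ?P = "\<lambda>U. U \<subseteq> Z \<and> (\<forall>x\<in>U. \<exists>r>0. {y \<in> Z. d x y < r} \<subseteq> U)"
  have Int: "?P (S \<inter> T)" if S: "?P S" and T: "?P T" for S T
  proof (intro conjI ballI)
    show "S \<inter> T \<subseteq> Z" using S by blast
    fix x assume x: "x \<in> S \<inter> T"
    obtain r where r: "r > 0" "{y \<in> Z. d x y < r} \<subseteq> S"
      using S x by blast
    obtain r' where r': "r' > 0" "{y \<in> Z. d x y < r'} \<subseteq> T"
      using T x by blast
    have "0 < min r r'" "{y \<in> Z. d x y < min r r'} \<subseteq> S \<inter> T"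
      using r r' by auto
    then show "\<exists>r>0. {y \<in> Z. d x y < r} \<subseteq> S \<inter> T"
      by blast
  qed
  have Union: "?P (\<Union>K)" if K: "\<forall>k\<in>K. ?P k" for K
  proof (intro conjI ballI)
    show "\<Union>K \<subseteq> Z" using K by blast
    fix x assume "x \<in> \<Union>K"
    then obtain k where k: "k \<in> K" "x \<in> k" by blast
    then obtain r where "r > 0" "{y \<in> Z. d x y < r} \<subseteq> k"
      using K by meson
    then show "\<exists>r>0. {y \<in> Z. d x y < r} \<subseteq> \<Union>K"
      using k by blast
  qed
  have "istopology ?P"
    unfolding istopology_def
    by (rule conjI; intro allI impI; (rule Int | rule Union); assumption)
  then show ?thesis
    by (simp add: pm_topology_def topology_inverse')
qed

lemma (in Metric_space) pm_topology_eq_mtopology: "pm_topology M d = mtopology"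
proof -
  have "{y \<in> M. d x y < r} = mball x r" if "x \<in> M" for x r
    using that by (auto simp: mball_def)
  then have "(U \<subseteq> M \<and> (\<forall>x\<in>U. \<exists>r>0. {y \<in> M. d x y < r} \<subseteq> U)) =
      (U \<subseteq> M \<and> (\<forall>x. x \<in> U \<longrightarrow> (\<exists>r>0. mball x r \<subseteq> U)))" for U
    by (metis subsetD)
  then show ?thesis
    unfolding topology_eq openin_pm_topology openin_mtopology by blast
qed


section \<open>Borel measures on topological spaces\<close>

definition borel_of :: "'b topology \<Rightarrow> 'b measure" where
  "borel_of T = sigma (topspace T) {U. openin T U}"

definition measure_support :: "'b topology \<Rightarrow> 'b measure \<Rightarrow> 'b set" where
  "measure_support T \<mu> =
     {z \<in> topspace T. \<forall>U. openin T U \<and> z \<in> U \<longrightarrow> 0 < emeasure \<mu> U}"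

definition borel_prob_moment ::
    "'a set \<Rightarrow> ('a \<Rightarrow> 'a \<Rightarrow> real) \<Rightarrow> real \<Rightarrow> 'a measure set" where
  "borel_prob_moment M d p =
     {\<mu>. prob_space \<mu> \<and>
         space \<mu> = M \<and> sets \<mu> = sets (borel_of (Metric_space.mtopology M d)) \<and>
         (\<exists>x0\<in>M. (\<integral>\<^sup>+ y. ennreal (d x0 y powr p) \<partial>\<mu>) < \<infinity>)}"

text \<open>The sample points are \<open>x 0, ..., x (n - 1)\<close>, and \<^const>\<open>return\<close> is the Dirac measure.\<close>

definition empirical_measure :: "'a measure \<Rightarrow> nat \<Rightarrow> (nat \<Rightarrow> 'a) \<Rightarrow> 'a measure" where
  "empirical_measure \<mu> n x =
     measure_of (space \<mu>) (sets \<mu>)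
       (\<lambda>S. ennreal (1 / real n) * (\<Sum>i<n. emeasure (return \<mu> (x i)) S))"

text \<open>
  The outer expectation is the usual expectation on measurable functions (lemma below). For a
  function whose measurability is not established it is an upper bound for \<^const>\<open>nn_integral\<close>,
  which is then a lower integral.
\<close>

definition outer_expectation :: "'w measure \<Rightarrow> ('w \<Rightarrow> ennreal) \<Rightarrow> ennreal" where
  "outer_expectation P f =
     (INF g \<in> {g \<in> borel_measurable P. \<forall>w\<in>space P. f w \<le> g w}. \<integral>\<^sup>+ w. g w \<partial>P)"

lemma outer_expectation_measurable:
  assumes "f \<in> borel_measurable P"
  shows "outer_expectation P f = (\<integral>\<^sup>+ w. f w \<partial>P)"
  unfolding outer_expectation_def
proof (rule antisym)
  show "(INF g \<in> {g \<in> borel_measurable P. \<forall>w\<in>space P. f w \<le> g w}. \<integral>\<^sup>+ w. g w \<partial>P)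
      \<le> (\<integral>\<^sup>+ w. f w \<partial>P)"
    using assms by (intro INF_lower) auto
qed (auto intro!: INF_greatest nn_integral_mono)

lemma nn_integral_le_outer_expectation: "(\<integral>\<^sup>+ w. f w \<partial>P) \<le> outer_expectation P f"
  unfolding outer_expectation_def by (auto intro!: INF_greatest nn_integral_mono)


section \<open>Diameter and connectivity modulus\<close>

definition ediam :: "'a set \<Rightarrow> ('a \<Rightarrow> 'a \<Rightarrow> real) \<Rightarrow> ennreal" where
  "ediam M d = (SUP x\<in>M. SUP y\<in>M. ennreal (d x y))"

definition paths_between ::
    "'a set \<Rightarrow> ('a \<Rightarrow> 'a \<Rightarrow> real) \<Rightarrow> 'a \<Rightarrow> 'a \<Rightarrow> (real \<Rightarrow> 'a) set" where
  "paths_between M d x y =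
     {\<gamma>. pathin (Metric_space.mtopology M d) \<gamma> \<and> \<gamma> 0 = x \<and> \<gamma> 1 = y}"

definition conn_radius :: "'a set \<Rightarrow> ('a \<Rightarrow> 'a \<Rightarrow> real) \<Rightarrow> 'a \<Rightarrow> 'a \<Rightarrow> ennreal" where
  "conn_radius M d x y =
     (INF \<gamma> \<in> paths_between M d x y. SUP t \<in> {0..1}. ennreal (max (d x (\<gamma> t)) (d (\<gamma> t) y)))"

definition connectivity_modulus :: "'a set \<Rightarrow> ('a \<Rightarrow> 'a \<Rightarrow> real) \<Rightarrow> ennreal" where
  "connectivity_modulus M d =
     (SUP (x, y) \<in> {(x, y). x \<in> M \<and> y \<in> M \<and> x \<noteq> y}. conn_radius M d x y / ennreal (d x y))"


section \<open>Functional pseudo-metric measure spaces and the Kantorovich--Sturm distance\<close>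

record 'b fmm_space =
  fmm_carrier :: "'b set"
  fmm_dist :: "'b \<Rightarrow> 'b \<Rightarrow> real"
  fmm_measure :: "'b measure"
  fmm_fun :: "'b \<Rightarrow> real"

definition fmm_topology :: "'b fmm_space \<Rightarrow> 'b topology" where
  "fmm_topology F = pm_topology (fmm_carrier F) (fmm_dist F)"

definition fmm_support :: "'b fmm_space \<Rightarrow> 'b set" where
  "fmm_support F = measure_support (fmm_topology F) (fmm_measure F)"

definition measure_couplings :: "'b fmm_space \<Rightarrow> 'c fmm_space \<Rightarrow> ('b \<times> 'c) measure set" where
  "measure_couplings F F' =
     {h. prob_space h \<and>
         space h = fmm_carrier F \<times> fmm_carrier F' \<and>
         sets h = sets (borel_of (prod_topology (fmm_topology F) (fmm_topology F'))) \<and>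
         distr h (fmm_measure F) fst = fmm_measure F \<and>
         distr h (fmm_measure F') snd = fmm_measure F'}"

text \<open>The disjoint union of the two carriers is \<open>Z <+> Z'\<close>, with injections \<^const>\<open>Inl\<close>, \<^const>\<open>Inr\<close>.\<close>

definition metric_couplings ::
    "'b fmm_space \<Rightarrow> 'c fmm_space \<Rightarrow> ('b + 'c \<Rightarrow> 'b + 'c \<Rightarrow> real) set" where
  "metric_couplings F F' =
     {\<delta>. pseudo_metric_on (fmm_carrier F <+> fmm_carrier F') \<delta> \<and>
         (\<forall>a\<in>fmm_support F. \<forall>b\<in>fmm_support F. \<delta> (Inl a) (Inl b) = fmm_dist F a b) \<and>
         (\<forall>a\<in>fmm_support F'. \<forall>b\<in>fmm_support F'. \<delta> (Inr a) (Inr b) = fmm_dist F' a b)}"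

definition ennroot :: "real \<Rightarrow> ennreal \<Rightarrow> ennreal" where
  "ennroot p x = (if x = \<infinity> then \<infinity> else ennreal (enn2real x powr (1 / p)))"

definition KS_distance :: "real \<Rightarrow> 'b fmm_space \<Rightarrow> 'c fmm_space \<Rightarrow> ennreal" where
  "KS_distance p F F' =
     (INF (h, \<delta>) \<in> measure_couplings F F' \<times> metric_couplings F F'.
        max (ennroot p (\<integral>\<^sup>+ (z, z'). ennreal (\<delta> (Inl z) (Inr z') powr p) \<partial>h))
            (ennroot p (\<integral>\<^sup>+ (z, z'). ennreal (\<bar>fmm_fun F z - fmm_fun F' z'\<bar> powr p) \<partial>h)))"


section \<open>Barycentric merge trees\<close>

definition p_deviation :: "real \<Rightarrow> ('a \<Rightarrow> 'a \<Rightarrow> real) \<Rightarrow> 'a measure \<Rightarrow> 'a \<Rightarrow> real" where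
  "p_deviation p \<theta> \<mu> x = (\<integral> y. \<theta> x y powr p \<partial>\<mu>) powr (1 / p)"

definition sublevel :: "'a set \<Rightarrow> ('a \<Rightarrow> real) \<Rightarrow> real \<Rightarrow> 'a set" where
  "sublevel M \<sigma> t = {x \<in> M. \<sigma> x \<le> t}"

definition sublevel_component ::
    "'a set \<Rightarrow> ('a \<Rightarrow> 'a \<Rightarrow> real) \<Rightarrow> ('a \<Rightarrow> real) \<Rightarrow> real \<Rightarrow> 'a \<Rightarrow> 'a set" where
  "sublevel_component M d \<sigma> t x =
     connected_component_of_set (subtopology (Metric_space.mtopology M d) (sublevel M \<sigma> t)) x"

definition merge_rel ::
    "'a set \<Rightarrow> ('a \<Rightarrow> 'a \<Rightarrow> real) \<Rightarrow> ('a \<Rightarrow> real) \<Rightarrow> ('a \<times> 'a) set" where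
  "merge_rel M d \<sigma> =
     {(x, y). x \<in> M \<and> y \<in> M \<and>
        (\<exists>t. \<sigma> x = t \<and> \<sigma> y = t \<and> y \<in> sublevel_component M d \<sigma> t x)}"

definition merge_tree :: "'a set \<Rightarrow> ('a \<Rightarrow> 'a \<Rightarrow> real) \<Rightarrow> ('a \<Rightarrow> real) \<Rightarrow> 'a set set" where
  "merge_tree M d \<sigma> = M // merge_rel M d \<sigma>"

definition merge_proj ::
    "'a set \<Rightarrow> ('a \<Rightarrow> 'a \<Rightarrow> real) \<Rightarrow> ('a \<Rightarrow> real) \<Rightarrow> 'a \<Rightarrow> 'a set" where
  "merge_proj M d \<sigma> x = merge_rel M d \<sigma> `` {x}"

text \<open>
  In the next two definitions \<^const>\<open>the_elem\<close> is applied to a singleton: \<open>\<sigma>\<close>, and likewise the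
  component of a point in its own sublevel set, is constant on the equivalence classes.
\<close>

definition merge_height :: "('a \<Rightarrow> real) \<Rightarrow> 'a set \<Rightarrow> real" where
  "merge_height \<sigma> a = the_elem (\<sigma> ` a)"

definition merge_component ::
    "'a set \<Rightarrow> ('a \<Rightarrow> 'a \<Rightarrow> real) \<Rightarrow> ('a \<Rightarrow> real) \<Rightarrow> 'a set \<Rightarrow> 'a set" where
  "merge_component M d \<sigma> a = the_elem ((\<lambda>x. sublevel_component M d \<sigma> (\<sigma> x) x) ` a)"

definition merge_le ::
    "'a set \<Rightarrow> ('a \<Rightarrow> 'a \<Rightarrow> real) \<Rightarrow> ('a \<Rightarrow> real) \<Rightarrow> 'a set \<Rightarrow> 'a set \<Rightarrow> bool" where
  "merge_le M d \<sigma> a b \<longleftrightarrow> merge_component M d \<sigma> a \<subseteq> merge_component M d \<sigma> b"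

definition merge_upper ::
    "'a set \<Rightarrow> ('a \<Rightarrow> 'a \<Rightarrow> real) \<Rightarrow> ('a \<Rightarrow> real) \<Rightarrow> 'a set \<Rightarrow> 'a set \<Rightarrow> 'a set set" where
  "merge_upper M d \<sigma> a b = {c \<in> merge_tree M d \<sigma>. merge_le M d \<sigma> a c \<and> merge_le M d \<sigma> b c}"

definition merge_dist ::
    "'a set \<Rightarrow> ('a \<Rightarrow> 'a \<Rightarrow> real) \<Rightarrow> ('a \<Rightarrow> real) \<Rightarrow> 'a set \<Rightarrow> 'a set \<Rightarrow> real" where
  "merge_dist M d \<sigma> a b =
     (INF c \<in> merge_upper M d \<sigma> a b.
        max (merge_height \<sigma> c - merge_height \<sigma> a) (merge_height \<sigma> c - merge_height \<sigma> b))"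

definition functional_BMT ::
    "real \<Rightarrow> ('a \<Rightarrow> 'a \<Rightarrow> real) \<Rightarrow> 'a set \<Rightarrow> ('a \<Rightarrow> 'a \<Rightarrow> real) \<Rightarrow> 'a measure \<Rightarrow> 'a set fmm_space"
  where
  "functional_BMT p \<theta> M d \<mu> =
     (let \<sigma> = p_deviation p \<theta> \<mu>;
          T = merge_tree M d \<sigma>;
          dT = merge_dist M d \<sigma>
      in \<lparr>fmm_carrier = T,
          fmm_dist = dT,
          fmm_measure = distr \<mu> (borel_of (pm_topology T dT)) (merge_proj M d \<sigma>),
          fmm_fun = merge_height \<sigma>\<rparr>)"


section \<open>Upper Wasserstein dimension\<close>

text \<open>
  A closed ball ``of diameter \<open>\<epsilon>\<close>'' is a closed ball of radius \<open>\<epsilon> / 2\<close>, centred anywhere in the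
  space. The value is \<open>\<infinity>\<close> if no finite cover exists.
\<close>

definition covering_number ::
    "'a set \<Rightarrow> ('a \<Rightarrow> 'a \<Rightarrow> real) \<Rightarrow> real \<Rightarrow> 'a set \<Rightarrow> enat" where
  "covering_number M d \<epsilon> S =
     (INF F \<in> {F. finite F \<and> F \<subseteq> M \<and> S \<subseteq> (\<Union>x\<in>F. Metric_space.mcball M d x (\<epsilon> / 2))}.
        enat (card F))"

definition measure_covering_number ::
    "('a \<Rightarrow> 'a \<Rightarrow> real) \<Rightarrow> 'a measure \<Rightarrow> real \<Rightarrow> real \<Rightarrow> enat" where
  "measure_covering_number d \<mu> \<epsilon> \<tau> =
     (INF S \<in> {S \<in> sets \<mu>. measure \<mu> S \<ge> 1 - \<tau>}. covering_number (space \<mu>) d \<epsilon> S)"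

definition measure_dim ::
    "('a \<Rightarrow> 'a \<Rightarrow> real) \<Rightarrow> 'a measure \<Rightarrow> real \<Rightarrow> real \<Rightarrow> ereal" where
  "measure_dim d \<mu> \<epsilon> \<tau> =
     (case measure_covering_number d \<mu> \<epsilon> \<tau> of
        enat N \<Rightarrow> ereal (ln (real N) / (- ln \<epsilon>))
      | \<infinity> \<Rightarrow> \<infinity>)"

definition upper_wasserstein_dim ::
    "real \<Rightarrow> ('a \<Rightarrow> 'a \<Rightarrow> real) \<Rightarrow> 'a measure \<Rightarrow> ereal" where
  "upper_wasserstein_dim p d \<mu> =
     (INF s \<in> {s. s > 2 * p \<and>
                Limsup (at_right 0) (\<lambda>\<epsilon>. measure_dim d \<mu> \<epsilon> (\<epsilon> powr (s * p / (s - 2 * p)))) \<le> ereal s}.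
        ereal s)"

end

(*
  A coupling of mu and nu whose d^p-cost is at most B^p moves the deviation functions by at most
  L B (Minkowski), and finite connectivity modulus K makes the projection to the merge tree
  L K-Lipschitz. Two functions within e of each other have merge trees that are related by a
  correspondence of distortion at most 2 e; gluing the trees along it and pushing the coupling
  forward bounds the Kantorovich-Sturm distance by L (K + 2) B. It remains to couple mu with its
  empirical measure.

  For a chain of nested finite partitions, one coupling is simultaneously good at all levels: match
  mass inside the finest cells first and pass the unmatched mass on to the next level, where it is
  at most the total discrepancy of the two measures on that level. A single partition into small
  balls and a set of small p-th moment gives consistency, by the law of large numbers on the cells
  and a one-sided strong law for the tail. For the rate, the covers supplied by the Wasserstein
  dimension at the scales n^(-a), with a running from (t - 2p) / t^2 to 1 / t in finitely many
  steps, are chained into nested partitions, and the variance bound sqrt (N / n) for N cells gives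
  the exponent 1 / t up to the step size. As t < s, this beats n^(-1/s) with room to spare, which
  absorbs every multiplicative factor, so that the constant C can be taken to be 1.
*)
theory Submission
  imports Defs
begin

section \<open>Merge trees\<close>

text \<open>Two obstacles shape the argument. Measurability of the glued distance on the trees, and
  of the Kantorovich-Sturm distance as a function of the sample, is not established; costs are
  therefore pulled back to the base space by inequalities between lower integrals, and expectations
  are bounded through explicit measurable majorants. Moreover, the dimension supplies at each scale
  an unrelated cover of an unrelated set of large mass. Nested partitions arise by chaining ball
  centres upwards on the intersection of these sets, which costs a factor linear in the number of
  levels; so that number must not grow with n. The endpoints of the range of exponents balance the
  errors: the finest cells contribute n^(-p/t), and at the coarsest scale both the discarded mass
  and the deviation of the frequencies are of order n^(-p/t). In between, t > 2p makes the finest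
  scales the worst, and passing to the next coarser scale loses only n^(p eta) for the step eta. The
  dimension speaks of small scales only, so all this starts at some n depending on mu; earlier n are
  handled by the diameter.\<close>

locale merge_setting = Metric_space M d
  for M :: "'a set" and d :: "'a \<Rightarrow> 'a \<Rightarrow> real" +
  fixes \<sigma> :: "'a \<Rightarrow> real"
  assumes path_connected: "path_connected_space mtopology"
    and locally_path_connected: "locally_path_connected_space mtopology"
    and continuous_height: "continuous_map mtopology euclideanreal \<sigma>"
begin

abbreviation proj :: "'a \<Rightarrow> 'a set" where
  "proj \<equiv> merge_proj M d \<sigma>"

abbreviation tree_dist :: "'a set \<Rightarrow> 'a set \<Rightarrow> real" where
  "tree_dist \<equiv> merge_dist M d \<sigma>"

text \<open>This is \<open>merge_le\<close> lifted to points, see \<open>merge_le_proj\<close>. With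
  a connected witness set in place of a component, unions of witnesses do the work, and distances
  can be computed on representatives instead of classes.\<close>

definition below :: "'a \<Rightarrow> 'a \<Rightarrow> bool" where
  "below x z \<longleftrightarrow> (\<exists>C. connectedin mtopology C \<and> C \<subseteq> sublevel M \<sigma> (\<sigma> z) \<and> x \<in> C \<and> z \<in> C)"

definition merge_levels :: "'a \<Rightarrow> 'a \<Rightarrow> real set" where
  "merge_levels x y = \<sigma> ` {z \<in> M. below x z \<and> below y z}"

text \<open>The height at which the branches of \<open>x\<close> and \<open>y\<close> meet. By
  \<open>merge_level_le\<close> and \<open>merge_level_attained\<close> it is a minimax value: the
  infimum, over connected sets containing both points, of upper bounds of
  \<open>\<sigma>\<close>.\<close>

definition merge_level :: "'a \<Rightarrow> 'a \<Rightarrow> real" where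
  "merge_level x y = Inf (merge_levels x y)"

lemma in_sublevel_component:
  "y \<in> sublevel_component M d \<sigma> t x \<longleftrightarrow>
     (\<exists>C. connectedin mtopology C \<and> C \<subseteq> sublevel M \<sigma> t \<and> x \<in> C \<and> y \<in> C)"
  by (auto simp: sublevel_component_def connected_component_of_def connectedin_subtopology)

lemma below_iff: "below x z \<longleftrightarrow> x \<in> sublevel_component M d \<sigma> (\<sigma> z) z"
  unfolding below_def in_sublevel_component by blast

lemma below_refl: "x \<in> M \<Longrightarrow> below x x"
  unfolding below_def by (intro exI[of _ "{x}"]) (auto simp: sublevel_def connectedin_sing)

lemma below_height_le: "below x z \<Longrightarrow> \<sigma> x \<le> \<sigma> z"
  by (auto simp: below_def sublevel_def)

lemma below_in_carrier: "below x z \<Longrightarrow> x \<in> M \<and> z \<in> M"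
  by (auto simp: below_def sublevel_def)

lemma below_trans:
  assumes "below x y" "below y z"
  shows "below x z"
proof -
  obtain C where C: "connectedin mtopology C" "C \<subseteq> sublevel M \<sigma> (\<sigma> y)" "x \<in> C" "y \<in> C"
    using assms unfolding below_def by blast
  obtain C' where C': "connectedin mtopology C'" "C' \<subseteq> sublevel M \<sigma> (\<sigma> z)" "y \<in> C'" "z \<in> C'"
    using assms unfolding below_def by blast
  have "connectedin mtopology (C \<union> C')"
    using C C' by (intro connectedin_Un) auto
  moreover have "C \<union> C' \<subseteq> sublevel M \<sigma> (\<sigma> z)"
    using C C' below_height_le[OF assms(2)] by (force simp: sublevel_def)
  ultimately show ?thesis
    using C C' unfolding below_def by blast
qed

lemma sublevel_component_eq: "sublevel_component M d \<sigma> (\<sigma> x) x = {y. below y x}"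
  by (auto simp: below_iff)

text \<open>If each point lies below the other, the heights agree by \<open>below_height_le\<close>,
  so the common level \<open>t\<close> need not be carried along.\<close>

lemma merge_rel_iff: "(x, y) \<in> merge_rel M d \<sigma> \<longleftrightarrow> below x y \<and> below y x"
proof
  assume "(x, y) \<in> merge_rel M d \<sigma>"
  then have "\<sigma> x = \<sigma> y" "y \<in> sublevel_component M d \<sigma> (\<sigma> x) x"
    by (auto simp: merge_rel_def)
  then show "below x y \<and> below y x"
    unfolding below_def in_sublevel_component by auto
next
  assume *: "below x y \<and> below y x"
  then have "\<sigma> x = \<sigma> y" "x \<in> M" "y \<in> M"
    using below_height_le[of x y] below_height_le[of y x] below_in_carrier[of x y] by auto
  with * show "(x, y) \<in> merge_rel M d \<sigma>"
    by (simp add: merge_rel_def below_iff)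
qed

lemma proj_eq: "proj x = {y. below x y \<and> below y x}"
  by (auto simp: merge_proj_def merge_rel_iff)

lemma merge_tree_eq: "merge_tree M d \<sigma> = proj ` M"
  by (auto simp: merge_tree_def merge_proj_def quotient_def)

lemma self_in_proj: "x \<in> M \<Longrightarrow> x \<in> proj x"
  by (simp add: proj_eq below_refl)

lemma merge_height_proj: "x \<in> M \<Longrightarrow> merge_height \<sigma> (proj x) = \<sigma> x"
proof -
  assume x: "x \<in> M"
  have "\<sigma> y = \<sigma> x" if "y \<in> proj x" for y
    using that below_height_le[of x y] below_height_le[of y x] by (simp add: proj_eq)
  then have "\<sigma> ` proj x = {\<sigma> x}"
    using self_in_proj[OF x] by blast
  then show ?thesis by (simp add: merge_height_def)
qed

lemma merge_component_proj: "x \<in> M \<Longrightarrow> merge_component M d \<sigma> (proj x) = {y. below y x}"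
proof -
  assume x: "x \<in> M"
  have "{z. below z y} = {z. below z x}" if "y \<in> proj x" for y
    using that below_trans[of _ x y] below_trans[of _ y x] by (auto simp: proj_eq)
  then have "(\<lambda>x. {y. below y x}) ` proj x = {{y. below y x}}"
    using self_in_proj[OF x] by blast
  then show ?thesis by (simp add: merge_component_def sublevel_component_eq)
qed

lemma merge_le_proj:
  "x \<in> M \<Longrightarrow> z \<in> M \<Longrightarrow> merge_le M d \<sigma> (proj x) (proj z) \<longleftrightarrow> below x z"
  using below_refl[of x] below_trans[of _ x z] by (auto simp: merge_le_def merge_component_proj)

lemma merge_upper_proj:
  assumes "x \<in> M" "y \<in> M"
  shows "merge_upper M d \<sigma> (proj x) (proj y) = proj ` {z \<in> M. below x z \<and> below y z}"
  using assms by (auto simp: merge_upper_def merge_tree_eq merge_le_proj)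

lemma merge_levels_lower: "h \<in> merge_levels x y \<Longrightarrow> \<sigma> x \<le> h \<and> \<sigma> y \<le> h"
  using below_height_le by (auto simp: merge_levels_def)

lemma bdd_below_merge_levels: "bdd_below (merge_levels x y)"
  using merge_levels_lower by (meson bdd_belowI)

text \<open>
  A connected set need not attain its supremum of \<open>\<sigma>\<close>. A path inside the slightly larger open
  sublevel set does, by compactness, and its highest point lies above both ends.
\<close>

lemma merge_level_below_connected:
  assumes C: "connectedin mtopology C" "C \<subseteq> sublevel M \<sigma> t" "x \<in> C" "y \<in> C" and "\<eta> > 0"
  shows "\<exists>h\<in>merge_levels x y. h < t + \<eta>"
proof -
  define U where "U = {z \<in> M. \<sigma> z < t + \<eta>}"
  have "openin mtopology U"
    using openin_continuous_map_preimage[OF continuous_height, of "{..<t + \<eta>}"]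
    by (simp add: U_def)
  then have lpc: "locally_path_connected_space (subtopology mtopology U)"
    by (rule locally_path_connected_space_open_subset[OF locally_path_connected])
  have "C \<subseteq> U" using C(2) \<open>\<eta> > 0\<close> by (force simp: U_def sublevel_def)
  then have "connected_component_of (subtopology mtopology U) x y"
    using C unfolding connected_component_of_def connectedin_subtopology by blast
  then have "path_component_of (subtopology mtopology U) x y"
    using path_component_eq_connected_component_of[OF lpc, of x] by (metis mem_Collect_eq)
  then obtain g where g: "pathin (subtopology mtopology U) g" "g 0 = x" "g 1 = y"
    unfolding path_component_of_def by blast
  have gM: "pathin mtopology g" and gU: "g ` {0..1} \<subseteq> U"
    using g(1) by (auto simp: pathin_subtopology)
  have "continuous_map (top_of_set {0..1}) euclideanreal (\<sigma> \<circ> g)"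
    using gM continuous_height unfolding pathin_def by (rule continuous_map_compose)
  then have "continuous_on {0..1} (\<sigma> \<circ> g)" by simp
  then obtain s where s: "s \<in> {0..1}" "\<And>r. r \<in> {0..1} \<Longrightarrow> (\<sigma> \<circ> g) r \<le> (\<sigma> \<circ> g) s"
    using continuous_attains_sup[of "{0..1::real}" "\<sigma> \<circ> g"] by auto
  have con: "connectedin mtopology (g ` {0..1})"
    using gM unfolding pathin_def
    by (rule connectedin_continuous_map_image) (simp add: connectedin_absolute)
  have sub: "g ` {0..1} \<subseteq> sublevel M \<sigma> (\<sigma> (g s))"
    using s gU by (auto simp: sublevel_def U_def)
  have 01: "x \<in> g ` {0..1}" "y \<in> g ` {0..1}" "g s \<in> g ` {0..1}"
    using g s by (auto intro: image_eqI[of _ _ 0] image_eqI[of _ _ 1])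
  then have "below x (g s)" "below y (g s)"
    unfolding below_def using con sub by blast+
  moreover have "g s \<in> U" using gU s(1) by blast
  then have "g s \<in> M" "\<sigma> (g s) < t + \<eta>" by (auto simp: U_def)
  ultimately show ?thesis by (auto simp: merge_levels_def)
qed

text \<open>The bound \<open>t\<close> need not be a value of \<open>\<sigma>\<close>, whereas
  \<open>merge_levels\<close> contains only heights of actual points. Later estimates are thereby
  freed from finding a common upper point: any connected set will do.\<close>

lemma merge_level_le:
  assumes C: "connectedin mtopology C" "C \<subseteq> sublevel M \<sigma> t" "x \<in> C" "y \<in> C"
  shows "merge_level x y \<le> t"
proof (rule field_le_epsilon)
  fix \<eta> :: real assume "\<eta> > 0"
  then obtain h where "h \<in> merge_levels x y" "h < t + \<eta>"
    using merge_level_below_connected[OF assms] by blast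
  then show "merge_level x y \<le> t + \<eta>"
    unfolding merge_level_def using cInf_lower[OF _ bdd_below_merge_levels] by force
qed

text \<open>Guards the real infimum, which is unspecified on the empty set. A path is compact, so
  \<open>\<sigma>\<close> is bounded on it and its image is a connected witness.\<close>

lemma merge_levels_nonempty:
  assumes "x \<in> M" "y \<in> M"
  shows "merge_levels x y \<noteq> {}"
proof -
  obtain g where g: "pathin mtopology g" "g 0 = x" "g 1 = y"
    using path_connected assms unfolding path_connected_space_def by auto
  have "continuous_map (top_of_set {0..1}) euclideanreal (\<sigma> \<circ> g)"
    using g(1) continuous_height unfolding pathin_def by (rule continuous_map_compose)
  then have "continuous_on {0..1} (\<sigma> \<circ> g)" by simp
  then obtain s where s: "s \<in> {0..1}" "\<And>r. r \<in> {0..1} \<Longrightarrow> (\<sigma> \<circ> g) r \<le> (\<sigma> \<circ> g) s"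
    using continuous_attains_sup[of "{0..1::real}" "\<sigma> \<circ> g"] by auto
  have con: "connectedin mtopology (g ` {0..1})"
    using g(1) unfolding pathin_def
    by (rule connectedin_continuous_map_image) (simp add: connectedin_absolute)
  have "g ` {0..1} \<subseteq> sublevel M \<sigma> (\<sigma> (g s))"
    using s connectedin_subset_topspace[OF con] by (auto simp: sublevel_def)
  moreover have "x \<in> g ` {0..1}" "y \<in> g ` {0..1}"
    using g by (auto intro: image_eqI[of _ _ 0] image_eqI[of _ _ 1])
  ultimately show ?thesis
    using merge_level_below_connected[OF con, of "\<sigma> (g s)" x y 1] by auto
qed

lemma merge_level_lower: "x \<in> M \<Longrightarrow> y \<in> M \<Longrightarrow> \<sigma> x \<le> merge_level x y \<and> \<sigma> y \<le> merge_level x y"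
  unfolding merge_level_def
  using merge_levels_nonempty merge_levels_lower by (meson cInf_greatest)

lemma merge_level_sym: "merge_level x y = merge_level y x"
  by (simp add: merge_level_def merge_levels_def conj_commute)

lemma merge_level_self: "x \<in> M \<Longrightarrow> merge_level x x = \<sigma> x"
  by (rule antisym, rule merge_level_le[of "{x}"])
     (auto simp: connectedin_sing sublevel_def merge_level_lower)

lemma merge_level_attained:
  assumes "x \<in> M" "y \<in> M" "\<eta> > 0"
  shows "\<exists>C t. connectedin mtopology C \<and> C \<subseteq> sublevel M \<sigma> t \<and> x \<in> C \<and> y \<in> C
           \<and> t < merge_level x y + \<eta>"
proof -
  have "Inf (merge_levels x y) < merge_level x y + \<eta>"
    using \<open>\<eta> > 0\<close> by (simp add: merge_level_def)
  then obtain h where "h \<in> merge_levels x y" "h < merge_level x y + \<eta>"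
    using cInf_lessD[OF merge_levels_nonempty[OF assms(1,2)]] by blast
  then obtain z where z: "below x z" "below y z" "\<sigma> z < merge_level x y + \<eta>"
    by (auto simp: merge_levels_def)
  obtain C where C: "connectedin mtopology C" "C \<subseteq> sublevel M \<sigma> (\<sigma> z)" "x \<in> C" "z \<in> C"
    using z(1) unfolding below_def by blast
  obtain C' where C': "connectedin mtopology C'" "C' \<subseteq> sublevel M \<sigma> (\<sigma> z)" "y \<in> C'" "z \<in> C'"
    using z(2) unfolding below_def by blast
  have "connectedin mtopology (C \<union> C')"
    using C C' by (intro connectedin_Un) auto
  then show ?thesis
    using C C' z(3) by (intro exI[of _ "C \<union> C'"] exI[of _ "\<sigma> z"]) auto
qed

text \<open>Witnesses for \<open>x\<close>, \<open>y\<close> and for \<open>y\<close>,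
  \<open>z\<close> share \<open>y\<close>, so their union is connected, at the larger of the two
  levels.\<close>

lemma merge_level_ultra:
  assumes "x \<in> M" "y \<in> M" "z \<in> M"
  shows "merge_level x z \<le> max (merge_level x y) (merge_level y z)"
proof (rule field_le_epsilon)
  fix \<eta> :: real assume "\<eta> > 0"
  obtain C t where C: "connectedin mtopology C" "C \<subseteq> sublevel M \<sigma> t" "x \<in> C" "y \<in> C"
      "t < merge_level x y + \<eta>"
    using merge_level_attained[OF assms(1,2) \<open>\<eta> > 0\<close>] by blast
  obtain C' t' where C': "connectedin mtopology C'" "C' \<subseteq> sublevel M \<sigma> t'" "y \<in> C'" "z \<in> C'"
      "t' < merge_level y z + \<eta>"
    using merge_level_attained[OF assms(2,3) \<open>\<eta> > 0\<close>] by blast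
  have "connectedin mtopology (C \<union> C')"
    using C C' by (intro connectedin_Un) auto
  moreover have "C \<union> C' \<subseteq> sublevel M \<sigma> (max t t')"
    using C C' by (auto simp: sublevel_def)
  ultimately have "merge_level x z \<le> max t t'"
    using C(3) C'(4) by (intro merge_level_le[of "C \<union> C'"]) auto
  then show "merge_level x z \<le> max (merge_level x y) (merge_level y z) + \<eta>"
    using C(5) C'(5) by linarith
qed

text \<open>Since \<open>max (c - a) (c - b) = c - min a b\<close>, the infimum in the distance acts
  on the height of the upper point alone and becomes the merge level.\<close>

lemma tree_dist_proj:
  assumes "x \<in> M" "y \<in> M"
  shows "tree_dist (proj x) (proj y) = merge_level x y - min (\<sigma> x) (\<sigma> y)"
proof -
  have "tree_dist (proj x) (proj y) =
      (INF z \<in> {z \<in> M. below x z \<and> below y z}. \<sigma> z + - min (\<sigma> x) (\<sigma> y))"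
    unfolding merge_dist_def merge_upper_proj[OF assms] image_image
    using assms by (intro INF_cong) (auto simp: merge_height_proj max_def min_def)
  also have "\<dots> = Inf ((\<lambda>h. - min (\<sigma> x) (\<sigma> y) + h) ` merge_levels x y)"
    by (simp add: merge_levels_def image_image add.commute)
  also have "\<dots> = merge_level x y - min (\<sigma> x) (\<sigma> y)"
    unfolding merge_level_def using merge_levels_nonempty[OF assms] bdd_below_merge_levels
    by (subst Inf_add_eq) (auto simp: Inf_add_eq)
  finally show ?thesis .
qed

lemma pseudo_metric_tree_dist: "pseudo_metric_on (merge_tree M d \<sigma>) tree_dist"
  unfolding pseudo_metric_on_def merge_tree_eq
proof (intro conjI ballI; clarify)
  fix x y assume xy: "x \<in> M" "y \<in> M"
  show "0 \<le> tree_dist (proj x) (proj y)"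
    using merge_level_lower[OF xy] by (auto simp: tree_dist_proj xy)
  show "tree_dist (proj x) (proj y) = tree_dist (proj y) (proj x)"
    by (simp add: tree_dist_proj xy merge_level_sym[of x y] min.commute)
  show "tree_dist (proj x) (proj x) = 0"
    by (simp add: tree_dist_proj xy merge_level_self)
  fix z assume z: "z \<in> M"
  \<comment> \<open>One of the two levels on the right dominates the level on the left. The other is
    at least the heights of its own end points, which pays for the differences of the
    minima.\<close>
  show "tree_dist (proj x) (proj z) \<le> tree_dist (proj x) (proj y) + tree_dist (proj y) (proj z)"
    using merge_level_lower[OF xy] merge_level_lower[OF xy(2) z]
      merge_level_ultra[OF xy z, unfolded le_max_iff_disj]
    by (elim disjE) (simp_all add: tree_dist_proj xy z min_def)
qed

lemma tree_dist_path_bound: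
  assumes "connectedin mtopology C" "x \<in> C" "y \<in> C"
    and "\<And>z. z \<in> C \<Longrightarrow> \<sigma> z \<le> min (\<sigma> x) (\<sigma> y) + r"
  shows "tree_dist (proj x) (proj y) \<le> r"
proof -
  have CM: "C \<subseteq> M" using connectedin_subset_topspace[OF assms(1)] by simp
  then have "merge_level x y \<le> min (\<sigma> x) (\<sigma> y) + r"
    using assms by (intro merge_level_le[of C]) (auto simp: sublevel_def)
  then show ?thesis using CM assms by (simp add: tree_dist_proj subset_iff)
qed

end

text \<open>A connected witness for \<open>\<sigma>\<close> at level \<open>t\<close> is one for
  \<open>\<sigma>'\<close> at level \<open>t + e\<close>. The merge level and the minimum of the
  heights in \<open>tree_dist_proj\<close> move by at most \<open>e\<close> each, hence
  \<open>2 * e\<close>.\<close>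

lemma merge_dist_stable:
  assumes "merge_setting M d \<sigma>" "merge_setting M d \<sigma>'"
    and close: "\<And>x. x \<in> M \<Longrightarrow> \<bar>\<sigma> x - \<sigma>' x\<bar> \<le> e"
    and xy: "x \<in> M" "y \<in> M"
  shows "merge_dist M d \<sigma>' (merge_proj M d \<sigma>' x) (merge_proj M d \<sigma>' y)
    \<le> merge_dist M d \<sigma> (merge_proj M d \<sigma> x) (merge_proj M d \<sigma> y) + 2 * e"
proof -
  interpret A: merge_setting M d \<sigma> by fact
  interpret B: merge_setting M d \<sigma>' by fact
  have "B.merge_level x y \<le> A.merge_level x y + e"
  proof (rule field_le_epsilon)
    fix \<eta> :: real assume "\<eta> > 0"
    then obtain C t where C: "connectedin A.mtopology C" "C \<subseteq> sublevel M \<sigma> t" "x \<in> C" "y \<in> C"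
        "t < A.merge_level x y + \<eta>"
      using A.merge_level_attained[OF xy] by blast
    have "C \<subseteq> sublevel M \<sigma>' (t + e)"
      using C(2) close by (fastforce simp: sublevel_def abs_le_iff)
    then have "B.merge_level x y \<le> t + e"
      using C by (intro B.merge_level_le) auto
    then show "B.merge_level x y \<le> A.merge_level x y + e + \<eta>"
      using C(5) by linarith
  qed
  then show ?thesis
    using close[OF xy(1)] close[OF xy(2)] by (simp add: A.tree_dist_proj B.tree_dist_proj xy)
qed

text \<open>A path that nearly realises \<open>conn_radius\<close> stays within about
  \<open>k * d x y\<close> of both ends, so \<open>\<sigma>\<close> climbs at most \<open>L\<close>
  times that above either end.\<close>

lemma (in merge_setting) tree_dist_Lipschitz:
  assumes lip: "\<And>x y. x \<in> M \<Longrightarrow> y \<in> M \<Longrightarrow> \<bar>\<sigma> x - \<sigma> y\<bar> \<le> L * d x y" and "L > 0"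
    and K: "connectivity_modulus M d < \<infinity>" and xy: "x \<in> M" "y \<in> M"
  shows "tree_dist (proj x) (proj y) \<le> L * (enn2real (connectivity_modulus M d) * d x y)"
proof (cases "x = y")
  case True
  then show ?thesis
    using xy by (simp add: tree_dist_proj merge_level_self)
next
  case False
  define k where "k = enn2real (connectivity_modulus M d)"
  have dpos: "d x y > 0" using False xy by auto
  have "conn_radius M d x y / ennreal (d x y) \<le> connectivity_modulus M d"
    unfolding connectivity_modulus_def using False xy by (intro SUP_upper2[of "(x, y)"]) auto
  also have "\<dots> = ennreal k" using K by (simp add: k_def)
  finally have "conn_radius M d x y / ennreal (d x y) * ennreal (d x y) \<le> ennreal k * ennreal (d x y)"
    by (rule mult_right_mono) simp
  moreover have "conn_radius M d x y / ennreal (d x y) * ennreal (d x y) = conn_radius M d x y"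
    using dpos by (simp add: ennreal_divide_times ennreal_mult_divide_eq)
  ultimately have cr: "conn_radius M d x y \<le> ennreal (k * d x y)"
    using dpos by (simp add: ennreal_mult'')
  have k0: "k \<ge> 0" by (simp add: k_def)
  have "tree_dist (proj x) (proj y) \<le> L * (k * d x y) + \<eta>" if "\<eta> > 0" for \<eta>
  proof -
    \<comment> \<open>The infimum over paths need not be attained; slack \<open>\<eta> / L\<close>
      in the radius becomes \<open>\<eta>\<close> in height.\<close>
    have "ennreal (k * d x y) < ennreal (k * d x y + \<eta> / L)"
      using \<open>\<eta> > 0\<close> \<open>L > 0\<close> k0 dpos by (intro ennreal_lessI add_nonneg_pos) auto
    then have "conn_radius M d x y < ennreal (k * d x y + \<eta> / L)"
      using cr by (rule order.strict_trans1[rotated])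
    then obtain g where g: "g \<in> paths_between M d x y"
      and "(SUP t \<in> {0..1}. ennreal (max (d x (g t)) (d (g t) y))) < ennreal (k * d x y + \<eta> / L)"
      unfolding conn_radius_def by (auto simp: INF_less_iff)
    then have b: "ennreal (max (d x (g t)) (d (g t) y)) \<le> ennreal (k * d x y + \<eta> / L)"
      if "t \<in> {0..1}" for t
      using that by (meson SUP_upper less_le order_trans)
    have "0 \<le> k * d x y + \<eta> / L"
      using k0 dpos \<open>\<eta> > 0\<close> \<open>L > 0\<close> by simp
    then have r: "d x (g t) \<le> k * d x y + \<eta> / L" "d (g t) y \<le> k * d x y + \<eta> / L"
      if "t \<in> {0..1}" for t
      using b[OF that] by (simp_all add: ennreal_le_iff)
    have p: "pathin mtopology g" "g 0 = x" "g 1 = y"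
      using g by (auto simp: paths_between_def)
    have con: "connectedin mtopology (g ` {0..1})"
      using p(1) unfolding pathin_def
      by (rule connectedin_continuous_map_image) (simp add: connectedin_absolute)
    then have gM: "g t \<in> M" if "t \<in> {0..1}" for t
      using connectedin_subset_topspace[OF con] that by auto
    show ?thesis
    proof (rule tree_dist_path_bound[OF con])
      show "x \<in> g ` {0..1}" "y \<in> g ` {0..1}"
        using p by (auto intro: image_eqI[of _ _ 0] image_eqI[of _ _ 1])
      fix z assume "z \<in> g ` {0..1}"
      then obtain t where t: "t \<in> {0..1}" "z = g t" by blast
      \<comment> \<open>Both ends enter: the maximum in \<open>conn_radius\<close> is what bounds
        the rise above the lower of the two heights.\<close>
      have "\<sigma> z \<le> \<sigma> x + L * d x z" "\<sigma> z \<le> \<sigma> y + L * d z y"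
        using lip[of x z] lip[of z y] gM t xy by fastforce+
      moreover have "L * d x z \<le> L * (k * d x y + \<eta> / L)" "L * d z y \<le> L * (k * d x y + \<eta> / L)"
        using r[OF t(1)] \<open>L > 0\<close> t by auto
      moreover have "L * (k * d x y + \<eta> / L) = L * (k * d x y) + \<eta>"
        using \<open>L > 0\<close> by (simp add: field_simps)
      ultimately show "\<sigma> z \<le> min (\<sigma> x) (\<sigma> y) + (L * (k * d x y) + \<eta>)"
        by linarith
    qed
  qed
  then show ?thesis
    unfolding k_def[symmetric] by (rule field_le_epsilon)
qed

section \<open>Minkowski inequality and Borel measurability\<close>

text \<open>Convexity of the \<open>p\<close>-th power with weights \<open>A / (A + B)\<close> and
  \<open>B / (A + B)\<close>, applied to \<open>u * (A + B) / A\<close> and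
  \<open>v * (A + B) / B\<close>. With norm bounds for \<open>A\<close> and \<open>B\<close> this is
  the pointwise form of Minkowski's inequality.\<close>

lemma powr_add_le_weighted:
  fixes u v A B p :: real
  assumes "0 \<le> u" "0 \<le> v" "0 < A" "0 < B" "1 \<le> p"
  shows "(u + v) powr p \<le>
    (A + B) powr (p - 1) * A powr (1 - p) * u powr p + (A + B) powr (p - 1) * B powr (1 - p) * v powr p"
proof -
  \<comment> \<open>Serves the cases \<open>u = 0\<close> and \<open>v = 0\<close>, which are kept
    apart from the convexity argument for positive numbers.\<close>
  have ge1: "1 \<le> (A + B) powr (p - 1) * A powr (1 - p)" if "0 < A" "0 < B" for A B :: real
  proof -
    have "A powr (p - 1) \<le> (A + B) powr (p - 1)"
      using that assms by (intro powr_mono2) auto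
    then have "A powr (p - 1) * A powr (1 - p) \<le> (A + B) powr (p - 1) * A powr (1 - p)"
      by (intro mult_right_mono) auto
    then show ?thesis using that by (simp flip: powr_add)
  qed
  consider "u = 0" | "v = 0" | "u > 0" "v > 0" using assms by fastforce
  then show ?thesis
  proof cases
    case 1
    have "1 * v powr p \<le> (B + A) powr (p - 1) * B powr (1 - p) * v powr p"
      using ge1[of B A] assms by (intro mult_right_mono) auto
    then show ?thesis using 1 by (simp add: add.commute)
  next
    case 2
    have "1 * u powr p \<le> (A + B) powr (p - 1) * A powr (1 - p) * u powr p"
      using ge1[of A B] assms by (intro mult_right_mono) auto
    then show ?thesis using 2 by simp
  next
    case 3
    define S where "S = A + B"
    have S: "S > 0" using assms by (simp add: S_def)
    have w: "A / S + B / S = 1" using S by (simp add: S_def flip: add_divide_distrib)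
    have "1 - B / S = A / S" using w by linarith
    then have "(A / S * (u * S / A) + B / S * (v * S / B)) powr p
        \<le> A / S * (u * S / A) powr p + B / S * (v * S / B) powr p"
      using convex_onD[OF powr_convex[OF assms(5)], of "B / S" "u * S / A" "v * S / B"] S assms 3
      by (simp add: S_def)
    moreover have "A / S * (u * S / A) + B / S * (v * S / B) = u + v"
      using S assms by simp
    moreover have "a / S * (x * S / a) powr p = S powr (p - 1) * a powr (1 - p) * x powr p"
      if "a > 0" "x > 0" for a x
      using that S by (simp add: powr_mult powr_divide powr_diff)
    ultimately show ?thesis using 3 assms by (simp add: S_def)
  qed
qed

text \<open>Bounds \<open>A\<close>, \<open>B\<close> in place of norms avoid roots of possibly
  infinite integrals. The weights divide by \<open>A\<close> and \<open>B\<close>, so both are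
  positive; callers whose norm may vanish add a small amount first.\<close>

lemma Minkowski_nn_integral:
  fixes u v :: "'b \<Rightarrow> real"
  assumes [measurable]: "u \<in> borel_measurable N" "v \<in> borel_measurable N"
    and nonneg: "\<And>x. x \<in> space N \<Longrightarrow> 0 \<le> u x" "\<And>x. x \<in> space N \<Longrightarrow> 0 \<le> v x"
    and AB: "0 < A" "0 < B" and p: "1 \<le> p"
    and u: "(\<integral>\<^sup>+ x. ennreal (u x powr p) \<partial>N) \<le> ennreal (A powr p)"
    and v: "(\<integral>\<^sup>+ x. ennreal (v x powr p) \<partial>N) \<le> ennreal (B powr p)"
  shows "(\<integral>\<^sup>+ x. ennreal ((u x + v x) powr p) \<partial>N) \<le> ennreal ((A + B) powr p)"
proof -
  define a where "a = (A + B) powr (p - 1) * A powr (1 - p)"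
  define b where "b = (A + B) powr (p - 1) * B powr (1 - p)"
  have ab: "0 \<le> a" "0 \<le> b" by (auto simp: a_def b_def)
  have "(\<integral>\<^sup>+ x. ennreal ((u x + v x) powr p) \<partial>N)
      \<le> (\<integral>\<^sup>+ x. ennreal a * ennreal (u x powr p) + ennreal b * ennreal (v x powr p) \<partial>N)"
  proof (rule nn_integral_mono)
    fix x assume "x \<in> space N"
    then have "(u x + v x) powr p \<le> a * u x powr p + b * v x powr p"
      unfolding a_def b_def using nonneg AB p by (intro powr_add_le_weighted) auto
    then show "ennreal ((u x + v x) powr p)
        \<le> ennreal a * ennreal (u x powr p) + ennreal b * ennreal (v x powr p)"
      using ab by (simp add: ennreal_leI flip: ennreal_mult ennreal_plus)
  qed
  also have "\<dots> = ennreal a * (\<integral>\<^sup>+ x. ennreal (u x powr p) \<partial>N)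
      + ennreal b * (\<integral>\<^sup>+ x. ennreal (v x powr p) \<partial>N)"
    by (simp add: nn_integral_add nn_integral_cmult)
  also have "\<dots> \<le> ennreal a * ennreal (A powr p) + ennreal b * ennreal (B powr p)"
    using u v by (intro add_mono mult_left_mono) auto
  also have "\<dots> = ennreal (a * A powr p + b * B powr p)"
    using ab by (simp flip: ennreal_mult ennreal_plus)
  \<comment> \<open>The weights are made for this collapse: \<open>A powr (1 - p)\<close> turns
    \<open>A powr p\<close> into \<open>A\<close>, and the two summands add up to
    \<open>A + B\<close>.\<close>
  also have "a * A powr p + b * B powr p = (A + B) powr p"
  proof -
    have "a * A powr p = (A + B) powr (p - 1) * A" "b * B powr p = (A + B) powr (p - 1) * B"
      using AB by (simp_all add: a_def b_def mult.assoc flip: powr_add)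
    then have "a * A powr p + b * B powr p = (A + B) powr (p - 1) * (A + B) powr 1"
      using AB by (simp add: distrib_left)
    then show ?thesis unfolding powr_add[symmetric] by simp
  qed
  finally show ?thesis .
qed

section \<open>Borel sigma-algebras, couplings and measurability on products\<close>

lemma space_borel_of [simp]: "space (borel_of T) = topspace T"
  by (simp add: borel_of_def space_measure_of_conv)

lemma sets_borel_of: "sets (borel_of T) = sigma_sets (topspace T) {U. openin T U}"
  unfolding borel_of_def by (intro sets_measure_of) (auto dest: openin_subset)

lemma openin_in_sets_borel_of [intro]: "openin T U \<Longrightarrow> U \<in> sets (borel_of T)"
  by (simp add: sets_borel_of sigma_sets.Basic)

lemma measurable_borel_ofI:
  assumes "\<And>x. x \<in> space N \<Longrightarrow> f x \<in> topspace T"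
    and "\<And>U. openin T U \<Longrightarrow> f -` U \<inter> space N \<in> sets N"
  shows "f \<in> measurable N (borel_of T)"
  unfolding borel_of_def
  by (rule measurable_sigma_sets[OF sets_measure_of])
     (use assms in \<open>auto dest: openin_subset simp: borel_of_def\<close>)

lemma measurable_continuous_map:
  assumes "continuous_map S T f" and "sets N = sets (borel_of S)"
  shows "f \<in> measurable N (borel_of T)"
proof (rule measurable_borel_ofI)
  have N: "space N = topspace S" using sets_eq_imp_space_eq[OF assms(2)] by simp
  fix x assume "x \<in> space N"
  then show "f x \<in> topspace T" using assms(1) N by (auto simp: continuous_map_def)
next
  have N: "space N = topspace S" using sets_eq_imp_space_eq[OF assms(2)] by simp
  fix U assume "openin T U"
  then have "openin S {x \<in> topspace S. f x \<in> U}"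
    using assms(1) by (simp add: continuous_map_def)
  moreover have "f -` U \<inter> space N = {x \<in> topspace S. f x \<in> U}" using N by auto
  ultimately show "f -` U \<inter> space N \<in> sets N" using assms(2) by auto
qed

lemma borel_measurable_continuous_map:
  fixes f :: "'b \<Rightarrow> real"
  assumes "continuous_map S euclideanreal f" and "sets N = sets (borel_of S)"
  shows "f \<in> borel_measurable N"
proof (rule borel_measurableI)
  have N: "space N = topspace S" using sets_eq_imp_space_eq[OF assms(2)] by simp
  fix U :: "real set" assume "open U"
  then have "openin S {x \<in> topspace S. f x \<in> U}"
    using assms(1) by (simp add: continuous_map_def)
  moreover have "f -` U \<inter> space N = {x \<in> topspace S. f x \<in> U}" using N by auto
  ultimately show "f -` U \<inter> space N \<in> sets N" using assms(2) by auto
qed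

text \<open>Couplings live on the product sigma-algebra, where densities and Fubini are available.
  The Kantorovich-Sturm distance asks for Borel sets of a product topology;
  \<open>openin_prod_in_sets\<close> mediates between the two.\<close>

definition is_coupling :: "'a measure \<Rightarrow> 'b measure \<Rightarrow> ('a \<times> 'b) measure \<Rightarrow> bool" where
  "is_coupling \<mu> \<nu> h \<longleftrightarrow> prob_space h \<and> sets h = sets (\<mu> \<Otimes>\<^sub>M \<nu>)
     \<and> distr h \<mu> fst = \<mu> \<and> distr h \<nu> snd = \<nu>"

text \<open>\<open>f\<close> is not assumed measurable, so both sides are lower integrals: a simple
  function below \<open>f\<close> pulls back along \<open>T\<close> to one below the composition.
  This direction suffices for the glued distance on the trees, whose measurability is not
  established.\<close>

lemma nn_integral_distr_le:
  assumes [measurable]: "T \<in> measurable N N'"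
  shows "(\<integral>\<^sup>+ x. f x \<partial>distr N N' T) \<le> (\<integral>\<^sup>+ x. f (T x) \<partial>N)"
  unfolding nn_integral_def[of "distr N N' T"]
proof (rule SUP_least)
  fix g assume "g \<in> {g. simple_function (distr N N' T) g \<and> g \<le> f}"
  then have g: "simple_function (distr N N' T) g" "g \<le> f" by auto
  have "integral\<^sup>S (distr N N' T) g = (\<integral>\<^sup>+ x. g x \<partial>distr N N' T)"
    using g by (simp add: nn_integral_eq_simple_integral)
  also have "\<dots> = (\<integral>\<^sup>+ x. g (T x) \<partial>N)"
    using borel_measurable_simple_function[OF g(1)] by (intro nn_integral_distr) auto
  also have "\<dots> \<le> (\<integral>\<^sup>+ x. f (T x) \<partial>N)"
    using g(2) by (intro nn_integral_mono) (auto simp: le_fun_def)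
  finally show "integral\<^sup>S (distr N N' T) g \<le> (\<integral>\<^sup>+ x. f (T x) \<partial>N)" .
qed

context Metric_space
begin

lemma Lipschitz_imp_continuous_map:
  assumes "\<And>x y. x \<in> M \<Longrightarrow> y \<in> M \<Longrightarrow> \<bar>f x - f y\<bar> \<le> L * d x y"
  shows "continuous_map mtopology euclideanreal f"
  unfolding continuous_map_def
proof (intro conjI allI impI)
  fix U :: "real set" assume "openin euclideanreal U"
  then have U: "open U" by simp
  show "openin mtopology {x \<in> topspace mtopology. f x \<in> U}"
    unfolding openin_mtopology
  proof (intro conjI allI impI)
    fix x assume "x \<in> {x \<in> topspace mtopology. f x \<in> U}"
    then have x: "x \<in> M" "f x \<in> U" by auto
    then obtain e where e: "e > 0" "\<And>y. \<bar>y - f x\<bar> < e \<Longrightarrow> y \<in> U"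
      using U unfolding open_dist dist_real_def by meson
    have "f y \<in> U" if "y \<in> mball x (e / (\<bar>L\<bar> + 1))" for y
    proof (rule e(2))
      have y: "y \<in> M" "d x y < e / (\<bar>L\<bar> + 1)" using that by auto
      have "L * d x y \<le> (\<bar>L\<bar> + 1) * d x y" by (intro mult_right_mono) auto
      also have "\<dots> < e" using y(2) by (simp add: field_simps)
      finally show "\<bar>f y - f x\<bar> < e" using assms[OF x(1) y(1)] by linarith
    qed
    then show "\<exists>r>0. mball x r \<subseteq> {x \<in> topspace mtopology. f x \<in> U}"
      using e(1) by (intro exI[of _ "e / (\<bar>L\<bar> + 1)"]) auto
  qed auto
qed auto

lemma separable_dense:
  assumes "separable_space mtopology"
  obtains C where "countable C" "C \<subseteq> M" "\<And>x r. x \<in> M \<Longrightarrow> r > 0 \<Longrightarrow> \<exists>c\<in>C. d x c < r"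
proof -
  obtain C where C: "countable C" "C \<subseteq> M" "mtopology closure_of C = M"
    using assms by (auto simp: separable_space_def)
  have "\<exists>c\<in>C. d x c < r" if "x \<in> M" "r > 0" for x r
    using C(3) that unfolding metric_closure_of by auto
  with C show thesis using that by blast
qed

text \<open>Separability enters here: balls with centres in a countable dense set and radii
  \<open>1 / Suc k\<close> make an open set of the product a countable union of measurable
  rectangles.\<close>

lemma openin_prod_in_sets:
  assumes sep: "separable_space mtopology"
    and U: "openin (prod_topology mtopology mtopology) U"
  shows "U \<in> sets (borel_of mtopology \<Otimes>\<^sub>M borel_of mtopology)"
proof -
  obtain C where C: "countable C" "C \<subseteq> M" "\<And>x r. x \<in> M \<Longrightarrow> r > 0 \<Longrightarrow> \<exists>c\<in>C. d x c < r"
    using separable_dense[OF sep] by blast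
  define B where "B = (\<lambda>(c, c', k). mball c (1 / Suc k) \<times> mball c' (1 / Suc k))"
  define I where "I = {i \<in> C \<times> C \<times> (UNIV :: nat set). B i \<subseteq> U}"
  have "U \<subseteq> (\<Union>i\<in>I. B i)"
  proof (clarify)
    fix x y assume xy: "(x, y) \<in> U"
    then obtain V W where VW: "openin mtopology V" "openin mtopology W" "x \<in> V" "y \<in> W" "V \<times> W \<subseteq> U"
      using U[unfolded openin_prod_topology_alt, rule_format, OF xy] by auto
    obtain r where r: "r > 0" "mball x r \<subseteq> V"
      using VW(1)[unfolded openin_mtopology] VW(3) by auto
    obtain r' where r': "r' > 0" "mball y r' \<subseteq> W"
      using VW(2)[unfolded openin_mtopology] VW(4) by auto
    have xM: "x \<in> M" "y \<in> M"
      using openin_subset[OF VW(1)] openin_subset[OF VW(2)] VW(3,4) by auto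
    \<comment> \<open>Half of the smaller radius: a centre closer than \<open>1 / Suc k\<close> to
      the point has its ball of that radius inside the given ball.\<close>
    obtain k where k: "1 / Suc k < min r r' / 2"
      using nat_approx_posE[of "min r r' / 2"] r(1) r'(1) by auto
    obtain c where c: "c \<in> C" "d x c < 1 / Suc k" using C(3)[OF xM(1), of "1 / Suc k"] by auto
    obtain c' where c': "c' \<in> C" "d y c' < 1 / Suc k" using C(3)[OF xM(2), of "1 / Suc k"] by auto
    have "mball c (1 / Suc k) \<subseteq> mball x r"
    proof
      fix z assume "z \<in> mball c (1 / Suc k)"
      then have "z \<in> M" "c \<in> M" "d c z < 1 / Suc k" by auto
      then show "z \<in> mball x r" using triangle[of x c z] c k xM by auto
    qed
    moreover have "mball c' (1 / Suc k) \<subseteq> mball y r'"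
    proof
      fix z assume "z \<in> mball c' (1 / Suc k)"
      then have "z \<in> M" "c' \<in> M" "d c' z < 1 / Suc k" by auto
      then show "z \<in> mball y r'" using triangle[of y c' z] c' k xM by auto
    qed
    ultimately have "mball c (1 / Suc k) \<times> mball c' (1 / Suc k) \<subseteq> V \<times> W"
      using r(2) r'(2) by (intro Sigma_mono) (blast intro: subset_trans)+
    then have "B (c, c', k) \<subseteq> U" using VW(5) by (simp add: B_def)
    then have "(c, c', k) \<in> I" using c c' by (simp add: I_def)
    moreover have "(x, y) \<in> B (c, c', k)"
      using c c' xM C(2) by (auto simp: B_def commute)
    ultimately show "(x, y) \<in> (\<Union>i\<in>I. B i)" by blast
  qed
  then have "U = (\<Union>i\<in>I. B i)" by (auto simp: I_def)
  moreover have "countable I"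
    by (rule countable_subset[of _ "C \<times> C \<times> UNIV"]) (use C(1) in \<open>auto simp: I_def\<close>)
  moreover have "B i \<in> sets (borel_of mtopology \<Otimes>\<^sub>M borel_of mtopology)" for i
    by (cases i) (auto simp: B_def)
  ultimately show ?thesis by (metis sets.countable_UN'')
qed

lemma measurable_prod_continuous_map:
  assumes "separable_space mtopology"
    and "sets \<mu> = sets (borel_of mtopology)" "sets \<nu> = sets (borel_of mtopology)"
    and f: "continuous_map (prod_topology mtopology mtopology) T f"
  shows "f \<in> measurable (\<mu> \<Otimes>\<^sub>M \<nu>) (borel_of T)"
proof (rule measurable_borel_ofI)
  have sp: "space (\<mu> \<Otimes>\<^sub>M \<nu>) = M \<times> M"
    using sets_eq_imp_space_eq[OF assms(2)] sets_eq_imp_space_eq[OF assms(3)]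
    by (simp add: space_pair_measure)
  fix x assume "x \<in> space (\<mu> \<Otimes>\<^sub>M \<nu>)"
  then show "f x \<in> topspace T" using f sp unfolding continuous_map_def by auto
next
  have sp: "space (\<mu> \<Otimes>\<^sub>M \<nu>) = M \<times> M"
    using sets_eq_imp_space_eq[OF assms(2)] sets_eq_imp_space_eq[OF assms(3)]
    by (simp add: space_pair_measure)
  fix U assume "openin T U"
  then have "openin (prod_topology mtopology mtopology) {x \<in> M \<times> M. f x \<in> U}"
    using f by (simp add: continuous_map_def)
  moreover have "f -` U \<inter> space (\<mu> \<Otimes>\<^sub>M \<nu>) = {x \<in> M \<times> M. f x \<in> U}" using sp by auto
  ultimately show "f -` U \<inter> space (\<mu> \<Otimes>\<^sub>M \<nu>) \<in> sets (\<mu> \<Otimes>\<^sub>M \<nu>)"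
    using openin_prod_in_sets[OF assms(1)] sets_pair_measure_cong[OF assms(2,3)] by auto
qed

lemma borel_measurable_dist_pair:
  assumes "separable_space mtopology"
    and "sets \<mu> = sets (borel_of mtopology)" "sets \<nu> = sets (borel_of mtopology)"
  shows "(\<lambda>z. d (fst z) (snd z)) \<in> borel_measurable (\<mu> \<Otimes>\<^sub>M \<nu>)"
proof -
  have "continuous_map (prod_topology mtopology mtopology) euclideanreal (\<lambda>z. d (fst z) (snd z))"
    using continuous_map_mdist[of "prod_topology mtopology mtopology" "metric (M, d)" fst snd]
    by (simp add: continuous_map_fst continuous_map_snd)
  from measurable_prod_continuous_map[OF assms this]
  show ?thesis
    by (simp add: measurable_def borel_of_def borel_def)
qed

end

section \<open>Deviation functions\<close>

lemma powr_le_powr_cancel: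
  fixes a b p :: real
  assumes "a powr p \<le> b powr p" "0 \<le> a" "0 < b" "0 < p"
  shows "a \<le> b"
  using assms powr_less_mono2[of p b a] by fastforce

lemma ennreal_powr_bound:
  assumes "x < \<infinity>" "1 \<le> p"
  obtains A :: real where "0 < A" "x \<le> ennreal (A powr p)"
proof
  \<comment> \<open>The summand 1 keeps \<open>A\<close> positive when \<open>x = 0\<close>, as
    \<open>Minkowski_nn_integral\<close> demands.\<close>
  define A where "A = enn2real x powr (1 / p) + 1"
  show "0 < A" by (simp add: A_def add_nonneg_pos)
  have "enn2real x = (enn2real x powr (1 / p)) powr p"
    using assms by (simp add: powr_powr)
  also have "\<dots> \<le> A powr p" using assms by (intro powr_mono2) (auto simp: A_def)
  finally have "ennreal (enn2real x) \<le> ennreal (A powr p)" by (rule ennreal_leI)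
  then show "x \<le> ennreal (A powr p)"
    using assms(1) by (simp add: ennreal_enn2real_if less_top split: if_splits)
qed

locale bmt_setting = Metric_space M d
  for M :: "'a set" and d :: "'a \<Rightarrow> 'a \<Rightarrow> real" +
  fixes \<theta> :: "'a \<Rightarrow> 'a \<Rightarrow> real" and p L :: real
  assumes p_ge_1: "1 \<le> p" and L_pos: "0 < L"
    and separable: "separable_space mtopology"
    and connected: "connected_space mtopology"
    and locally_path_connected: "locally_path_connected_space mtopology"
    and modulus_finite: "connectivity_modulus M d < \<infinity>"
    and admissible: "admissible L M d \<theta>"
begin

lemma theta_nonneg: "x \<in> M \<Longrightarrow> y \<in> M \<Longrightarrow> 0 \<le> \<theta> x y"
  and theta_commute: "x \<in> M \<Longrightarrow> y \<in> M \<Longrightarrow> \<theta> x y = \<theta> y x"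
  and theta_triangle: "x \<in> M \<Longrightarrow> y \<in> M \<Longrightarrow> z \<in> M \<Longrightarrow> \<theta> x z \<le> \<theta> x y + \<theta> y z"
  and theta_le: "x \<in> M \<Longrightarrow> y \<in> M \<Longrightarrow> \<theta> x y \<le> L * d x y"
  using admissible by (auto simp: admissible_def pseudo_metric_on_def)

lemma theta_Lipschitz:
  assumes "x \<in> M" "y \<in> M" "z \<in> M"
  shows "\<bar>\<theta> x y - \<theta> x z\<bar> \<le> L * d y z"
  using theta_triangle[OF assms] theta_triangle[of x z y] theta_commute[of y z] theta_le[of y z] assms
  by linarith

abbreviation "moments \<equiv> borel_prob_moment M d p"

lemma moments_prob: "\<mu> \<in> moments \<Longrightarrow> prob_space \<mu>"
  and moments_space: "\<mu> \<in> moments \<Longrightarrow> space \<mu> = M"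
  and moments_sets: "\<mu> \<in> moments \<Longrightarrow> sets \<mu> = sets (borel_of mtopology)"
  by (auto simp: borel_prob_moment_def)

lemma borel_measurable_dist: "\<mu> \<in> moments \<Longrightarrow> x \<in> M \<Longrightarrow> d x \<in> borel_measurable \<mu>"
proof (rule borel_measurable_continuous_map[OF Lipschitz_imp_continuous_map[of _ 1]])
  fix y z assume "x \<in> M" "y \<in> M" "z \<in> M"
  then show "\<bar>d x y - d x z\<bar> \<le> 1 * d y z"
    using triangle[of x y z] triangle[of x z y] commute[of y z] by simp
qed (simp_all add: moments_sets)

lemma borel_measurable_theta: "\<mu> \<in> moments \<Longrightarrow> x \<in> M \<Longrightarrow> \<theta> x \<in> borel_measurable \<mu>"
  by (rule borel_measurable_continuous_map[OF Lipschitz_imp_continuous_map[of _ L]])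
     (simp_all add: moments_sets theta_Lipschitz)

lemma moment_finite:
  assumes \<mu>: "\<mu> \<in> moments" and x: "x \<in> M"
  shows "(\<integral>\<^sup>+ y. ennreal (d x y powr p) \<partial>\<mu>) < \<infinity>"
proof -
  interpret prob_space \<mu> using \<mu> by (rule moments_prob)
  obtain x0 where x0: "x0 \<in> M" "(\<integral>\<^sup>+ y. ennreal (d x0 y powr p) \<partial>\<mu>) < \<infinity>"
    using \<mu> by (auto simp: borel_prob_moment_def)
  obtain A where A: "0 < A" "(\<integral>\<^sup>+ y. ennreal (d x0 y powr p) \<partial>\<mu>) \<le> ennreal (A powr p)"
    using ennreal_powr_bound[OF x0(2) p_ge_1] by blast
  have [measurable]: "d x0 \<in> borel_measurable \<mu>"
    using borel_measurable_dist[OF \<mu> x0(1)] .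
  have c: "(\<integral>\<^sup>+ y. ennreal (d x x0 powr p) \<partial>\<mu>) \<le> ennreal ((d x x0 + 1) powr p)"
    using p_ge_1 by (simp add: emeasure_space_1 ennreal_leI powr_mono2)
  have "(\<integral>\<^sup>+ y. ennreal (d x y powr p) \<partial>\<mu>) \<le> (\<integral>\<^sup>+ y. ennreal ((d x x0 + d x0 y) powr p) \<partial>\<mu>)"
    using x x0 p_ge_1
    by (intro nn_integral_mono ennreal_leI powr_mono2) (auto simp: moments_space[OF \<mu>] triangle)
  also have "\<dots> \<le> ennreal ((d x x0 + 1 + A) powr p)"
    using Minkowski_nn_integral[OF _ _ _ _ _ A(1) p_ge_1 c A(2)] by (simp add: add_nonneg_pos)
  also have "\<dots> < \<infinity>" by simp
  finally show ?thesis .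
qed

lemma deviation_nonneg: "0 \<le> p_deviation p \<theta> \<mu> x"
  by (simp add: p_deviation_def)

text \<open>The Bochner integral in \<open>p_deviation\<close> has the default value 0 on
  non-integrable functions. Domination of \<open>\<theta>\<close> by \<open>L * d\<close> rules this
  out, and from here on only nonnegative integrals are used.\<close>

lemma deviation_powr:
  assumes \<mu>: "\<mu> \<in> moments" and x: "x \<in> M"
  shows "(\<integral>\<^sup>+ y. ennreal (\<theta> x y powr p) \<partial>\<mu>) = ennreal (p_deviation p \<theta> \<mu> x powr p)"
proof -
  have [measurable]: "\<theta> x \<in> borel_measurable \<mu>" "d x \<in> borel_measurable \<mu>"
    using borel_measurable_theta[OF \<mu> x] borel_measurable_dist[OF \<mu> x] by auto
  have "(\<integral>\<^sup>+ y. ennreal (\<theta> x y powr p) \<partial>\<mu>) \<le> (\<integral>\<^sup>+ y. ennreal (L powr p) * ennreal (d x y powr p) \<partial>\<mu>)"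
  proof (rule nn_integral_mono)
    fix y assume "y \<in> space \<mu>"
    then have y: "y \<in> M" by (simp add: moments_space[OF \<mu>])
    have "\<theta> x y powr p \<le> (L * d x y) powr p"
      using x y p_ge_1 by (intro powr_mono2) (auto simp: theta_nonneg theta_le)
    then show "ennreal (\<theta> x y powr p) \<le> ennreal (L powr p) * ennreal (d x y powr p)"
      using L_pos by (simp add: powr_mult ennreal_leI flip: ennreal_mult)
  qed
  also have "\<dots> = ennreal (L powr p) * (\<integral>\<^sup>+ y. ennreal (d x y powr p) \<partial>\<mu>)"
    by (simp add: nn_integral_cmult)
  also have "\<dots> < \<infinity>" using moment_finite[OF \<mu> x] by (simp add: ennreal_mult_less_top)
  finally have "integrable \<mu> (\<lambda>y. \<theta> x y powr p)"
    by (intro integrableI_nonneg) auto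
  then have "(\<integral>\<^sup>+ y. ennreal (\<theta> x y powr p) \<partial>\<mu>) = ennreal (\<integral> y. \<theta> x y powr p \<partial>\<mu>)"
    by (intro nn_integral_eq_integral) auto
  also have "(\<integral> y. \<theta> x y powr p \<partial>\<mu>) = p_deviation p \<theta> \<mu> x powr p"
    using p_ge_1 by (simp add: p_deviation_def powr_powr)
  finally show ?thesis .
qed

lemma deviation_le:
  assumes \<mu>: "\<mu> \<in> moments" and x: "x \<in> M" and A: "0 < A"
    and "(\<integral>\<^sup>+ y. ennreal (\<theta> x y powr p) \<partial>\<mu>) \<le> ennreal (A powr p)"
  shows "p_deviation p \<theta> \<mu> x \<le> A"
proof (rule powr_le_powr_cancel[of _ p])
  show "p_deviation p \<theta> \<mu> x powr p \<le> A powr p"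
    using assms by (simp add: deviation_powr ennreal_le_iff)
qed (use A p_ge_1 deviation_nonneg in auto)

text \<open>Minkowski for \<open>\<theta> x z \<le> \<theta> x y + \<theta> y z\<close>, where the
  first summand is constant in \<open>z\<close> and \<open>\<mu>\<close> has mass one.\<close>

lemma deviation_Lipschitz_le:
  assumes \<mu>: "\<mu> \<in> moments" and xy: "x \<in> M" "y \<in> M"
  shows "p_deviation p \<theta> \<mu> x \<le> p_deviation p \<theta> \<mu> y + \<theta> x y"
proof (rule field_le_epsilon)
  fix e :: real assume e: "e > 0"
  interpret prob_space \<mu> using \<mu> by (rule moments_prob)
  define A B where "A = \<theta> x y + e / 2" and "B = p_deviation p \<theta> \<mu> y + e / 2"
  have AB: "0 < A" "0 < B"
    using e xy by (auto simp: A_def B_def theta_nonneg deviation_nonneg intro!: add_nonneg_pos)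
  have [measurable]: "\<theta> y \<in> borel_measurable \<mu>" using borel_measurable_theta[OF \<mu> xy(2)] .
  have c: "(\<integral>\<^sup>+ z. ennreal (\<theta> x y powr p) \<partial>\<mu>) \<le> ennreal (A powr p)"
    using p_ge_1 e xy
    by (simp add: emeasure_space_1 A_def) (intro ennreal_leI powr_mono2, auto simp: theta_nonneg)
  have c': "(\<integral>\<^sup>+ z. ennreal (\<theta> y z powr p) \<partial>\<mu>) \<le> ennreal (B powr p)"
    unfolding deviation_powr[OF \<mu> xy(2)] using p_ge_1 e xy
    by (intro ennreal_leI powr_mono2) (auto simp: B_def deviation_nonneg)
  have "(\<integral>\<^sup>+ z. ennreal (\<theta> x z powr p) \<partial>\<mu>) \<le> (\<integral>\<^sup>+ z. ennreal ((\<theta> x y + \<theta> y z) powr p) \<partial>\<mu>)"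
    using xy p_ge_1 by (intro nn_integral_mono ennreal_leI powr_mono2)
      (auto simp: moments_space[OF \<mu>] theta_triangle theta_nonneg)
  also have "\<dots> \<le> ennreal ((A + B) powr p)"
    using xy by (intro Minkowski_nn_integral[OF _ _ _ _ AB p_ge_1 c c'])
      (auto simp: theta_nonneg moments_space[OF \<mu>])
  finally have "p_deviation p \<theta> \<mu> x \<le> A + B"
    using AB by (intro deviation_le[OF \<mu> xy(1)]) auto
  then show "p_deviation p \<theta> \<mu> x \<le> p_deviation p \<theta> \<mu> y + \<theta> x y + e"
    by (simp add: A_def B_def)
qed

lemma deviation_Lipschitz:
  assumes \<mu>: "\<mu> \<in> moments" and xy: "x \<in> M" "y \<in> M"
  shows "\<bar>p_deviation p \<theta> \<mu> x - p_deviation p \<theta> \<mu> y\<bar> \<le> L * d x y"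
  using deviation_Lipschitz_le[OF \<mu> xy] deviation_Lipschitz_le[OF \<mu> xy(2,1)]
    theta_commute[OF xy] theta_le[OF xy] by linarith

lemma merge_setting_deviation: "\<mu> \<in> moments \<Longrightarrow> merge_setting M d (p_deviation p \<theta> \<mu>)"
  using connected locally_path_connected path_connected_eq_connected_space
  by (intro merge_setting.intro merge_setting_axioms.intro Metric_space_axioms
      Lipschitz_imp_continuous_map[of _ L] deviation_Lipschitz) auto

text \<open>The coupling is a space \<open>N\<close> with two maps, so that the reverse estimate is
  the same lemma with \<open>a\<close> and \<open>b\<close> exchanged. Minkowski is applied on
  \<open>N\<close> to
  \<open>\<theta> x (a w) \<le> \<theta> x (b w) + L * d (a w) (b w)\<close>.\<close>

lemma deviation_coupling_le:
  assumes \<mu>: "\<mu> \<in> moments" and \<nu>: "\<nu> \<in> moments" and x: "x \<in> M" and B: "0 < B"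
    and a: "a \<in> measurable N \<mu>" "distr N \<mu> a = \<mu>" and b: "b \<in> measurable N \<nu>" "distr N \<nu> b = \<nu>"
    and meas: "(\<lambda>w. d (a w) (b w)) \<in> borel_measurable N"
    and int: "(\<integral>\<^sup>+ w. ennreal (d (a w) (b w) powr p) \<partial>N) \<le> ennreal (B powr p)"
  shows "p_deviation p \<theta> \<mu> x \<le> p_deviation p \<theta> \<nu> x + L * B"
proof (rule field_le_epsilon)
  fix e :: real assume e: "e > 0"
  define A where "A = p_deviation p \<theta> \<nu> x + e"
  have A: "0 < A" using e by (simp add: A_def deviation_nonneg add_nonneg_pos)
  note [measurable] = a(1) b(1) meas borel_measurable_theta[OF \<mu> x] borel_measurable_theta[OF \<nu> x]
  have aM: "a w \<in> M" "b w \<in> M" if "w \<in> space N" for w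
    using measurable_space[OF a(1) that] measurable_space[OF b(1) that]
      moments_space[OF \<mu>] moments_space[OF \<nu>] by simp_all
  have c: "(\<integral>\<^sup>+ w. ennreal (\<theta> x (b w) powr p) \<partial>N) \<le> ennreal (A powr p)"
  proof -
    have "(\<integral>\<^sup>+ w. ennreal (\<theta> x (b w) powr p) \<partial>N) = (\<integral>\<^sup>+ y. ennreal (\<theta> x y powr p) \<partial>distr N \<nu> b)"
      by (subst nn_integral_distr) auto
    also have "\<dots> = ennreal (p_deviation p \<theta> \<nu> x powr p)"
      by (simp add: b(2) deviation_powr[OF \<nu> x])
    also have "\<dots> \<le> ennreal (A powr p)"
      using e p_ge_1 by (intro ennreal_leI powr_mono2) (auto simp: A_def deviation_nonneg)
    finally show ?thesis .
  qed
  have c': "(\<integral>\<^sup>+ w. ennreal ((L * d (a w) (b w)) powr p) \<partial>N) \<le> ennreal ((L * B) powr p)"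
  proof -
    have "(\<integral>\<^sup>+ w. ennreal ((L * d (a w) (b w)) powr p) \<partial>N)
        = (\<integral>\<^sup>+ w. ennreal (L powr p) * ennreal (d (a w) (b w) powr p) \<partial>N)"
      using L_pos by (simp add: powr_mult ennreal_mult)
    also have "\<dots> = ennreal (L powr p) * (\<integral>\<^sup>+ w. ennreal (d (a w) (b w) powr p) \<partial>N)"
      by (simp add: nn_integral_cmult)
    also have "\<dots> \<le> ennreal (L powr p) * ennreal (B powr p)"
      using int by (intro mult_left_mono) auto
    also have "\<dots> = ennreal ((L * B) powr p)"
      using L_pos B by (simp add: powr_mult ennreal_mult)
    finally show ?thesis .
  qed
  have "(\<integral>\<^sup>+ y. ennreal (\<theta> x y powr p) \<partial>\<mu>) = (\<integral>\<^sup>+ w. ennreal (\<theta> x (a w) powr p) \<partial>N)"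
    by (subst (1) a(2)[symmetric], subst nn_integral_distr) auto
  also have "\<dots> \<le> (\<integral>\<^sup>+ w. ennreal ((\<theta> x (b w) + L * d (a w) (b w)) powr p) \<partial>N)"
  proof (intro nn_integral_mono ennreal_leI powr_mono2)
    fix w assume "w \<in> space N"
    then show "\<theta> x (a w) \<le> \<theta> x (b w) + L * d (a w) (b w)"
      using theta_Lipschitz[of x "a w" "b w"] aM x by fastforce
  qed (use p_ge_1 x aM theta_nonneg in auto)
  also have "\<dots> \<le> ennreal ((A + L * B) powr p)"
    using A B L_pos p_ge_1 x aM
    by (intro Minkowski_nn_integral c c') (auto simp: theta_nonneg)
  finally have "p_deviation p \<theta> \<mu> x \<le> A + L * B"
    using A B L_pos by (intro deviation_le[OF \<mu> x]) (auto intro: add_pos_pos)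
  then show "p_deviation p \<theta> \<mu> x \<le> p_deviation p \<theta> \<nu> x + L * B + e"
    by (simp add: A_def)
qed

end

text \<open>
  The shortest way across a bridge of length \<open>e\<close> from \<open>f x\<close> to \<open>g x\<close>. This extends \<open>d\<close> and \<open>d'\<close> when
  the correspondence of \<open>f x\<close> with \<open>g x\<close> has distortion at most \<open>2 e\<close>.
\<close>

definition glued_dist ::
    "'i set \<Rightarrow> ('i \<Rightarrow> 'b) \<Rightarrow> ('i \<Rightarrow> 'c) \<Rightarrow> ('b \<Rightarrow> 'b \<Rightarrow> real) \<Rightarrow> ('c \<Rightarrow> 'c \<Rightarrow> real) \<Rightarrow> real
      \<Rightarrow> 'b + 'c \<Rightarrow> 'b + 'c \<Rightarrow> real" where
  "glued_dist I f g d d' e u v =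
     (case (u, v) of
        (Inl a, Inl b) \<Rightarrow> d a b
      | (Inr a, Inr b) \<Rightarrow> d' a b
      | (Inl a, Inr b) \<Rightarrow> (INF x\<in>I. d a (f x) + e + d' (g x) b)
      | (Inr b, Inl a) \<Rightarrow> (INF x\<in>I. d a (f x) + e + d' (g x) b))"

text \<open>The triangle inequalities at risk are those that cross the bridge twice: two crossings
  cost \<open>2 * e\<close>, exactly what the distortion may lose. \<open>f\<close> and
  \<open>g\<close> need not be injective; they merely list corresponding pairs.\<close>

lemma pseudo_metric_glued_dist:
  assumes d: "pseudo_metric_on Z d" and d': "pseudo_metric_on Z' d'"
    and I: "I \<noteq> {}" "f ` I \<subseteq> Z" "g ` I \<subseteq> Z'" and e: "0 \<le> e"
    and dist: "\<And>x y. x \<in> I \<Longrightarrow> y \<in> I \<Longrightarrow> \<bar>d (f x) (f y) - d' (g x) (g y)\<bar> \<le> 2 * e"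
  shows "pseudo_metric_on (Z <+> Z') (glued_dist I f g d d' e)"
    and "\<And>a b x. a \<in> Z \<Longrightarrow> b \<in> Z' \<Longrightarrow> x \<in> I \<Longrightarrow>
      glued_dist I f g d d' e (Inl a) (Inr b) \<le> d a (f x) + e + d' (g x) b"
proof -
  define D where "D = glued_dist I f g d d' e"
  have fZ: "x \<in> I \<Longrightarrow> f x \<in> Z" and gZ: "x \<in> I \<Longrightarrow> g x \<in> Z'" for x using I by auto
  note dn = d[unfolded pseudo_metric_on_def, THEN conjunct1, rule_format, THEN conjunct1]
  note ds = d[unfolded pseudo_metric_on_def, THEN conjunct1, rule_format, THEN conjunct2]
  note dt = d[unfolded pseudo_metric_on_def, THEN conjunct2, THEN conjunct2, rule_format]
  note dn' = d'[unfolded pseudo_metric_on_def, THEN conjunct1, rule_format, THEN conjunct1]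
  note ds' = d'[unfolded pseudo_metric_on_def, THEN conjunct1, rule_format, THEN conjunct2]
  note dt' = d'[unfolded pseudo_metric_on_def, THEN conjunct2, THEN conjunct2, rule_format]
  have D: "D (Inl a) (Inl b) = d a b" "D (Inr a') (Inr b') = d' a' b'"
    "D (Inr a') (Inl a) = D (Inl a) (Inr a')" for a b a' b'
    by (simp_all add: D_def glued_dist_def)
  have up: "D (Inl a) (Inr b) \<le> d a (f x) + e + d' (g x) b"
    if "a \<in> Z" "b \<in> Z'" "x \<in> I" for a b x
    unfolding D_def glued_dist_def
    using that dn[OF that(1) fZ] dn'[OF gZ that(2)] e
    by (auto intro!: cINF_lower bdd_belowI2[of _ 0])
  have low: "c \<le> D (Inl a) (Inr b)"
    if "\<And>x. x \<in> I \<Longrightarrow> c \<le> d a (f x) + e + d' (g x) b" for a b c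
    unfolding D_def glued_dist_def using that I(1) by (auto intro!: cINF_greatest)
  have app: "\<exists>x\<in>I. d a (f x) + e + d' (g x) b < D (Inl a) (Inr b) + \<eta>" if "\<eta> > 0" for a b \<eta>
  proof (rule ccontr)
    assume "\<not> ?thesis"
    then have "D (Inl a) (Inr b) + \<eta> \<le> D (Inl a) (Inr b)" by (intro low) (auto simp: not_less)
    then show False using that by simp
  qed
  have nonneg: "0 \<le> D (Inl a) (Inr b)" if "a \<in> Z" "b \<in> Z'" for a b
    using dn[OF that(1) fZ] dn'[OF gZ that(2)] e by (intro low) (simp add: add_nonneg_nonneg)
  have t1: "D (Inl a) (Inr c) \<le> d a b + D (Inl b) (Inr c)" if "a \<in> Z" "b \<in> Z" "c \<in> Z'" for a b c
  proof -
    have "D (Inl a) (Inr c) - d a b \<le> D (Inl b) (Inr c)"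
    proof (rule low)
      fix x assume x: "x \<in> I"
      show "D (Inl a) (Inr c) - d a b \<le> d b (f x) + e + d' (g x) c"
        using up[OF that(1,3) x] dt[OF that(1,2) fZ[OF x]] by linarith
    qed
    then show ?thesis by simp
  qed
  have t2: "D (Inl a) (Inr c) \<le> D (Inl a) (Inr b) + d' b c" if "a \<in> Z" "b \<in> Z'" "c \<in> Z'" for a b c
  proof -
    have "D (Inl a) (Inr c) - d' b c \<le> D (Inl a) (Inr b)"
    proof (rule low)
      fix x assume x: "x \<in> I"
      show "D (Inl a) (Inr c) - d' b c \<le> d a (f x) + e + d' (g x) b"
        using up[OF that(1,3) x] dt'[OF gZ[OF x] that(2,3)] by linarith
    qed
    then show ?thesis by simp
  qed
  \<comment> \<open>Out over the bridge at \<open>x\<close> and back over the one at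
    \<open>y\<close>. Near-optimal bridges are taken because the infimum need not be
    attained.\<close>
  have t3: "d a c \<le> D (Inl a) (Inr b) + D (Inl c) (Inr b)" if "a \<in> Z" "b \<in> Z'" "c \<in> Z" for a b c
  proof (rule field_le_epsilon)
    fix \<eta> :: real assume "\<eta> > 0"
    then obtain x y where x: "x \<in> I" "d a (f x) + e + d' (g x) b < D (Inl a) (Inr b) + \<eta> / 2"
      and y: "y \<in> I" "d c (f y) + e + d' (g y) b < D (Inl c) (Inr b) + \<eta> / 2"
      using app[of "\<eta> / 2"] by (meson half_gt_zero)
    have "d a c \<le> d a (f x) + d (f x) (f y) + d (f y) c"
      using dt[OF that(1) fZ[OF x(1)] that(3)] dt[OF fZ[OF x(1)] fZ[OF y(1)] that(3)] by linarith
    moreover have "d' (g x) (g y) \<le> d' (g x) b + d' (g y) b"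
      using dt'[OF gZ[OF x(1)] that(2) gZ[OF y(1)]] ds'[OF gZ[OF y(1)] that(2)] by linarith
    ultimately show "d a c \<le> D (Inl a) (Inr b) + D (Inl c) (Inr b) + \<eta>"
      using dist[OF x(1) y(1)] ds[OF fZ[OF y(1)] that(3)] x y by linarith
  qed
  have t4: "d' a c \<le> D (Inl b) (Inr a) + D (Inl b) (Inr c)" if "a \<in> Z'" "b \<in> Z" "c \<in> Z'" for a b c
  proof (rule field_le_epsilon)
    fix \<eta> :: real assume "\<eta> > 0"
    then obtain x y where x: "x \<in> I" "d b (f x) + e + d' (g x) a < D (Inl b) (Inr a) + \<eta> / 2"
      and y: "y \<in> I" "d b (f y) + e + d' (g y) c < D (Inl b) (Inr c) + \<eta> / 2"
      using app[of "\<eta> / 2"] by (meson half_gt_zero)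
    have "d' a c \<le> d' a (g x) + d' (g x) (g y) + d' (g y) c"
      using dt'[OF that(1) gZ[OF x(1)] that(3)] dt'[OF gZ[OF x(1)] gZ[OF y(1)] that(3)] by linarith
    moreover have "d (f x) (f y) \<le> d b (f x) + d b (f y)"
      using dt[OF fZ[OF x(1)] that(2) fZ[OF y(1)]] ds[OF fZ[OF x(1)] that(2)] by linarith
    ultimately show "d' a c \<le> D (Inl b) (Inr a) + D (Inl b) (Inr c) + \<eta>"
      using dist[OF x(1) y(1)] ds'[OF that(1) gZ[OF x(1)]] x y by linarith
  qed
  have "pseudo_metric_on (Z <+> Z') D"
    unfolding pseudo_metric_on_def
  proof (intro conjI ballI)
    fix u v assume uv: "u \<in> Z <+> Z'" "v \<in> Z <+> Z'"
    show "0 \<le> D u v" using uv by (auto simp: D dn dn' nonneg)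
    show "D u v = D v u" using uv by (auto simp: D ds ds')
    fix w assume w: "w \<in> Z <+> Z'"
    have t1': "D (Inl c) (Inr a) \<le> D (Inl b) (Inr a) + d b c" if "a \<in> Z'" "b \<in> Z" "c \<in> Z" for a b c
      using t1[OF that(3,2,1)] ds[OF that(2,3)] by linarith
    have t2': "D (Inl c) (Inr a) \<le> d' a b + D (Inl c) (Inr b)" if "a \<in> Z'" "b \<in> Z'" "c \<in> Z" for a b c
      using t2[OF that(3,2,1)] ds'[OF that(1,2)] by linarith
    show "D u w \<le> D u v + D v w"
    proof (cases u; cases v; cases w)
    qed (use uv w in \<open>auto simp: D intro: dt dt' t1 t1' t2 t2' t3 t4\<close>)
  qed (use d d' in \<open>auto simp: pseudo_metric_on_def D\<close>)
  then show "pseudo_metric_on (Z <+> Z') (glued_dist I f g d d' e)" by (simp add: D_def)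
  show "\<And>a b x. a \<in> Z \<Longrightarrow> b \<in> Z' \<Longrightarrow> x \<in> I \<Longrightarrow>
      glued_dist I f g d d' e (Inl a) (Inr b) \<le> d a (f x) + e + d' (g x) b"
    using up unfolding D_def .
qed

section \<open>Stability of barycentric merge trees under couplings\<close>

lemma topspace_pm_topology [simp]: "topspace (pm_topology Z d) = Z"
proof
  show "topspace (pm_topology Z d) \<subseteq> Z"
    by (metis openin_pm_topology openin_topspace)
  have "openin (pm_topology Z d) Z"
    unfolding openin_pm_topology by (auto intro: exI[of _ 1])
  then show "Z \<subseteq> topspace (pm_topology Z d)" by (rule openin_subset)
qed

lemma (in Metric_space) continuous_map_pm_topology:
  assumes "pseudo_metric_on Z e" and "f ` M \<subseteq> Z"
    and "\<And>x y. x \<in> M \<Longrightarrow> y \<in> M \<Longrightarrow> e (f x) (f y) \<le> c * d x y"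
  shows "continuous_map mtopology (pm_topology Z e) f"
  unfolding continuous_map_def
proof (intro conjI allI impI)
  show "f \<in> topspace mtopology \<rightarrow> topspace (pm_topology Z e)" using assms(2) by auto
  fix U assume U: "openin (pm_topology Z e) U"
  show "openin mtopology {x \<in> topspace mtopology. f x \<in> U}"
    unfolding openin_mtopology
  proof (intro conjI allI impI)
    fix x assume "x \<in> {x \<in> topspace mtopology. f x \<in> U}"
    then have x: "x \<in> M" "f x \<in> U" by auto
    obtain r where r: "r > 0" "{y \<in> Z. e (f x) y < r} \<subseteq> U"
      using U x(2) unfolding openin_pm_topology by meson
    have "f y \<in> U" if "y \<in> mball x (r / (\<bar>c\<bar> + 1))" for y
    proof -
      have y: "y \<in> M" "d x y < r / (\<bar>c\<bar> + 1)" using that by auto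
      have "c * d x y \<le> (\<bar>c\<bar> + 1) * d x y" by (intro mult_right_mono) auto
      also have "\<dots> < r" using y(2) by (simp add: field_simps)
      finally have "e (f x) (f y) < r" using assms(3)[OF x(1) y(1)] by linarith
      then show ?thesis using r(2) y(1) assms(2) by auto
    qed
    then show "\<exists>r>0. mball x r \<subseteq> {x \<in> topspace mtopology. f x \<in> U}"
      using r(1) by (intro exI[of _ "r / (\<bar>c\<bar> + 1)"]) auto
  qed auto
qed

lemma continuous_map_prod_both:
  assumes "continuous_map X Y f" "continuous_map X' Y' g"
  shows "continuous_map (prod_topology X X') (prod_topology Y Y') (\<lambda>z. (f (fst z), g (snd z)))"
proof (rule continuous_map_pairedI)
  show "continuous_map (prod_topology X X') Y (\<lambda>z. f (fst z))"
    using continuous_map_compose[OF continuous_map_fst assms(1)] by (simp add: o_def)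
  show "continuous_map (prod_topology X X') Y' (\<lambda>z. g (snd z))"
    using continuous_map_compose[OF continuous_map_snd assms(2)] by (simp add: o_def)
qed

lemma ennroot_le:
  assumes "x \<le> ennreal (B powr p)" "0 \<le> B" "1 \<le> p"
  shows "ennroot p x \<le> ennreal B"
proof -
  have fin: "x \<noteq> \<infinity>" using assms(1) by (auto simp: top_unique)
  then have "enn2real x \<le> B powr p"
    using assms(1) by (intro enn2real_leI) auto
  then have "enn2real x powr (1 / p) \<le> (B powr p) powr (1 / p)"
    using assms by (intro powr_mono2) auto
  also have "\<dots> = B" using assms by (simp add: powr_powr)
  finally show ?thesis using fin by (simp add: ennroot_def ennreal_leI)
qed

context bmt_setting
begin

abbreviation modulus :: real where
  "modulus \<equiv> enn2real (connectivity_modulus M d)"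

text \<open>The shape of both pointwise bounds on the trees: a multiple of the distance in
  \<open>M\<close> plus the length of the bridge.\<close>

lemma nn_integral_dist_add_const_le:
  assumes N: "prob_space N" and meas: "(\<lambda>w. d (a w) (b w)) \<in> borel_measurable N"
    and B: "0 < B" and c: "0 < c" and e: "0 < e"
    and int: "(\<integral>\<^sup>+ w. ennreal (d (a w) (b w) powr p) \<partial>N) \<le> ennreal (B powr p)"
  shows "(\<integral>\<^sup>+ w. ennreal ((c * d (a w) (b w) + e) powr p) \<partial>N) \<le> ennreal ((c * B + e) powr p)"
proof -
  interpret prob_space N by fact
  note [measurable] = meas
  have "(\<integral>\<^sup>+ w. ennreal ((c * d (a w) (b w)) powr p) \<partial>N)
      = (\<integral>\<^sup>+ w. ennreal (c powr p) * ennreal (d (a w) (b w) powr p) \<partial>N)"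
    using c by (simp add: powr_mult ennreal_mult)
  also have "\<dots> = ennreal (c powr p) * (\<integral>\<^sup>+ w. ennreal (d (a w) (b w) powr p) \<partial>N)"
    by (simp add: nn_integral_cmult)
  also have "\<dots> \<le> ennreal (c powr p) * ennreal (B powr p)"
    using int by (intro mult_left_mono) auto
  also have "\<dots> = ennreal ((c * B) powr p)"
    using c B by (simp add: powr_mult ennreal_mult)
  finally have 1: "(\<integral>\<^sup>+ w. ennreal ((c * d (a w) (b w)) powr p) \<partial>N) \<le> ennreal ((c * B) powr p)" .
  have 2: "(\<integral>\<^sup>+ w. ennreal (e powr p) \<partial>N) \<le> ennreal (e powr p)"
    by (simp add: emeasure_space_1)
  show ?thesis
    using c B e p_ge_1 by (intro Minkowski_nn_integral[OF _ _ _ _ _ _ _ 1 2]) auto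
qed

theorem KS_distance_BMT_le:
  assumes \<mu>: "\<mu> \<in> moments" and \<nu>: "\<nu> \<in> moments" and B: "0 < B"
    and coupling: "is_coupling \<mu> \<nu> h"
    and int: "(\<integral>\<^sup>+ z. ennreal (d (fst z) (snd z) powr p) \<partial>h) \<le> ennreal (B powr p)"
  shows "KS_distance p (functional_BMT p \<theta> M d \<mu>) (functional_BMT p \<theta> M d \<nu>)
    \<le> ennreal (L * (modulus + 2) * B)"
proof -
  have h: "prob_space h" "sets h = sets (\<mu> \<Otimes>\<^sub>M \<nu>)" "distr h \<mu> fst = \<mu>" "distr h \<nu> snd = \<nu>"
    using coupling by (simp_all add: is_coupling_def)
  define \<sigma> where "\<sigma> = p_deviation p \<theta> \<mu>"
  define \<sigma>' where "\<sigma>' = p_deviation p \<theta> \<nu>"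
  interpret h: prob_space h by fact
  interpret A: merge_setting M d \<sigma> unfolding \<sigma>_def by (rule merge_setting_deviation[OF \<mu>])
  interpret A': merge_setting M d \<sigma>' unfolding \<sigma>'_def by (rule merge_setting_deviation[OF \<nu>])
  define T where "T = merge_tree M d \<sigma>"
  define T' where "T' = merge_tree M d \<sigma>'"
  define F where "F = functional_BMT p \<theta> M d \<mu>"
  define F' where "F' = functional_BMT p \<theta> M d \<nu>"
  have F: "fmm_carrier F = T" "fmm_dist F = A.tree_dist" "fmm_fun F = merge_height \<sigma>"
    "fmm_measure F = distr \<mu> (borel_of (pm_topology T A.tree_dist)) A.proj"
    by (simp_all add: F_def functional_BMT_def Let_def T_def \<sigma>_def)
  have F': "fmm_carrier F' = T'" "fmm_dist F' = A'.tree_dist" "fmm_fun F' = merge_height \<sigma>'"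
    "fmm_measure F' = distr \<nu> (borel_of (pm_topology T' A'.tree_dist)) A'.proj"
    by (simp_all add: F'_def functional_BMT_def Let_def T'_def \<sigma>'_def)
  have sp: "space \<mu> = M" "space \<nu> = M" using moments_space \<mu> \<nu> by auto
  have sh: "space h = M \<times> M"
    using sets_eq_imp_space_eq[OF h(2)] by (simp add: space_pair_measure sp)
  have fst_meas: "fst \<in> measurable h \<mu>" and snd_meas: "snd \<in> measurable h \<nu>"
    using measurable_cong_sets[OF h(2) refl] by auto
  have dm: "(\<lambda>z. d (fst z) (snd z)) \<in> borel_measurable h"
    using borel_measurable_dist_pair[OF separable moments_sets[OF \<mu>] moments_sets[OF \<nu>]]
      measurable_cong_sets[OF h(2) refl] by auto
  \<comment> \<open>The uniform distance of the two deviation functions, as \<open>close\<close>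
    shows, and at the same time the length of the bridge.\<close>
  define e where "e = L * B"
  have e: "0 < e" using L_pos B by (simp add: e_def)
  have close: "\<bar>\<sigma> x - \<sigma>' x\<bar> \<le> e" if "x \<in> M" for x
  proof -
    have "\<sigma> x \<le> \<sigma>' x + L * B"
      unfolding \<sigma>_def \<sigma>'_def
      by (rule deviation_coupling_le[OF \<mu> \<nu> that B fst_meas h(3) snd_meas h(4) dm int])
    moreover have "\<sigma>' x \<le> \<sigma> x + L * B"
      unfolding \<sigma>_def \<sigma>'_def
      using dm int
      by (intro deviation_coupling_le[OF \<nu> \<mu> that B snd_meas h(4) fst_meas h(3)])
         (simp_all add: commute)
    ultimately show ?thesis by (simp add: e_def abs_le_iff)
  qed
  have pm: "pseudo_metric_on T A.tree_dist" "pseudo_metric_on T' A'.tree_dist"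
    using A.pseudo_metric_tree_dist A'.pseudo_metric_tree_dist by (auto simp: T_def T'_def)
  have im: "A.proj ` M = T" "A'.proj ` M = T'"
    by (auto simp: T_def T'_def A.merge_tree_eq A'.merge_tree_eq)
  have Mne: "M \<noteq> {}" using h.not_empty sh by auto
  have distortion: "\<bar>A.tree_dist (A.proj x) (A.proj y) - A'.tree_dist (A'.proj x) (A'.proj y)\<bar> \<le> 2 * e"
    if "x \<in> M" "y \<in> M" for x y
    using merge_dist_stable[OF A.merge_setting_axioms A'.merge_setting_axioms close that]
      merge_dist_stable[OF A'.merge_setting_axioms A.merge_setting_axioms _ that] close
    by (fastforce simp: abs_minus_commute abs_le_iff)
  \<comment> \<open>The correspondence is indexed by \<open>M\<close> itself, since both trees are
    quotients of it.\<close>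
  define \<delta> where "\<delta> = glued_dist M A.proj A'.proj A.tree_dist A'.tree_dist e"
  have glue: "pseudo_metric_on (T <+> T') \<delta>"
    "\<And>a b x. a \<in> T \<Longrightarrow> b \<in> T' \<Longrightarrow> x \<in> M \<Longrightarrow>
      \<delta> (Inl a) (Inr b) \<le> A.tree_dist a (A.proj x) + e + A'.tree_dist (A'.proj x) b"
    unfolding \<delta>_def
    by (rule pseudo_metric_glued_dist[where f = A.proj and g = A'.proj,
          OF pm Mne equalityD1[OF im(1)] equalityD1[OF im(2)] less_imp_le[OF e] distortion];
        assumption)+
  have \<delta>_mem: "\<delta> \<in> metric_couplings F F'"
    using glue(1) by (auto simp: metric_couplings_def F F' \<delta>_def glued_dist_def)
  have lip: "A.tree_dist (A.proj x) (A.proj y) \<le> (L * modulus) * d x y" if "x \<in> M" "y \<in> M" for x y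
    using A.tree_dist_Lipschitz[OF _ L_pos modulus_finite that] deviation_Lipschitz[OF \<mu>]
    by (simp add: \<sigma>_def mult.assoc)
  have lip': "A'.tree_dist (A'.proj x) (A'.proj y) \<le> (L * modulus) * d x y" if "x \<in> M" "y \<in> M" for x y
    using A'.tree_dist_Lipschitz[OF _ L_pos modulus_finite that] deviation_Lipschitz[OF \<nu>]
    by (simp add: \<sigma>'_def mult.assoc)
  have cont: "continuous_map mtopology (pm_topology T A.tree_dist) A.proj"
    using im by (intro continuous_map_pm_topology[OF pm(1) _ lip]) auto
  have cont': "continuous_map mtopology (pm_topology T' A'.tree_dist) A'.proj"
    using im by (intro continuous_map_pm_topology[OF pm(2) _ lip']) auto
  define PT where "PT = prod_topology (pm_topology T A.tree_dist) (pm_topology T' A'.tree_dist)"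
  define q where "q = (\<lambda>z. (A.proj (fst z), A'.proj (snd z)))"
  \<comment> \<open>The projections are Lipschitz, hence continuous, and so is the pair of them on
    the product. This gives measurability for the Borel sigma-algebra of the product of the
    trees.\<close>
  have q: "q \<in> measurable h (borel_of PT)"
    using measurable_prod_continuous_map[OF separable moments_sets[OF \<mu>] moments_sets[OF \<nu>]
        continuous_map_prod_both[OF cont cont']] measurable_cong_sets[OF h(2) refl]
    by (auto simp: q_def PT_def)
  define H where "H = distr h (borel_of PT) q"
  have proj_meas: "A.proj \<in> measurable \<mu> (fmm_measure F)"
    using measurable_continuous_map[OF cont moments_sets[OF \<mu>]] by (simp add: F)
  have proj_meas': "A'.proj \<in> measurable \<nu> (fmm_measure F')"
    using measurable_continuous_map[OF cont' moments_sets[OF \<nu>]] by (simp add: F')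
  have fst_m: "fst \<in> measurable (borel_of PT) (fmm_measure F)"
    using measurable_continuous_map[of PT _ fst] by (simp add: F PT_def continuous_map_fst)
  have snd_m: "snd \<in> measurable (borel_of PT) (fmm_measure F')"
    using measurable_continuous_map[of PT _ snd] by (simp add: F' PT_def continuous_map_snd)
  have "distr H (fmm_measure F) fst = distr h (fmm_measure F) (A.proj \<circ> fst)"
    unfolding H_def using fst_m q by (subst distr_distr) (auto simp: q_def o_def)
  also have "\<dots> = distr (distr h \<mu> fst) (fmm_measure F) A.proj"
    using proj_meas fst_meas by (subst distr_distr) auto
  also have "\<dots> = fmm_measure F"
    unfolding h(3) F(4) by (rule distr_cong) simp_all
  finally have m1: "distr H (fmm_measure F) fst = fmm_measure F" .
  have "distr H (fmm_measure F') snd = distr h (fmm_measure F') (A'.proj \<circ> snd)"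
    unfolding H_def using snd_m q by (subst distr_distr) (auto simp: q_def o_def)
  also have "\<dots> = distr (distr h \<nu> snd) (fmm_measure F') A'.proj"
    using proj_meas' snd_meas by (subst distr_distr) auto
  also have "\<dots> = fmm_measure F'"
    unfolding h(4) F'(4) by (rule distr_cong) simp_all
  finally have m2: "distr H (fmm_measure F') snd = fmm_measure F'" .
  have H_mem: "H \<in> measure_couplings F F'"
    unfolding measure_couplings_def using m1 m2 h.prob_space_distr[OF q]
    by (auto simp: H_def F F' PT_def fmm_topology_def)
  \<comment> \<open>The factor \<open>L * (modulus + 1)\<close> covers both the Lipschitz constant
    \<open>L * modulus\<close> of the projections and \<open>L\<close> of the height functions, and
    it is positive even for modulus 0. The bridge adds one more \<open>L * B\<close>.\<close>
  define R where "R = L * (modulus + 2) * B"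
  have mod0: "0 \<le> modulus" by simp
  have R0: "0 \<le> R" using L_pos B by (simp add: R_def)
  have R1: "L * (modulus + 1) * B + e = R" by (simp add: R_def e_def algebra_simps)
  have bound: "(\<integral>\<^sup>+ z. ennreal ((L * (modulus + 1) * d (fst z) (snd z) + e) powr p) \<partial>h)
      \<le> ennreal (R powr p)"
    using nn_integral_dist_add_const_le[OF h(1) dm B _ e int, of "L * (modulus + 1)"] L_pos
    by (simp add: R1 add_nonneg_pos)
  have "(\<integral>\<^sup>+ (z, z'). ennreal (\<delta> (Inl z) (Inr z') powr p) \<partial>H)
      \<le> (\<integral>\<^sup>+ z. ennreal (\<delta> (Inl (A.proj (fst z))) (Inr (A'.proj (snd z))) powr p) \<partial>h)"
    unfolding H_def by (rule order_trans[OF nn_integral_distr_le[OF q]]) (simp add: q_def)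
  also have "\<dots> \<le> (\<integral>\<^sup>+ z. ennreal ((L * (modulus + 1) * d (fst z) (snd z) + e) powr p) \<partial>h)"
  proof (intro nn_integral_mono ennreal_leI powr_mono2)
    fix z assume "z \<in> space h"
    then have z: "fst z \<in> M" "snd z \<in> M" by (auto simp: sh)
    then have zT: "A.proj (fst z) \<in> T" "A'.proj (snd z) \<in> T'" using im by auto
    show "0 \<le> \<delta> (Inl (A.proj (fst z))) (Inr (A'.proj (snd z)))"
      using glue(1) zT by (auto simp: pseudo_metric_on_def)
    \<comment> \<open>The bridge at \<open>snd z\<close> is taken: it ends at the target, so the
      second tree contributes nothing.\<close>
    have "A'.tree_dist (A'.proj (snd z)) (A'.proj (snd z)) = 0"
      using pm(2) zT by (auto simp: pseudo_metric_on_def)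
    then have "\<delta> (Inl (A.proj (fst z))) (Inr (A'.proj (snd z))) \<le> (L * modulus) * d (fst z) (snd z) + e"
      using glue(2)[OF zT z(2)] lip[OF z] by linarith
    also have "\<dots> \<le> L * (modulus + 1) * d (fst z) (snd z) + e"
      using L_pos by (intro add_right_mono mult_right_mono mult_left_mono) auto
    finally show "\<delta> (Inl (A.proj (fst z))) (Inr (A'.proj (snd z)))
        \<le> L * (modulus + 1) * d (fst z) (snd z) + e" .
  qed (use p_ge_1 in auto)
  also note bound
  finally have b1: "ennroot p (\<integral>\<^sup>+ (z, z'). ennreal (\<delta> (Inl z) (Inr z') powr p) \<partial>H) \<le> ennreal R"
    using R0 p_ge_1 by (intro ennroot_le) auto
  have "(\<integral>\<^sup>+ (z, z'). ennreal (\<bar>fmm_fun F z - fmm_fun F' z'\<bar> powr p) \<partial>H)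
      \<le> (\<integral>\<^sup>+ z. ennreal (\<bar>fmm_fun F (A.proj (fst z)) - fmm_fun F' (A'.proj (snd z))\<bar> powr p) \<partial>h)"
    unfolding H_def by (rule order_trans[OF nn_integral_distr_le[OF q]]) (simp add: q_def)
  also have "\<dots> \<le> (\<integral>\<^sup>+ z. ennreal ((L * (modulus + 1) * d (fst z) (snd z) + e) powr p) \<partial>h)"
  proof (intro nn_integral_mono ennreal_leI powr_mono2)
    fix z assume "z \<in> space h"
    then have z: "fst z \<in> M" "snd z \<in> M" by (auto simp: sh)
    have "\<bar>\<sigma> (fst z) - \<sigma>' (snd z)\<bar> \<le> L * 1 * d (fst z) (snd z) + e"
      using deviation_Lipschitz[OF \<mu> z] close[OF z(2)] unfolding \<sigma>_def[symmetric] by linarith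
    also have "\<dots> \<le> L * (modulus + 1) * d (fst z) (snd z) + e"
      using L_pos by (intro add_right_mono mult_right_mono mult_left_mono) auto
    finally show "\<bar>fmm_fun F (A.proj (fst z)) - fmm_fun F' (A'.proj (snd z))\<bar>
        \<le> L * (modulus + 1) * d (fst z) (snd z) + e"
      using z by (simp add: F F' A.merge_height_proj A'.merge_height_proj)
  qed (use p_ge_1 in auto)
  also note bound
  finally have b2: "ennroot p (\<integral>\<^sup>+ (z, z'). ennreal (\<bar>fmm_fun F z - fmm_fun F' z'\<bar> powr p) \<partial>H) \<le> ennreal R"
    using R0 p_ge_1 by (intro ennroot_le) auto
  have "KS_distance p F F' \<le> ennreal R"
    unfolding KS_distance_def
    by (rule INF_lower2[of "(H, \<delta>)"]) (use H_mem \<delta>_mem b1 b2 in auto)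
  then show ?thesis by (simp add: F_def F'_def R_def)
qed

end

section \<open>Couplings subordinate to nested partitions\<close>

text \<open>Greedy matching from fine to coarse. \<open>g j i\<close> is the class of
  \<open>i\<close> at level \<open>j\<close>, and \<open>J\<close> counts the levels already
  treated; stage \<open>J\<close> matches what is left inside each class of that level as far as
  possible. The fourth clause records that matched pairs already share a class. In the last clause,
  mass matched across classes plus mass not yet matched is bounded by the excess of \<open>a\<close>
  over \<open>b\<close>; later stages only take mass out of the second term, at worst into the
  first.\<close>

lemma nested_partial_coupling:
  fixes a b :: "'i \<Rightarrow> real" and g :: "nat \<Rightarrow> 'i \<Rightarrow> 'k"
  assumes fin: "finite I"
    and a: "\<And>i. i \<in> I \<Longrightarrow> 0 \<le> a i" and b: "\<And>i. i \<in> I \<Longrightarrow> 0 \<le> b i"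
    and nested: "\<And>j i i'. i \<in> I \<Longrightarrow> i' \<in> I \<Longrightarrow> g j i = g j i' \<Longrightarrow> g (Suc j) i = g (Suc j) i'"
  shows "\<exists>\<pi>. (\<forall>i\<in>I. \<forall>i'\<in>I. 0 \<le> \<pi> i i') \<and>
    (\<forall>i\<in>I. (\<Sum>i'\<in>I. \<pi> i i') \<le> a i) \<and> (\<forall>i'\<in>I. (\<Sum>i\<in>I. \<pi> i i') \<le> b i') \<and>
    (\<forall>i\<in>I. \<forall>i'\<in>I. \<forall>j\<ge>J. \<pi> i i' \<noteq> 0 \<longrightarrow> g j i = g j i') \<and>
    (\<forall>j<J. (\<Sum>i\<in>I. \<Sum>i'\<in>I. if g j i = g j i' then 0 else \<pi> i i') + (\<Sum>i\<in>I. a i - (\<Sum>i'\<in>I. \<pi> i i'))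
      \<le> (\<Sum>k\<in>g j ` I. max 0 ((\<Sum>i\<in>{i\<in>I. g j i = k}. a i) - (\<Sum>i\<in>{i\<in>I. g j i = k}. b i))))"
    (is "\<exists>\<pi>. ?pos \<pi> \<and> ?row \<pi> \<and> ?col \<pi> \<and> ?supp J \<pi> \<and> ?lev J \<pi>")
proof (induction J)
  case 0
  show ?case by (intro exI[of _ "\<lambda>_ _. 0"]) (use a b in auto)
next
  case (Suc J)
  then obtain \<pi> where H: "?pos \<pi> \<and> ?row \<pi> \<and> ?col \<pi> \<and> ?supp J \<pi> \<and> ?lev J \<pi>"
    by (rule exE)
  note pos = H[THEN conjunct1, rule_format]
    and row = H[THEN conjunct2, THEN conjunct1, rule_format]
    and col = H[THEN conjunct2, THEN conjunct2, THEN conjunct1, rule_format]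
    and supp = H[THEN conjunct2, THEN conjunct2, THEN conjunct2, THEN conjunct1, rule_format]
    and lev = H[THEN conjunct2, THEN conjunct2, THEN conjunct2, THEN conjunct2, rule_format]
  define cl where "cl k = {i\<in>I. g J i = k}" for k
  have fcl: "finite (cl k)" and clI: "cl k \<subseteq> I" for k using fin by (auto simp: cl_def)
  define u where "u i = a i - (\<Sum>i'\<in>I. \<pi> i i')" for i
  define v where "v i' = b i' - (\<Sum>i\<in>I. \<pi> i i')" for i'
  have u0: "i \<in> I \<Longrightarrow> 0 \<le> u i" and v0: "i \<in> I \<Longrightarrow> 0 \<le> v i" for i
    using row col by (auto simp: u_def v_def)
  define U where "U k = sum u (cl k)" for k
  define V where "V k = sum v (cl k)" for k
  have U0: "0 \<le> U k" and V0: "0 \<le> V k" for k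
    using u0 v0 clI by (auto simp: U_def V_def intro!: sum_nonneg)
  have uU: "i \<in> I \<Longrightarrow> u i \<le> U (g J i)" and vV: "i \<in> I \<Longrightarrow> v i \<le> V (g J i)" for i
    unfolding U_def V_def using u0 v0 fcl clI by (auto intro!: member_le_sum simp: cl_def)
  \<comment> \<open>Within a class this is the product of the two residuals, scaled so that the side
    with less mass is used up. Where neither side has any mass left, the quotient is
    \<open>0 / 0 = 0\<close>.\<close>
  define \<rho> where "\<rho> i i' = (if g J i = g J i' then u i * v i' / max (U (g J i)) (V (g J i)) else 0)" for i i'
  have \<rho>0: "i \<in> I \<Longrightarrow> i' \<in> I \<Longrightarrow> 0 \<le> \<rho> i i'" for i i'
    using u0 v0 U0 by (auto simp: \<rho>_def intro!: divide_nonneg_nonneg mult_nonneg_nonneg simp: le_max_iff_disj)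
  have rrow: "(\<Sum>i'\<in>I. \<rho> i i') = u i * (V (g J i) / max (U (g J i)) (V (g J i)))" if "i \<in> I" for i
  proof -
    have "(\<Sum>i'\<in>I. \<rho> i i') = (\<Sum>i'\<in>cl (g J i). u i * v i' / max (U (g J i)) (V (g J i)))"
      unfolding \<rho>_def using fin by (subst sum.inter_filter[symmetric]) (auto simp: cl_def intro!: sum.cong)
    then show ?thesis by (simp add: V_def sum_distrib_left sum_divide_distrib)
  qed
  have rcol: "(\<Sum>i\<in>I. \<rho> i i') = v i' * (U (g J i') / max (U (g J i')) (V (g J i')))" if "i' \<in> I" for i'
  proof -
    have "(\<Sum>i\<in>I. \<rho> i i') = (\<Sum>i\<in>cl (g J i'). u i * v i' / max (U (g J i')) (V (g J i')))"
      unfolding \<rho>_def using fin by (subst sum.inter_filter[symmetric]) (auto simp: cl_def intro!: sum.cong)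
    then show ?thesis by (simp add: U_def sum_distrib_left sum_divide_distrib mult.commute)
  qed
  have frac: "0 \<le> s / max s t" "s / max s t \<le> 1" "0 \<le> s / max t s" "s / max t s \<le> 1"
    if "0 \<le> s" "0 \<le> t" for s t :: real
    using that by (auto simp: max_def divide_le_eq_1 intro: divide_nonneg_nonneg)
  have rrow_le: "(\<Sum>i'\<in>I. \<rho> i i') \<le> u i" and rcol_le: "(\<Sum>i'\<in>I. \<rho> i' i) \<le> v i" if "i \<in> I" for i
    unfolding rrow[OF that] rcol[OF that]
    by (rule mult_left_le[OF frac(4)[OF V0 U0] u0[OF that]],
        rule mult_left_le[OF frac(2)[OF U0 V0] v0[OF that]])
  define \<pi>' where "\<pi>' i i' = \<pi> i i' + \<rho> i i'" for i i'
  \<comment> \<open>Pairs matched so far share their class at level \<open>J\<close>, so they take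
    equal mass from both sides of it: the residual excess is the original one.\<close>
  have UV: "U k - V k = sum a (cl k) - sum b (cl k)" for k
  proof -
    have "(\<Sum>i\<in>cl k. \<Sum>i'\<in>I. \<pi> i i') = (\<Sum>i\<in>cl k. \<Sum>i'\<in>cl k. \<pi> i i')"
      using supp fin clI by (intro sum.cong sum.mono_neutral_right) (auto simp: cl_def)
    also have "\<dots> = (\<Sum>i'\<in>cl k. \<Sum>i\<in>cl k. \<pi> i i')" by (rule sum.swap)
    also have "\<dots> = (\<Sum>i'\<in>cl k. \<Sum>i\<in>I. \<pi> i i')"
      using supp fin clI by (intro sum.cong sum.mono_neutral_left) (auto simp: cl_def)
    finally show ?thesis by (simp add: U_def V_def u_def v_def sum_subtractf)
  qed
  \<comment> \<open>After this stage a class keeps exactly the positive part of its excess.\<close>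
  have left: "(\<Sum>i\<in>I. u i - (\<Sum>i'\<in>I. \<rho> i i')) = (\<Sum>k\<in>g J ` I. max 0 (sum a (cl k) - sum b (cl k)))"
  proof -
    have "(\<Sum>i\<in>I. u i - (\<Sum>i'\<in>I. \<rho> i i')) = (\<Sum>k\<in>g J ` I. \<Sum>i\<in>cl k. u i - (\<Sum>i'\<in>I. \<rho> i i'))"
      unfolding cl_def using fin by (rule sum.image_gen)
    also have "\<dots> = (\<Sum>k\<in>g J ` I. U k * (1 - V k / max (U k) (V k)))"
    proof (rule sum.cong[OF refl])
      fix k
      have "(\<Sum>i\<in>cl k. u i - (\<Sum>i'\<in>I. \<rho> i i')) = (\<Sum>i\<in>cl k. u i * (1 - V k / max (U k) (V k)))"
        by (intro sum.cong refl) (auto simp: cl_def rrow right_diff_distrib)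
      then show "(\<Sum>i\<in>cl k. u i - (\<Sum>i'\<in>I. \<rho> i i')) = U k * (1 - V k / max (U k) (V k))"
        by (simp add: U_def sum_distrib_right)
    qed
    also have "\<dots> = (\<Sum>k\<in>g J ` I. max 0 (U k - V k))"
    proof (rule sum.cong[OF refl])
      fix k
      have "s * (1 - t / max s t) = max 0 (s - t)" if "0 \<le> s" "0 \<le> t" for s t :: real
        using that by (cases "s = 0"; cases "s \<ge> t") (auto simp: max_def field_simps)
      then show "U k * (1 - V k / max (U k) (V k)) = max 0 (U k - V k)" using U0 V0 by blast
    qed
    finally show ?thesis by (simp add: UV)
  qed
  have total: "(\<Sum>i\<in>I. a i - (\<Sum>i'\<in>I. \<pi>' i i')) = (\<Sum>i\<in>I. u i - (\<Sum>i'\<in>I. \<rho> i i'))"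
    by (intro sum.cong refl) (simp add: \<pi>'_def u_def sum.distrib)
  show ?case
  proof (intro exI[of _ \<pi>'] conjI ballI allI impI)
    fix i i' assume i: "i \<in> I" "i' \<in> I"
    show "0 \<le> \<pi>' i i'" using pos \<rho>0 i by (simp add: \<pi>'_def)
    fix j assume j: "Suc J \<le> j" and "\<pi>' i i' \<noteq> 0"
    then have "\<pi> i i' \<noteq> 0 \<or> \<rho> i i' \<noteq> 0" by (auto simp: \<pi>'_def)
    then have "g J i = g J i'" using supp[OF i, of J] by (auto simp: \<rho>_def split: if_splits)
    moreover have "J \<le> j" using j by simp
    ultimately show "g j i = g j i'" using nested[OF i] by (rule_tac dec_induct)
  next
    fix i assume i: "i \<in> I"
    show "(\<Sum>i'\<in>I. \<pi>' i i') \<le> a i"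
      using rrow_le[OF i] by (simp add: \<pi>'_def u_def sum.distrib)
    show "(\<Sum>i'\<in>I. \<pi>' i' i) \<le> b i"
      using rcol_le[OF i] by (simp add: \<pi>'_def v_def sum.distrib)
  next
    fix j assume "j < Suc J"
    then consider "j < J" | "j = J" by linarith
    then show "(\<Sum>i\<in>I. \<Sum>i'\<in>I. if g j i = g j i' then 0 else \<pi>' i i') + (\<Sum>i\<in>I. a i - (\<Sum>i'\<in>I. \<pi>' i i'))
      \<le> (\<Sum>k\<in>g j ` I. max 0 ((\<Sum>i\<in>{i\<in>I. g j i = k}. a i) - (\<Sum>i\<in>{i\<in>I. g j i = k}. b i)))"
    proof cases
      case 1
      \<comment> \<open>At a finer level the new mass may count as crossing, but it is no longer
        unmatched, so the sum of both terms does not grow.\<close>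
      have "(\<Sum>i\<in>I. \<Sum>i'\<in>I. if g j i = g j i' then 0 else \<pi>' i i')
          \<le> (\<Sum>i\<in>I. \<Sum>i'\<in>I. (if g j i = g j i' then 0 else \<pi> i i') + \<rho> i i')"
        using \<rho>0 by (intro sum_mono) (auto simp: \<pi>'_def)
      also have "\<dots> = (\<Sum>i\<in>I. \<Sum>i'\<in>I. if g j i = g j i' then 0 else \<pi> i i') + (\<Sum>i\<in>I. \<Sum>i'\<in>I. \<rho> i i')"
        by (simp add: sum.distrib)
      finally show ?thesis
        using lev[OF 1] unfolding total by (simp add: u_def sum_subtractf)
    next
      case 2
      have "(\<Sum>i\<in>I. \<Sum>i'\<in>I. if g J i = g J i' then 0 else \<pi>' i i') = 0"
        using supp by (intro sum.neutral ballI) (fastforce simp: \<pi>'_def \<rho>_def)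
      then show ?thesis using left unfolding 2 total by (simp add: cl_def)
    qed
  qed
qed

text \<open>One further level \<open>Suc J\<close> with a single class leaves nothing unmatched,
  because the total masses agree. Positive parts are relaxed to absolute values, whose expectation
  is bounded later.\<close>

lemma nested_coupling_discrete:
  fixes a b :: "'i \<Rightarrow> real" and g :: "nat \<Rightarrow> 'i \<Rightarrow> 'k"
  assumes fin: "finite I"
    and a: "\<And>i. i \<in> I \<Longrightarrow> 0 \<le> a i" and b: "\<And>i. i \<in> I \<Longrightarrow> 0 \<le> b i" and ab: "sum a I = sum b I"
    and nested: "\<And>j i i'. i \<in> I \<Longrightarrow> i' \<in> I \<Longrightarrow> g j i = g j i' \<Longrightarrow> g (Suc j) i = g (Suc j) i'"
    and top: "\<And>i i'. i \<in> I \<Longrightarrow> i' \<in> I \<Longrightarrow> g (Suc J) i = g (Suc J) i'"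
  obtains \<pi> where "\<And>i i'. i \<in> I \<Longrightarrow> i' \<in> I \<Longrightarrow> 0 \<le> \<pi> i i'"
    "\<And>i. i \<in> I \<Longrightarrow> (\<Sum>i'\<in>I. \<pi> i i') = a i" "\<And>i'. i' \<in> I \<Longrightarrow> (\<Sum>i\<in>I. \<pi> i i') = b i'"
    "\<And>j. j \<le> J \<Longrightarrow> (\<Sum>i\<in>I. \<Sum>i'\<in>I. if g j i = g j i' then 0 else \<pi> i i')
      \<le> (\<Sum>k\<in>g j ` I. \<bar>(\<Sum>i\<in>{i\<in>I. g j i = k}. a i) - (\<Sum>i\<in>{i\<in>I. g j i = k}. b i)\<bar>)"
proof -
  let ?lev = "\<lambda>\<pi>. \<forall>j<Suc (Suc J).
      (\<Sum>i\<in>I. \<Sum>i'\<in>I. if g j i = g j i' then 0 else \<pi> i i') + (\<Sum>i\<in>I. a i - (\<Sum>i'\<in>I. \<pi> i i'))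
      \<le> (\<Sum>k\<in>g j ` I. max 0 ((\<Sum>i\<in>{i\<in>I. g j i = k}. a i) - (\<Sum>i\<in>{i\<in>I. g j i = k}. b i)))"
  obtain \<pi> where H: "(\<forall>i\<in>I. \<forall>i'\<in>I. 0 \<le> \<pi> i i') \<and>
      (\<forall>i\<in>I. (\<Sum>i'\<in>I. \<pi> i i') \<le> a i) \<and> (\<forall>i'\<in>I. (\<Sum>i\<in>I. \<pi> i i') \<le> b i') \<and>
      (\<forall>i\<in>I. \<forall>i'\<in>I. \<forall>j\<ge>Suc (Suc J). \<pi> i i' \<noteq> 0 \<longrightarrow> g j i = g j i') \<and> ?lev \<pi>"
    by (rule exE[OF nested_partial_coupling[of I a b g "Suc (Suc J)"]])
       ((rule fin a b nested; assumption)+, rule that)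
  note pos = H[THEN conjunct1, rule_format]
    and row = H[THEN conjunct2, THEN conjunct1, rule_format]
    and col = H[THEN conjunct2, THEN conjunct2, THEN conjunct1, rule_format]
    and lev = H[THEN conjunct2, THEN conjunct2, THEN conjunct2, THEN conjunct2, rule_format]
  have left0: "0 \<le> (\<Sum>i\<in>I. a i - (\<Sum>i'\<in>I. \<pi> i i'))"
    using row by (intro sum_nonneg) auto
  have "(\<Sum>k\<in>g (Suc J) ` I. max 0 ((\<Sum>i\<in>{i\<in>I. g (Suc J) i = k}. a i) - (\<Sum>i\<in>{i\<in>I. g (Suc J) i = k}. b i))) = 0"
  proof (rule sum.neutral, rule ballI)
    fix k assume "k \<in> g (Suc J) ` I"
    then have "{i\<in>I. g (Suc J) i = k} = I" using top by blast
    then show "max 0 ((\<Sum>i\<in>{i\<in>I. g (Suc J) i = k}. a i) - (\<Sum>i\<in>{i\<in>I. g (Suc J) i = k}. b i)) = 0"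
      using ab by simp
  qed
  moreover have "0 \<le> (\<Sum>i\<in>I. \<Sum>i'\<in>I. if g (Suc J) i = g (Suc J) i' then 0 else \<pi> i i')"
    using pos by (intro sum_nonneg) auto
  ultimately have z: "(\<Sum>i\<in>I. a i - (\<Sum>i'\<in>I. \<pi> i i')) = 0"
    using lev[of "Suc J"] left0 by simp
  then have row': "(\<Sum>i'\<in>I. \<pi> i i') = a i" if "i \<in> I" for i
    using sum_nonneg_eq_0_iff[of I "\<lambda>i. a i - (\<Sum>i'\<in>I. \<pi> i i')"] fin row that by simp
  have "(\<Sum>i'\<in>I. b i' - (\<Sum>i\<in>I. \<pi> i i')) = 0"
    using z ab sum.swap[of \<pi> I I] by (simp add: sum_subtractf)
  then have col': "(\<Sum>i\<in>I. \<pi> i i') = b i'" if "i' \<in> I" for i'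
    using sum_nonneg_eq_0_iff[of I "\<lambda>i'. b i' - (\<Sum>i\<in>I. \<pi> i i')"] fin col that by simp
  have "(\<Sum>i\<in>I. \<Sum>i'\<in>I. if g j i = g j i' then 0 else \<pi> i i')
      \<le> (\<Sum>k\<in>g j ` I. \<bar>(\<Sum>i\<in>{i\<in>I. g j i = k}. a i) - (\<Sum>i\<in>{i\<in>I. g j i = k}. b i)\<bar>)" if "j \<le> J" for j
  proof -
    have "(\<Sum>k\<in>g j ` I. max 0 ((\<Sum>i\<in>{i\<in>I. g j i = k}. a i) - (\<Sum>i\<in>{i\<in>I. g j i = k}. b i)))
      \<le> (\<Sum>k\<in>g j ` I. \<bar>(\<Sum>i\<in>{i\<in>I. g j i = k}. a i) - (\<Sum>i\<in>{i\<in>I. g j i = k}. b i)\<bar>)"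
      by (intro sum_mono) auto
    then show ?thesis using lev[of j] that z by simp
  qed
  then show thesis using that pos row' col' by blast
qed

section \<open>From masses of cells to couplings of measures\<close>

lemma nn_integral_finite_image:
  assumes fin: "finite I" and \<iota>: "\<And>x. x \<in> space N \<Longrightarrow> \<iota> x \<in> I"
    and [measurable]: "\<iota> \<in> measurable N (count_space UNIV)"
  shows "(\<integral>\<^sup>+ x. F (\<iota> x) \<partial>N) = (\<Sum>i\<in>I. F i * emeasure N {x \<in> space N. \<iota> x = i})"
proof -
  have "(\<integral>\<^sup>+ x. F (\<iota> x) \<partial>N) = (\<integral>\<^sup>+ x. (\<Sum>i\<in>I. F i * indicator {x \<in> space N. \<iota> x = i} x) \<partial>N)"
  proof (rule nn_integral_cong)
    fix x assume x: "x \<in> space N"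
    have "(\<Sum>i\<in>I. F i * indicator {x \<in> space N. \<iota> x = i} x) = (\<Sum>i\<in>{\<iota> x}. F i * indicator {x \<in> space N. \<iota> x = i} x)"
      using fin \<iota>[OF x] by (intro sum.mono_neutral_right) auto
    then show "F (\<iota> x) = (\<Sum>i\<in>I. F i * indicator {x \<in> space N. \<iota> x = i} x)" using x by simp
  qed
  also have "\<dots> = (\<Sum>i\<in>I. F i * emeasure N {x \<in> space N. \<iota> x = i})"
    by (simp add: nn_integral_sum nn_integral_cmult_indicator)
  finally show ?thesis .
qed

lemma borel_measurable_finite_image_pair:
  fixes G :: "'i \<Rightarrow> 'k \<Rightarrow> ennreal"
  assumes fin: "finite I" "finite I'" and \<iota>: "\<iota> \<in> space N \<rightarrow> I" "\<kappa> \<in> space N \<rightarrow> I'"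
    and [measurable]: "\<iota> \<in> measurable N (count_space UNIV)" "\<kappa> \<in> measurable N (count_space UNIV)"
  shows "(\<lambda>z. G (\<iota> z) (\<kappa> z)) \<in> borel_measurable N"
proof -
  have "(\<lambda>z. \<Sum>i\<in>I. \<Sum>k\<in>I'. G i k * indicator {z \<in> space N. \<iota> z = i \<and> \<kappa> z = k} z) \<in> borel_measurable N"
    by measurable
  moreover have "(\<Sum>i\<in>I. \<Sum>k\<in>I'. G i k * indicator {z \<in> space N. \<iota> z = i \<and> \<kappa> z = k} z) = G (\<iota> z) (\<kappa> z)"
    if z: "z \<in> space N" for z
  proof -
    have "G i k * indicator {z \<in> space N. \<iota> z = i \<and> \<kappa> z = k} z
        = (if k = \<kappa> z then if i = \<iota> z then G i k else 0 else 0)" for i k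
      using z by (auto simp: indicator_def)
    moreover have "\<iota> z \<in> I" "\<kappa> z \<in> I'" using z \<iota> by auto
    ultimately show ?thesis using fin by simp
  qed
  ultimately show ?thesis by (rule measurable_cong[THEN iffD1, rotated])
qed

lemma distr_eqI_nn_integral:
  assumes [measurable]: "f \<in> measurable h \<mu>"
    and int: "\<And>A. A \<in> sets \<mu> \<Longrightarrow> (\<integral>\<^sup>+ z. indicator A (f z) \<partial>h) = (\<integral>\<^sup>+ x. indicator A x \<partial>\<mu>)"
  shows "distr h \<mu> f = \<mu>"
proof (rule measure_eqI)
  fix A assume "A \<in> sets (distr h \<mu> f)"
  then have A [measurable]: "A \<in> sets \<mu>" by simp
  have "emeasure (distr h \<mu> f) A = (\<integral>\<^sup>+ x. indicator A x \<partial>distr h \<mu> f)" by simp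
  also have "\<dots> = (\<integral>\<^sup>+ z. indicator A (f z) \<partial>h)" by (intro nn_integral_distr) auto
  also have "\<dots> = emeasure \<mu> A" using int[OF A] by simp
  finally show "emeasure (distr h \<mu> f) A = emeasure \<mu> A" .
qed simp

text \<open>The sum is the conditional mass of the second coordinate given the cell of
  \<open>x\<close>. It can differ from 1 only on cells of measure zero, where the quotient takes the
  default value 0, and there are finitely many of these.\<close>

lemma (in prob_space) AE_finite_image_weight_eq_1:
  fixes \<pi> :: "'i \<Rightarrow> 'i \<Rightarrow> real" and b :: "'i \<Rightarrow> real"
  assumes fin: "finite I" and \<iota>: "\<iota> \<in> space M \<rightarrow> I"
    and [measurable]: "\<iota> \<in> measurable M (count_space UNIV)"
    and pos: "\<And>i i'. i \<in> I \<Longrightarrow> i' \<in> I \<Longrightarrow> 0 \<le> \<pi> i i'" "\<And>i. i \<in> I \<Longrightarrow> 0 \<le> b i"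
    and row: "\<And>i. i \<in> I \<Longrightarrow> (\<Sum>i'\<in>I. \<pi> i i') = prob {x \<in> space M. \<iota> x = i}"
    and zero: "\<And>i i'. i \<in> I \<Longrightarrow> i' \<in> I \<Longrightarrow> b i' = 0 \<Longrightarrow> \<pi> i i' = 0"
  shows "AE x in M. (\<Sum>i'\<in>I. ennreal (\<pi> (\<iota> x) i' / (prob {y \<in> space M. \<iota> y = \<iota> x} * b i')) * ennreal (b i')) = 1"
proof -
  have "AE x in M. \<iota> x \<noteq> i" if "prob {x \<in> space M. \<iota> x = i} = 0" for i
  proof -
    have "{x \<in> space M. \<iota> x = i} \<in> null_sets M"
      using that by (intro null_setsI) (auto simp: emeasure_eq_measure)
    from AE_not_in[OF this] show ?thesis by (rule AE_mp) (auto intro!: AE_I2)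
  qed
  then have "AE x in M. \<forall>i\<in>{i\<in>I. prob {x \<in> space M. \<iota> x = i} = 0}. \<iota> x \<noteq> i"
    using fin by (intro AE_finite_allI) auto
  then show ?thesis
  proof (rule AE_mp, intro AE_I2 impI)
    fix x assume x: "x \<in> space M" and nz: "\<forall>i\<in>{i\<in>I. prob {x \<in> space M. \<iota> x = i} = 0}. \<iota> x \<noteq> i"
    define i where "i = \<iota> x"
    have i: "i \<in> I" using x \<iota> by (auto simp: i_def)
    have ai: "prob {y \<in> space M. \<iota> y = i} \<noteq> 0" using nz i by (auto simp: i_def)
    have "(\<Sum>i'\<in>I. ennreal (\<pi> i i' / (prob {y \<in> space M. \<iota> y = i} * b i')) * ennreal (b i'))
        = (\<Sum>i'\<in>I. ennreal (\<pi> i i' / prob {y \<in> space M. \<iota> y = i}))"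
    proof (intro sum.cong refl)
      fix i' assume i': "i' \<in> I"
      show "ennreal (\<pi> i i' / (prob {y \<in> space M. \<iota> y = i} * b i')) * ennreal (b i')
          = ennreal (\<pi> i i' / prob {y \<in> space M. \<iota> y = i})"
        using zero[OF i i'] pos(1)[OF i i'] pos(2)[OF i']
        by (cases "b i' = 0") (simp_all add: ennreal_mult[symmetric])
    qed
    also have "\<dots> = ennreal ((\<Sum>i'\<in>I. \<pi> i i') / prob {y \<in> space M. \<iota> y = i})"
      using pos i by (subst sum_ennreal) (auto simp: sum_divide_distrib)
    also have "\<dots> = 1" using ai by (simp add: row[OF i])
    finally show "(\<Sum>i'\<in>I. ennreal (\<pi> (\<iota> x) i' / (prob {y \<in> space M. \<iota> y = \<iota> x} * b i')) * ennreal (b i')) = 1"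
      by (simp add: i_def)
  qed
qed

text \<open>Inside a pair of cells the points are paired independently, so each marginal keeps its
  distribution within the cells. The second conclusion fixes the mass of every pair of cells, which
  is all that a cost bounded cell by cell needs.\<close>

lemma coupling_of_discrete:
  fixes \<mu> \<nu> :: "'a measure" and \<pi> :: "'i \<Rightarrow> 'i \<Rightarrow> real"
  assumes \<mu>: "prob_space \<mu>" and \<nu>: "prob_space \<nu>" and sets: "sets \<nu> = sets \<mu>"
    and fin: "finite I" and \<iota>: "\<iota> \<in> space \<mu> \<rightarrow> I" and m: "\<iota> \<in> measurable \<mu> (count_space UNIV)"
    and pos: "\<And>i i'. i \<in> I \<Longrightarrow> i' \<in> I \<Longrightarrow> 0 \<le> \<pi> i i'"
    and row: "\<And>i. i \<in> I \<Longrightarrow> (\<Sum>i'\<in>I. \<pi> i i') = measure \<mu> {x \<in> space \<mu>. \<iota> x = i}"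
    and col: "\<And>i'. i' \<in> I \<Longrightarrow> (\<Sum>i\<in>I. \<pi> i i') = measure \<nu> {x \<in> space \<mu>. \<iota> x = i'}"
  obtains h where "is_coupling \<mu> \<nu> h"
    "\<And>G. (\<integral>\<^sup>+ z. G (\<iota> (fst z)) (\<iota> (snd z)) \<partial>h) = (\<Sum>i\<in>I. \<Sum>i'\<in>I. ennreal (\<pi> i i') * G i i')"
proof -
  interpret M1: prob_space \<mu> by fact
  interpret M2: prob_space \<nu> by fact
  interpret P: pair_prob_space \<mu> \<nu> ..
  note [measurable] = m
  have sp: "space \<nu> = space \<mu>" using sets by (rule sets_eq_imp_space_eq)
  have m2 [measurable]: "\<iota> \<in> measurable \<nu> (count_space UNIV)"
    using m by (simp add: measurable_cong_sets[OF sets refl])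
  define a where "a i = measure \<mu> {x \<in> space \<mu>. \<iota> x = i}" for i
  define b where "b i = measure \<nu> {x \<in> space \<mu>. \<iota> x = i}" for i
  have ab0: "0 \<le> a i" "0 \<le> b i" for i by (auto simp: a_def b_def)
  have \<pi>_a: "\<pi> i i' = 0" if "i \<in> I" "i' \<in> I" "a i = 0" for i i'
    using row[OF that(1)] sum_nonneg_eq_0_iff[of I "\<pi> i"] pos fin that by (auto simp: a_def)
  have \<pi>_b: "\<pi> i i' = 0" if "i \<in> I" "i' \<in> I" "b i' = 0" for i i'
    using col[OF that(2)] sum_nonneg_eq_0_iff[of I "\<lambda>i. \<pi> i i'"] pos fin that by (auto simp: b_def)
  \<comment> \<open>On a pair of cells the coupling is the rescaled product measure; division by \<open>0\<close> occurs on null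
    cells only.\<close>
  define w where "w i i' = ennreal (\<pi> i i' / (a i * b i'))" for i i'
  define W where "W z = w (\<iota> (fst z)) (\<iota> (snd z))" for z
  define h where "h = density (\<mu> \<Otimes>\<^sub>M \<nu>) W"
  have pair: "(\<lambda>z. \<iota> (fst z)) \<in> space (\<mu> \<Otimes>\<^sub>M \<nu>) \<rightarrow> I" "(\<lambda>z. \<iota> (snd z)) \<in> space (\<mu> \<Otimes>\<^sub>M \<nu>) \<rightarrow> I"
    using \<iota> sp by (auto simp: space_pair_measure)
  have G_meas [measurable]: "(\<lambda>z. G (\<iota> (fst z)) (\<iota> (snd z))) \<in> borel_measurable (\<mu> \<Otimes>\<^sub>M \<nu>)"
    for G :: "'i \<Rightarrow> 'i \<Rightarrow> ennreal"
    by (rule borel_measurable_finite_image_pair[OF fin fin pair]) measurable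
  have [measurable]: "W \<in> borel_measurable (\<mu> \<Otimes>\<^sub>M \<nu>)"
    unfolding W_def by measurable
  have em: "emeasure \<mu> {x \<in> space \<mu>. \<iota> x = i} = ennreal (a i)"
    "emeasure \<nu> {x \<in> space \<mu>. \<iota> x = i} = ennreal (b i)" for i
    by (simp_all add: a_def b_def M1.emeasure_eq_measure M2.emeasure_eq_measure)
  have i1: "(\<integral>\<^sup>+ z. f (fst z) \<partial>h) = (\<integral>\<^sup>+ x. f x \<partial>\<mu>)" if [measurable]: "f \<in> borel_measurable \<mu>" for f
  proof -
    have "(\<integral>\<^sup>+ z. f (fst z) \<partial>h) = (\<integral>\<^sup>+ z. f (fst z) * W z \<partial>(\<mu> \<Otimes>\<^sub>M \<nu>))"
      unfolding h_def by (subst nn_integral_density) (auto simp: mult.commute)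
    also have "\<dots> = (\<integral>\<^sup>+ x. (\<integral>\<^sup>+ y. f x * W (x, y) \<partial>\<nu>) \<partial>\<mu>)"
      by (subst M2.nn_integral_fst[symmetric]) auto
    also have "\<dots> = (\<integral>\<^sup>+ x. f x * (\<Sum>i'\<in>I. w (\<iota> x) i' * ennreal (b i')) \<partial>\<mu>)"
    proof (rule nn_integral_cong)
      fix x assume x: "x \<in> space \<mu>"
      have "(\<integral>\<^sup>+ y. f x * W (x, y) \<partial>\<nu>) = (\<integral>\<^sup>+ y. f x * w (\<iota> x) (\<iota> y) \<partial>\<nu>)" by (simp add: W_def)
      also have "\<dots> = (\<Sum>i'\<in>I. f x * w (\<iota> x) i' * ennreal (b i'))"
        using \<iota> sp by (subst nn_integral_finite_image[OF fin, where F = "\<lambda>i'. f x * w (\<iota> x) i'"])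
          (auto simp: em)
      finally show "(\<integral>\<^sup>+ y. f x * W (x, y) \<partial>\<nu>) = f x * (\<Sum>i'\<in>I. w (\<iota> x) i' * ennreal (b i'))"
        by (simp add: sum_distrib_left mult.assoc)
    qed
    also have "\<dots> = (\<integral>\<^sup>+ x. f x \<partial>\<mu>)"
    proof (rule nn_integral_cong_AE)
      have "AE x in \<mu>. (\<Sum>i'\<in>I. w (\<iota> x) i' * ennreal (b i')) = 1"
        unfolding w_def a_def using \<pi>_b ab0
        by (intro M1.AE_finite_image_weight_eq_1[OF fin \<iota> m pos _ row]) auto
      then show "AE x in \<mu>. f x * (\<Sum>i'\<in>I. w (\<iota> x) i' * ennreal (b i')) = f x" by (rule AE_mp) auto
    qed
    finally show ?thesis .
  qed
  have i2: "(\<integral>\<^sup>+ z. f (snd z) \<partial>h) = (\<integral>\<^sup>+ x. f x \<partial>\<nu>)" if [measurable]: "f \<in> borel_measurable \<nu>" for f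
  proof -
    have "(\<integral>\<^sup>+ z. f (snd z) \<partial>h) = (\<integral>\<^sup>+ z. f (snd z) * W z \<partial>(\<mu> \<Otimes>\<^sub>M \<nu>))"
      unfolding h_def by (subst nn_integral_density) (auto simp: mult.commute)
    also have "\<dots> = (\<integral>\<^sup>+ y. (\<integral>\<^sup>+ x. f y * W (x, y) \<partial>\<mu>) \<partial>\<nu>)"
      by (subst P.nn_integral_snd[symmetric]) auto
    also have "\<dots> = (\<integral>\<^sup>+ y. f y * (\<Sum>i\<in>I. w i (\<iota> y) * ennreal (a i)) \<partial>\<nu>)"
    proof (rule nn_integral_cong)
      fix y assume y: "y \<in> space \<nu>"
      have "(\<integral>\<^sup>+ x. f y * W (x, y) \<partial>\<mu>) = (\<integral>\<^sup>+ x. f y * w (\<iota> x) (\<iota> y) \<partial>\<mu>)" by (simp add: W_def)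
      also have "\<dots> = (\<Sum>i\<in>I. f y * w i (\<iota> y) * ennreal (a i))"
        using \<iota> by (subst nn_integral_finite_image[OF fin, where F = "\<lambda>i. f y * w i (\<iota> y)"])
          (auto simp: em)
      finally show "(\<integral>\<^sup>+ x. f y * W (x, y) \<partial>\<mu>) = f y * (\<Sum>i\<in>I. w i (\<iota> y) * ennreal (a i))"
        by (simp add: sum_distrib_left mult.assoc)
    qed
    also have "\<dots> = (\<integral>\<^sup>+ x. f x \<partial>\<nu>)"
    proof (rule nn_integral_cong_AE)
      have "AE y in \<nu>. (\<Sum>i\<in>I. ennreal (\<pi> i (\<iota> y) / (measure \<nu> {x \<in> space \<nu>. \<iota> x = \<iota> y} * a i)) * ennreal (a i)) = 1"
        using \<pi>_a ab0 \<iota> pos col sp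
        by (intro M2.AE_finite_image_weight_eq_1[OF fin _ m2, where \<pi> = "\<lambda>i i'. \<pi> i' i"]) auto
      then show "AE y in \<nu>. f y * (\<Sum>i\<in>I. w i (\<iota> y) * ennreal (a i)) = f y"
        by (rule AE_mp) (auto simp: w_def b_def sp mult.commute)
    qed
    finally show ?thesis .
  qed
  have iG: "(\<integral>\<^sup>+ z. G (\<iota> (fst z)) (\<iota> (snd z)) \<partial>h) = (\<Sum>i\<in>I. \<Sum>i'\<in>I. ennreal (\<pi> i i') * G i i')"
    for G :: "'i \<Rightarrow> 'i \<Rightarrow> ennreal"
  proof -
    have "(\<integral>\<^sup>+ z. G (\<iota> (fst z)) (\<iota> (snd z)) \<partial>h)
        = (\<integral>\<^sup>+ z. w (\<iota> (fst z)) (\<iota> (snd z)) * G (\<iota> (fst z)) (\<iota> (snd z)) \<partial>(\<mu> \<Otimes>\<^sub>M \<nu>))"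
      unfolding h_def by (subst nn_integral_density) (auto simp: W_def)
    also have "\<dots> = (\<integral>\<^sup>+ x. (\<integral>\<^sup>+ y. w (\<iota> x) (\<iota> y) * G (\<iota> x) (\<iota> y) \<partial>\<nu>) \<partial>\<mu>)"
      using G_meas[of "\<lambda>i i'. w i i' * G i i'"]
      by (subst M2.nn_integral_fst[symmetric]) auto
    also have "\<dots> = (\<integral>\<^sup>+ x. (\<Sum>i'\<in>I. w (\<iota> x) i' * G (\<iota> x) i' * ennreal (b i')) \<partial>\<mu>)"
    proof (rule nn_integral_cong)
      fix x assume x: "x \<in> space \<mu>"
      show "(\<integral>\<^sup>+ y. w (\<iota> x) (\<iota> y) * G (\<iota> x) (\<iota> y) \<partial>\<nu>) = (\<Sum>i'\<in>I. w (\<iota> x) i' * G (\<iota> x) i' * ennreal (b i'))"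
        using \<iota> sp by (subst nn_integral_finite_image[OF fin, where F = "\<lambda>i'. w (\<iota> x) i' * G (\<iota> x) i'"])
          (auto simp: em)
    qed
    also have "\<dots> = (\<Sum>i\<in>I. (\<Sum>i'\<in>I. w i i' * G i i' * ennreal (b i')) * ennreal (a i))"
      using \<iota> by (subst nn_integral_finite_image[OF fin, where F = "\<lambda>i. \<Sum>i'\<in>I. w i i' * G i i' * ennreal (b i')"])
        (auto simp: em)
    also have "\<dots> = (\<Sum>i\<in>I. \<Sum>i'\<in>I. ennreal (\<pi> i i') * G i i')"
      unfolding sum_distrib_right
    proof (intro sum.cong refl)
      fix i i' assume i: "i \<in> I" "i' \<in> I"
      have "\<pi> i i' / (a i * b i') * b i' * a i = \<pi> i i'"
        using \<pi>_a[OF i] \<pi>_b[OF i] by auto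
      then have "w i i' * ennreal (b i') * ennreal (a i) = ennreal (\<pi> i i')"
        using pos[OF i] ab0 by (simp add: w_def flip: ennreal_mult)
      then show "w i i' * G i i' * ennreal (b i') * ennreal (a i) = ennreal (\<pi> i i') * G i i'"
        by (metis mult.assoc mult.commute)
    qed
    finally show ?thesis .
  qed
  have sh: "sets h = sets (\<mu> \<Otimes>\<^sub>M \<nu>)" by (simp add: h_def)
  have fm: "fst \<in> measurable h \<mu>" "snd \<in> measurable h \<nu>"
    using measurable_cong_sets[OF sh refl] by auto
  have "emeasure h (space h) = (\<integral>\<^sup>+ z. 1 \<partial>h)" by simp
  also have "\<dots> = 1" using i1[of "\<lambda>_. 1"] by (simp add: M1.emeasure_space_1)
  finally have "prob_space h" by (rule prob_spaceI)
  moreover have "distr h \<mu> fst = \<mu>" using i1 by (intro distr_eqI_nn_integral fm) auto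
  moreover have "distr h \<nu> snd = \<nu>" using i2 by (intro distr_eqI_nn_integral fm) auto
  ultimately show thesis using that sh iG unfolding is_coupling_def by blast
qed

definition cell_deviation :: "'a measure \<Rightarrow> 'a measure \<Rightarrow> 'k set \<Rightarrow> ('a \<Rightarrow> 'k) \<Rightarrow> real" where
  "cell_deviation \<mu> \<nu> K \<kappa> =
     (\<Sum>k\<in>K. \<bar>measure \<mu> {x \<in> space \<mu>. \<kappa> x = k} - measure \<nu> {x \<in> space \<mu>. \<kappa> x = k}\<bar>)"

text \<open>A pair is separated at level \<open>j\<close> with probability at most the cell
  deviation of that level, and is then charged \<open>D (Suc j)\<close>. The terms
  \<open>\<phi>\<close> and \<open>\<psi>\<close> depend on one coordinate each, so they integrate
  against the marginals whatever the coupling is; they carry tails and exceptional sets.\<close>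

lemma nested_coupling:
  fixes \<mu> \<nu> :: "'a measure" and g :: "nat \<Rightarrow> 'i \<Rightarrow> 'k" and D :: "nat \<Rightarrow> real"
    and c :: "'a \<Rightarrow> 'a \<Rightarrow> ennreal"
  assumes \<mu>: "prob_space \<mu>" and \<nu>: "prob_space \<nu>" and sets: "sets \<nu> = sets \<mu>"
    and fin: "finite I" and \<iota>: "\<iota> \<in> space \<mu> \<rightarrow> I" and m: "\<iota> \<in> measurable \<mu> (count_space UNIV)"
    and nested: "\<And>j i i'. i \<in> I \<Longrightarrow> i' \<in> I \<Longrightarrow> g j i = g j i' \<Longrightarrow> g (Suc j) i = g (Suc j) i'"
    and top: "\<And>i i'. i \<in> I \<Longrightarrow> i' \<in> I \<Longrightarrow> g (Suc J) i = g (Suc J) i'"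
    and D: "\<And>j. 0 \<le> D j"
    and \<phi>: "\<phi> \<in> borel_measurable \<mu>" and \<psi>: "\<psi> \<in> borel_measurable \<mu>"
    and cost: "\<And>x y j. x \<in> space \<mu> \<Longrightarrow> y \<in> space \<mu> \<Longrightarrow> j \<le> Suc J \<Longrightarrow> g j (\<iota> x) = g j (\<iota> y) \<Longrightarrow>
      c x y \<le> ennreal (D j) + (\<phi> x + \<psi> y)"
  obtains h where "is_coupling \<mu> \<nu> h"
    "(\<integral>\<^sup>+ z. c (fst z) (snd z) \<partial>h) \<le>
      ennreal (D 0 + (\<Sum>j\<le>J. D (Suc j) * cell_deviation \<mu> \<nu> (g j ` I) (\<lambda>x. g j (\<iota> x))))
      + ((\<integral>\<^sup>+ x. \<phi> x \<partial>\<mu>) + (\<integral>\<^sup>+ y. \<psi> y \<partial>\<nu>))"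
proof -
  interpret M1: prob_space \<mu> by fact
  interpret M2: prob_space \<nu> by fact
  note [measurable] = m
  have sp: "space \<nu> = space \<mu>" using sets by (rule sets_eq_imp_space_eq)
  have class_sum: "measure N {x \<in> space \<mu>. \<iota> x \<in> S} = (\<Sum>i\<in>S. measure N {x \<in> space \<mu>. \<iota> x = i})"
    if N: "finite_measure N" "sets N = sets \<mu>" and S: "S \<subseteq> I" for N S
  proof -
    interpret N: finite_measure N by fact
    have spN: "space N = space \<mu>" using N(2) by (rule sets_eq_imp_space_eq)
    have "{x \<in> space \<mu>. \<iota> x \<in> S} = (\<Union>i\<in>S. {x \<in> space \<mu>. \<iota> x = i})" by auto
    then show ?thesis
      using finite_subset[OF S fin] N(2)
      by (simp only:) (rule N.finite_measure_finite_Union, auto simp: disjoint_family_on_def)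
  qed
  have cls: "measure N {x \<in> space \<mu>. g j (\<iota> x) = k} = (\<Sum>i\<in>{i\<in>I. g j i = k}. measure N {x \<in> space \<mu>. \<iota> x = i})"
    if "finite_measure N" "sets N = sets \<mu>" for N j k
  proof -
    have "{x \<in> space \<mu>. g j (\<iota> x) = k} = {x \<in> space \<mu>. \<iota> x \<in> {i\<in>I. g j i = k}}" using \<iota> by auto
    then show ?thesis using class_sum[OF that, of "{i\<in>I. g j i = k}"] by simp
  qed
  define a where "a i = measure \<mu> {x \<in> space \<mu>. \<iota> x = i}" for i
  define b where "b i = measure \<nu> {x \<in> space \<mu>. \<iota> x = i}" for i
  have ab0: "0 \<le> a i" "0 \<le> b i" for i by (auto simp: a_def b_def)
  have all: "{x \<in> space \<mu>. \<iota> x \<in> I} = space \<mu>" using \<iota> by auto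
  have a1: "sum a I = 1"
    using class_sum[OF M1.finite_measure_axioms refl order_refl] by (simp add: all a_def M1.prob_space)
  have "sum b I = 1"
    using class_sum[OF M2.finite_measure_axioms sets order_refl] M2.prob_space by (simp add: all b_def sp)
  with a1 have ab: "sum a I = sum b I" by simp
  obtain \<pi> where pos: "\<And>i i'. i \<in> I \<Longrightarrow> i' \<in> I \<Longrightarrow> 0 \<le> \<pi> i i'"
    and row: "\<And>i. i \<in> I \<Longrightarrow> (\<Sum>i'\<in>I. \<pi> i i') = a i" and col: "\<And>i'. i' \<in> I \<Longrightarrow> (\<Sum>i\<in>I. \<pi> i i') = b i'"
    and lev: "\<And>j. j \<le> J \<Longrightarrow> (\<Sum>i\<in>I. \<Sum>i'\<in>I. if g j i = g j i' then 0 else \<pi> i i')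
      \<le> (\<Sum>k\<in>g j ` I. \<bar>(\<Sum>i\<in>{i\<in>I. g j i = k}. a i) - (\<Sum>i\<in>{i\<in>I. g j i = k}. b i)\<bar>)"
    by (rule nested_coupling_discrete[of I a b g J]; (rule fin ab0 ab nested top; assumption)?) blast
  obtain h where coupling: "is_coupling \<mu> \<nu> h"
    and hG: "\<And>G. (\<integral>\<^sup>+ z. G (\<iota> (fst z)) (\<iota> (snd z)) \<partial>h) = (\<Sum>i\<in>I. \<Sum>i'\<in>I. ennreal (\<pi> i i') * G i i')"
    by (rule coupling_of_discrete[OF \<mu> \<nu> sets fin \<iota> m pos row[unfolded a_def] col[unfolded b_def]])
       (assumption | (rule that; (assumption | blast)))+
  then have h: "prob_space h" "sets h = sets (\<mu> \<Otimes>\<^sub>M \<nu>)" "distr h \<mu> fst = \<mu>" "distr h \<nu> snd = \<nu>"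
    by (simp_all add: is_coupling_def)
  \<comment> \<open>Every level that separates the pair is charged, so that the integral splits into
    one term for each level.\<close>
  define G where "G i i' = D 0 + (\<Sum>j\<le>J. if g j i = g j i' then 0 else D (Suc j))" for i i'
  have G0: "0 \<le> G i i'" for i i'
    using D by (auto simp: G_def intro!: add_nonneg_nonneg sum_nonneg)
  have cG: "c x y \<le> ennreal (G (\<iota> x) (\<iota> y)) + (\<phi> x + \<psi> y)" if xy: "x \<in> space \<mu>" "y \<in> space \<mu>" for x y
  proof -
    have top': "g (Suc J) (\<iota> x) = g (Suc J) (\<iota> y)" using top \<iota> xy by blast
    \<comment> \<open>At the first common level \<open>l > 0\<close> the pair is still separated at
      \<open>l - 1\<close>, and that summand of \<open>G\<close> equals \<open>D l\<close>.\<close>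
    define l where "l = (LEAST j. g j (\<iota> x) = g j (\<iota> y))"
    have l: "g l (\<iota> x) = g l (\<iota> y)" unfolding l_def using top' by (rule LeastI)
    have l_le: "l \<le> Suc J" unfolding l_def using top' by (rule Least_le)
    have "D l \<le> G (\<iota> x) (\<iota> y)"
    proof (cases l)
      case 0
      then show ?thesis using D by (auto simp: G_def intro!: sum_nonneg)
    next
      case (Suc l')
      have "g l' (\<iota> x) \<noteq> g l' (\<iota> y)" using not_less_Least[of l' "\<lambda>j. g j (\<iota> x) = g j (\<iota> y)"] Suc by (simp add: l_def)
      then have "D l = (if g l' (\<iota> x) = g l' (\<iota> y) then 0 else D (Suc l'))" using Suc by simp
      also have "\<dots> \<le> (\<Sum>j\<le>J. if g j (\<iota> x) = g j (\<iota> y) then 0 else D (Suc j))"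
        using Suc l_le D by (intro member_le_sum[of l' "{..J}" "\<lambda>j. if g j (\<iota> x) = g j (\<iota> y) then 0 else D (Suc j)"]) auto
      finally show ?thesis using D[of 0] by (simp add: G_def)
    qed
    then have "ennreal (D l) \<le> ennreal (G (\<iota> x) (\<iota> y))" by (rule ennreal_leI)
    then show ?thesis
      using cost[OF xy l_le l] by (meson add_right_mono order_trans)
  qed
  interpret h: prob_space h by fact
  have sh: "space h = space \<mu> \<times> space \<mu>"
    using sets_eq_imp_space_eq[OF h(2)] by (simp add: space_pair_measure sp)
  have fm [measurable]: "fst \<in> measurable h \<mu>" "snd \<in> measurable h \<nu>"
    using measurable_cong_sets[OF h(2) refl] by auto
  have \<psi>' [measurable]: "\<psi> \<in> borel_measurable \<nu>" using \<psi> by (simp add: measurable_cong_sets[OF sets refl])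
  have [measurable]: "\<phi> \<in> borel_measurable \<mu>" by (rule \<phi>)
  have [measurable]: "\<iota> \<in> measurable \<nu> (count_space UNIV)"
    using m by (simp add: measurable_cong_sets[OF sets refl])
  have Gm [measurable]: "(\<lambda>z. ennreal (G (\<iota> (fst z)) (\<iota> (snd z)))) \<in> borel_measurable h"
    using \<iota> by (intro borel_measurable_finite_image_pair[OF fin fin, where G = "\<lambda>i i'. ennreal (G i i')"])
      (auto simp: sh)
  have "(\<integral>\<^sup>+ z. c (fst z) (snd z) \<partial>h)
      \<le> (\<integral>\<^sup>+ z. ennreal (G (\<iota> (fst z)) (\<iota> (snd z))) + (\<phi> (fst z) + \<psi> (snd z)) \<partial>h)"
    by (intro nn_integral_mono cG) (auto simp: sh)
  also have "\<dots> = (\<integral>\<^sup>+ z. ennreal (G (\<iota> (fst z)) (\<iota> (snd z))) \<partial>h)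
      + ((\<integral>\<^sup>+ z. \<phi> (fst z) \<partial>h) + (\<integral>\<^sup>+ z. \<psi> (snd z) \<partial>h))"
    by (simp add: nn_integral_add)
  also have "(\<integral>\<^sup>+ z. \<phi> (fst z) \<partial>h) = (\<integral>\<^sup>+ x. \<phi> x \<partial>\<mu>)"
    using nn_integral_distr[OF fm(1), of \<phi>] by (simp add: h(3))
  also have "(\<integral>\<^sup>+ z. \<psi> (snd z) \<partial>h) = (\<integral>\<^sup>+ x. \<psi> x \<partial>\<nu>)"
    using nn_integral_distr[OF fm(2), of \<psi>] by (simp add: h(4))
  also have "(\<integral>\<^sup>+ z. ennreal (G (\<iota> (fst z)) (\<iota> (snd z))) \<partial>h) = (\<Sum>i\<in>I. \<Sum>i'\<in>I. ennreal (\<pi> i i') * ennreal (G i i'))"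
    by (rule hG)
  also have "\<dots> = ennreal (\<Sum>i\<in>I. \<Sum>i'\<in>I. \<pi> i i' * G i i')"
    using pos G0 by (simp add: sum_nonneg flip: ennreal_mult sum_ennreal)
  also have "(\<Sum>i\<in>I. \<Sum>i'\<in>I. \<pi> i i' * G i i')
      = D 0 + (\<Sum>j\<le>J. D (Suc j) * (\<Sum>i\<in>I. \<Sum>i'\<in>I. if g j i = g j i' then 0 else \<pi> i i'))"
  proof -
    have "(\<Sum>i\<in>I. \<Sum>i'\<in>I. \<pi> i i' * G i i') = (\<Sum>i\<in>I. \<Sum>i'\<in>I. \<pi> i i' * D 0)
        + (\<Sum>i\<in>I. \<Sum>i'\<in>I. \<Sum>j\<le>J. D (Suc j) * (if g j i = g j i' then 0 else \<pi> i i'))"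
      unfolding G_def distrib_left sum.distrib sum_distrib_left
      by (intro arg_cong2[of _ _ _ _ "(+)"] sum.cong refl) (auto simp: mult.commute)
    also have "(\<Sum>i\<in>I. \<Sum>i'\<in>I. \<pi> i i' * D 0) = D 0"
      using a1 row by (simp flip: sum_distrib_right)
    also have "(\<Sum>i\<in>I. \<Sum>i'\<in>I. \<Sum>j\<le>J. D (Suc j) * (if g j i = g j i' then 0 else \<pi> i i'))
        = (\<Sum>j\<le>J. \<Sum>i\<in>I. \<Sum>i'\<in>I. D (Suc j) * (if g j i = g j i' then 0 else \<pi> i i'))"
    proof -
      have "(\<Sum>i'\<in>I. \<Sum>j\<le>J. D (Suc j) * (if g j i = g j i' then 0 else \<pi> i i'))
          = (\<Sum>j\<le>J. \<Sum>i'\<in>I. D (Suc j) * (if g j i = g j i' then 0 else \<pi> i i'))" for i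
        by (rule sum.swap)
      then show ?thesis by (simp only:) (rule sum.swap)
    qed
    finally show ?thesis by (simp only: sum_distrib_left)
  qed
  finally have "(\<integral>\<^sup>+ z. c (fst z) (snd z) \<partial>h) \<le>
      ennreal (D 0 + (\<Sum>j\<le>J. D (Suc j) * (\<Sum>i\<in>I. \<Sum>i'\<in>I. if g j i = g j i' then 0 else \<pi> i i')))
      + ((\<integral>\<^sup>+ x. \<phi> x \<partial>\<mu>) + (\<integral>\<^sup>+ y. \<psi> y \<partial>\<nu>))" .
  also have "\<dots> \<le> ennreal (D 0 + (\<Sum>j\<le>J. D (Suc j) * cell_deviation \<mu> \<nu> (g j ` I) (\<lambda>x. g j (\<iota> x))))
      + ((\<integral>\<^sup>+ x. \<phi> x \<partial>\<mu>) + (\<integral>\<^sup>+ y. \<psi> y \<partial>\<nu>))"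
    unfolding cell_deviation_def cls[OF M1.finite_measure_axioms refl] cls[OF M2.finite_measure_axioms sets]
      a_def[symmetric] b_def[symmetric]
    using lev D by (intro add_mono ennreal_leI sum_mono mult_left_mono order_refl) auto
  finally show thesis using that coupling by blast
qed

section \<open>Independent samples\<close>

text \<open>Integrated with \<open>y = f x\<close>, this bounds the sum of \<open>2 ^ k\<close>
  times the measure of \<open>{2 ^ k < f}\<close> by twice the integral of \<open>f\<close>.\<close>

lemma sum_pow2_below: "(\<Sum>k<K. if 2 ^ k < y then 2 ^ k else 0) \<le> 2 * y" if "0 \<le> y" for y :: real
proof (induction K)
  case 0
  then show ?case using that by simp
next
  case (Suc K)
  show ?case
  proof (cases "2 ^ K < y")
    case True
    have "(\<Sum>k<Suc K. if 2 ^ k < y then 2 ^ k else 0) \<le> (\<Sum>k<Suc K. 2 ^ k :: real)"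
      by (intro sum_mono) auto
    also have "\<dots> = 2 ^ Suc K - 1" by (simp only: geometric_sum[of "2 :: real"]) simp
    finally show ?thesis using True by simp
  next
    case False
    then show ?thesis using Suc by simp
  qed
qed

text \<open>Integrated with \<open>y = f x\<close>, this is the summability of the Chebyshev bounds:
  second moments truncated at \<open>2 ^ k\<close>, divided by \<open>2 ^ k\<close>.\<close>

lemma sum_inverse_pow2_above: "(\<Sum>k<K. if y \<le> 2 ^ k then y ^ 2 / 2 ^ k else 0) \<le> 2 * y"
  if "0 \<le> y" for y :: real
proof -
  \<comment> \<open>The geometric remainder is subtracted on the right; the plain bound 2 would not
    pass through the induction.\<close>
  have *: "(\<Sum>k<K. if y \<le> 2 ^ k then y / 2 ^ k else 0) \<le> (if y \<le> 2 ^ K then 2 - 2 * y / 2 ^ K else 0)"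
  proof (induction K)
    case 0
    then show ?case by simp
  next
    case (Suc K)
    show ?case
    proof (cases "y \<le> 2 ^ K")
      case True
      then have "y \<le> 2 ^ Suc K" by (simp add: order_trans[OF True])
      moreover have "2 * y / 2 ^ Suc K = y / 2 ^ K" by simp
      ultimately show ?thesis using Suc True by simp
    next
      case False
      then have "(\<Sum>k<Suc K. if y \<le> 2 ^ k then y / 2 ^ k else 0) \<le> 0" using Suc by simp
      moreover have "2 * y / 2 ^ Suc K \<le> 2" if "y \<le> 2 ^ Suc K"
        using that by (simp add: divide_le_eq)
      ultimately show ?thesis by auto
    qed
  qed
  also have "\<dots> \<le> 2" using that by auto
  finally have "y * (\<Sum>k<K. if y \<le> 2 ^ k then y / 2 ^ k else 0) \<le> y * 2"
    using that by (rule mult_left_mono)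
  moreover have "y * (\<Sum>k<K. if y \<le> 2 ^ k then y / 2 ^ k else 0) = (\<Sum>k<K. if y \<le> 2 ^ k then y ^ 2 / 2 ^ k else 0)"
    unfolding sum_distrib_left by (intro sum.cong refl) (auto simp: power2_eq_square)
  ultimately show ?thesis by (simp add: mult.commute)
qed

abbreviation samples :: "'a measure \<Rightarrow> (nat \<Rightarrow> 'a) measure" where
  "samples \<mu> \<equiv> \<Pi>\<^sub>M i\<in>(UNIV :: nat set). \<mu>"

locale iid_samples = prob_space N for N :: "'a measure"
begin

abbreviation P :: "(nat \<Rightarrow> 'a) measure" where "P \<equiv> samples N"

sublocale P: prob_space P
  by (rule prob_space_PiM) (rule prob_space_axioms)

lemma measurable_sample [measurable]: "(\<lambda>x. x i) \<in> measurable P N"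
  by (rule measurable_component_singleton) simp

lemma distr_sample: "distr P N (\<lambda>x. x i) = N"
  using distr_PiM_component[of UNIV "\<lambda>_. N" i] prob_space_axioms by simp

lemma sample_in_space: "x \<in> space P \<Longrightarrow> x i \<in> space N"
  by (auto simp: space_PiM)

lemma indep_samples: "P.indep_vars (\<lambda>_. N) (\<lambda>i x. x i) UNIV"
proof -
  have "distr P P (\<lambda>x. \<lambda>i\<in>UNIV. x i) = distr P P (\<lambda>x. x)"
    by (simp add: restrict_UNIV)
  also have "\<dots> = (\<Pi>\<^sub>M i\<in>UNIV. distr P N (\<lambda>x. x i))"
    by (simp add: distr_sample distr_id)
  finally show ?thesis
    by (subst P.indep_vars_iff_distr_eq_PiM') simp_all
qed

lemma indep_sample_functions:
  "f \<in> measurable N K \<Longrightarrow> P.indep_vars (\<lambda>_. K) (\<lambda>i x. f (x i)) UNIV"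
  using P.indep_vars_compose2[OF indep_samples, of "\<lambda>_. f" "\<lambda>_. K"] by simp

lemma integral_sample:
  fixes f :: "'a \<Rightarrow> real"
  assumes [measurable]: "f \<in> borel_measurable N"
  shows "(\<integral>x. f (x i) \<partial>P) = (\<integral>y. f y \<partial>N)"
  using integral_distr[of "\<lambda>x. x i" P N f] by (simp add: distr_sample)

lemma integrable_sample:
  fixes f :: "'a \<Rightarrow> real"
  assumes "integrable N f"
  shows "integrable P (\<lambda>x. f (x i))"
  using integrable_distr[of "\<lambda>x. x i" P N f] assms by (simp add: distr_sample)

lemma emeasure_sample:
  assumes [measurable]: "A \<in> sets N"
  shows "emeasure P {x \<in> space P. x i \<in> A} = emeasure N A"
proof -
  have "emeasure (distr P N (\<lambda>x. x i)) A = emeasure P ((\<lambda>x. x i) -` A \<inter> space P)"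
    by (rule emeasure_distr) auto
  moreover have "(\<lambda>x. x i) -` A \<inter> space P = {x \<in> space P. x i \<in> A}" by auto
  ultimately show ?thesis by (simp add: distr_sample)
qed

text \<open>Centred samples are orthogonal, and the variance is at most the raw second moment.
  \<open>B\<close> secures integrability without entering the estimate, so truncation levels may
  grow with the number of samples.\<close>

lemma second_moment_sum:
  fixes f :: "'a \<Rightarrow> real"
  assumes [measurable]: "f \<in> borel_measurable N" and B: "\<And>y. y \<in> space N \<Longrightarrow> \<bar>f y\<bar> \<le> B"
  shows "integrable P (\<lambda>x. ((\<Sum>i<n. f (x i)) - real n * (\<integral>y. f y \<partial>N)) ^ 2)"
    and "(\<integral>x. ((\<Sum>i<n. f (x i)) - real n * (\<integral>y. f y \<partial>N)) ^ 2 \<partial>P) \<le> real n * (\<integral>y. f y ^ 2 \<partial>N)"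
proof -
  define m where "m = (\<integral>y. f y \<partial>N)"
  define g where "g = (\<lambda>y. f y - m)"
  have [measurable]: "g \<in> borel_measurable N" unfolding g_def by measurable
  have fi: "integrable N f" by (rule integrable_const_bound[of _ B]) (use B in auto)
  have f2i: "integrable N (\<lambda>y. f y ^ 2)"
  proof (rule integrable_const_bound[of _ "B ^ 2"])
    show "AE y in N. norm (f y ^ 2) \<le> B ^ 2"
      using B by (intro AE_I2) (simp add: abs_le_square_iff[symmetric] order_trans[OF B])
  qed simp
  have gi: "integrable N g" using fi by (simp add: g_def)
  have g2i: "integrable N (\<lambda>y. g y * g y)"
  proof -
    have "(\<lambda>y. g y * g y) = (\<lambda>y. f y ^ 2 - 2 * m * f y + m ^ 2)"
      by (auto simp: g_def power2_eq_square algebra_simps)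
    then show ?thesis using fi f2i by simp
  qed
  have g0: "(\<integral>y. g y \<partial>N) = 0" using fi by (simp add: g_def m_def prob_space)
  have g2: "(\<integral>y. g y * g y \<partial>N) \<le> (\<integral>y. f y ^ 2 \<partial>N)"
  proof -
    have "(\<integral>y. g y * g y \<partial>N) = (\<integral>y. f y ^ 2 - 2 * m * f y + m ^ 2 \<partial>N)"
      by (auto simp: g_def power2_eq_square algebra_simps)
    also have "\<dots> = (\<integral>y. f y ^ 2 \<partial>N) - 2 * m * m + m ^ 2"
      using fi f2i by (simp add: m_def prob_space)
    also have "\<dots> \<le> (\<integral>y. f y ^ 2 \<partial>N)" by (simp add: power2_eq_square)
    finally show ?thesis .
  qed
  have prod: "integrable P (\<lambda>x. g (x i) * g (x j))
      \<and> (\<integral>x. g (x i) * g (x j) \<partial>P) = (if i = j then (\<integral>y. g y * g y \<partial>N) else 0)" for i j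
  proof (cases "i = j")
    case True
    then show ?thesis
      using integrable_sample[OF g2i, of j] integral_sample[of "\<lambda>y. g y * g y" j] by simp
  next
    case False
    have ind: "P.indep_vars (\<lambda>_. borel) (\<lambda>i x. g (x i)) {i, j}"
      by (rule P.indep_vars_subset[OF indep_sample_functions]) auto
    have "integrable P (\<lambda>x. \<Prod>k\<in>{i, j}. g (x k))"
      by (rule P.indep_vars_integrable[OF _ ind]) (auto intro: integrable_sample gi)
    moreover have "(\<integral>x. (\<Prod>k\<in>{i, j}. g (x k)) \<partial>P) = (\<Prod>k\<in>{i, j}. \<integral>x. g (x k) \<partial>P)"
      by (rule P.indep_vars_lebesgue_integral[OF _ ind]) (auto intro: integrable_sample gi)
    ultimately show ?thesis using False by (simp add: integral_sample g0)
  qed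
  have sq: "((\<Sum>i<n. f (x i)) - real n * m) ^ 2 = (\<Sum>i<n. \<Sum>j<n. g (x i) * g (x j))" for x
  proof -
    have "(\<Sum>i<n. f (x i)) - real n * m = (\<Sum>i<n. g (x i))" by (simp add: g_def sum_subtractf)
    then show ?thesis by (simp add: power2_eq_square sum_product)
  qed
  show "integrable P (\<lambda>x. ((\<Sum>i<n. f (x i)) - real n * (\<integral>y. f y \<partial>N)) ^ 2)"
    unfolding m_def[symmetric] sq using prod by (intro Bochner_Integration.integrable_sum) auto
  have "(\<integral>x. ((\<Sum>i<n. f (x i)) - real n * (\<integral>y. f y \<partial>N)) ^ 2 \<partial>P)
      = (\<Sum>i<n. \<Sum>j<n. (\<integral>x. g (x i) * g (x j) \<partial>P))"
    unfolding m_def[symmetric] sq using prod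
    by (subst Bochner_Integration.integral_sum)
       (auto intro!: Bochner_Integration.integrable_sum sum.cong Bochner_Integration.integral_sum)
  also have "\<dots> = real n * (\<integral>y. g y * g y \<partial>N)" using prod by simp
  also have "\<dots> \<le> real n * (\<integral>y. f y ^ 2 \<partial>N)" using g2 by (simp add: mult_left_mono)
  finally show "(\<integral>x. ((\<Sum>i<n. f (x i)) - real n * (\<integral>y. f y \<partial>N)) ^ 2 \<partial>P) \<le> real n * (\<integral>y. f y ^ 2 \<partial>N)" .
qed

text \<open>Hoeffding's inequality bounds the exceptional probabilities by a geometric sequence, so
  Borel-Cantelli applies along all \<open>n\<close> at once.\<close>

lemma frequency_eventually_close:
  assumes A [measurable]: "A \<in> sets N" and \<epsilon>: "0 < \<epsilon>"
  shows "AE x in P. \<forall>\<^sub>F n in sequentially. \<bar>(\<Sum>i<n. indicator A (x i)) / real n - measure N A\<bar> < \<epsilon>"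
proof -
  define E where "E n = {x \<in> space P. \<epsilon> \<le> \<bar>(\<Sum>i<n. indicator A (x i)) / real n - measure N A\<bar>}" for n
  have "P.prob (E n) \<le> 2 * exp (- 2 * \<epsilon>\<^sup>2) ^ n" if "0 < n" for n
  proof -
    interpret H: Hoeffding_ineq_iid P "{..<n}" "\<lambda>i x. indicator A (x i)" "\<lambda>x. indicator A (x 0)" 0 1
        "P.expectation (\<lambda>x. indicator A (x 0))"
    proof unfold_locales
      show "P.indep_vars (\<lambda>_. borel) (\<lambda>i x. indicator A (x i) :: real) {..<n}"
        by (rule P.indep_vars_subset[OF indep_sample_functions]) auto
      fix i
      have "distr P borel (\<lambda>x. indicator A (x i) :: real) = distr (distr P N (\<lambda>x. x i)) borel (indicator A)" for i
        by (subst distr_distr) (auto simp: o_def)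
      then show "distr P borel (\<lambda>x. indicator A (x i) :: real) = distr P borel (\<lambda>x. indicator A (x 0))"
        by (simp only: distr_sample)
    qed (auto simp: indicator_def)
    have m: "P.expectation (\<lambda>x. indicator A (x 0)) = measure N A"
      by (subst integral_sample) auto
    have eq: "E n = {x \<in> space P. \<epsilon> \<le> \<bar>(\<Sum>i<n. indicator A (x i)) / real (card {..<n})
        - P.expectation (\<lambda>x. indicator A (x 0))\<bar>}"
      by (simp add: E_def m)
    have "P.prob (E n) \<le> 2 * exp (- 2 * real (card {..<n}) * \<epsilon>\<^sup>2 / (1 - 0)\<^sup>2)"
      unfolding eq by (rule H.Hoeffding_ineq_abs_ge') (use \<epsilon> that in auto)
    also have "- 2 * real (card {..<n}) * \<epsilon>\<^sup>2 / (1 - 0)\<^sup>2 = real n * (- 2 * \<epsilon>\<^sup>2)" by simp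
    also have "exp (real n * (- 2 * \<epsilon>\<^sup>2)) = exp (- 2 * \<epsilon>\<^sup>2) ^ n"
      by (rule exp_of_nat_mult)
    finally show ?thesis .
  qed
  then have "summable (\<lambda>n. P.prob (E n))"
    using \<epsilon> by (intro summable_comparison_test_ev[OF _ summable_mult[OF summable_geometric, of "exp (- 2 * \<epsilon>\<^sup>2)" 2]])
      (auto intro!: eventually_sequentiallyI[of 1])
  then have "AE x in P. \<forall>\<^sub>F n in sequentially. x \<in> space P - E n"
    by (intro borel_cantelli_AE1) (auto simp: E_def P.emeasure_eq_measure)
  then show ?thesis
    by (rule AE_mp) (auto simp: E_def not_le elim: eventually_mono)
qed

text \<open>
  The part of the strong law of large numbers that the moments need. Along \<open>n = 2 ^ k\<close>, truncation
  at \<open>2 ^ k\<close> changes a sample with summable probability, and the truncated sums have summable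
  Chebyshev bounds; filling in the other \<open>n\<close> by monotonicity costs the factor 2.
\<close>

lemma sample_sum_eventually_le:
  fixes f :: "'a \<Rightarrow> real"
  assumes f [measurable]: "f \<in> borel_measurable N" and f0: "\<And>y. y \<in> space N \<Longrightarrow> 0 \<le> f y"
    and \<eta>: "(\<integral>\<^sup>+ y. ennreal (f y) \<partial>N) < ennreal \<eta>"
  shows "AE x in P. \<forall>\<^sub>F n in sequentially. (\<Sum>i<n. f (x i)) \<le> 2 * \<eta> * real n"
proof -
  define m where "m = (\<integral>y. f y \<partial>N)"
  have fi: "integrable N f"
    using f0 \<eta> by (intro integrableI_nonneg) (auto intro: order.strict_trans simp: less_top)
  have nn: "(\<integral>\<^sup>+ y. ennreal (f y) \<partial>N) = ennreal m"
    unfolding m_def using f0 fi by (intro nn_integral_eq_integral) auto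
  have m0: "0 \<le> m" unfolding m_def using f0 by (intro integral_nonneg_AE) auto
  have m\<eta>: "m < \<eta>" using \<eta> m0 unfolding nn by (simp add: ennreal_less_iff)
  define \<delta> where "\<delta> = \<eta> - m"
  have \<delta>: "0 < \<delta>" using m\<eta> by (simp add: \<delta>_def)
  define t where "t k y = (if f y \<le> 2 ^ k then f y else 0)" for k :: nat and y
  have [measurable]: "t k \<in> borel_measurable N" for k unfolding t_def by measurable
  have tb: "\<bar>t k y\<bar> \<le> 2 ^ k" if "y \<in> space N" for k y using f0[OF that] by (simp add: t_def)
  have ti: "integrable N (t k)" for k
    by (rule integrable_const_bound[of _ "2 ^ k"]) (use tb in auto)
  have t2b: "norm (t k y ^ 2) \<le> (2 ^ k) ^ 2" if "y \<in> space N" for k y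
    using tb[OF that, of k] by (simp add: abs_le_square_iff[symmetric])
  have t2i: "integrable N (\<lambda>y. t k y ^ 2)" for k
    by (rule integrable_const_bound[of _ "(2 ^ k) ^ 2"]) (use t2b in auto)
  have tm: "(\<integral>y. t k y \<partial>N) \<le> m" for k
    unfolding m_def by (rule integral_mono[OF ti fi]) (auto simp: t_def f0)
  define A where "A k = {x \<in> space P. 2 ^ k * \<eta> < (\<Sum>i<2 ^ k. f (x i))}" for k
  have [measurable]: "A k \<in> sets P" for k unfolding A_def by measurable
  define u where "u k = 2 ^ k * measure N {y \<in> space N. 2 ^ k < f y}" for k :: nat
  define v where "v k = (\<integral>y. t k y ^ 2 / 2 ^ k \<partial>N)" for k
  have PA: "P.prob (A k) \<le> u k + v k / \<delta>\<^sup>2" for k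
  proof -
    define n where "n = (2 :: nat) ^ k"
    have n: "real n = 2 ^ k" "0 < n" by (simp_all add: n_def)
    \<comment> \<open>A large sum has one of two causes: truncation changed some sample
      (\<open>E\<close>), or the truncated sum exceeds its mean by \<open>n * \<delta>\<close>
      (\<open>F\<close>). Indeed that mean is at most \<open>n * m\<close>, and
      \<open>\<eta> = m + \<delta>\<close>.\<close>
    define E where "E = (\<Union>i<n. {x \<in> space P. x i \<in> {y \<in> space N. 2 ^ k < f y}})"
    define F where "F = {x \<in> space P. real n * \<delta> \<le> \<bar>(\<Sum>i<n. t k (x i)) - real n * (\<integral>y. t k y \<partial>N)\<bar>}"
    have [measurable]: "E \<in> sets P" "F \<in> sets P" unfolding E_def F_def by measurable
    have "A k \<subseteq> E \<union> F"
    proof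
      fix x assume x: "x \<in> A k"
      then have xP: "x \<in> space P" by (simp add: A_def)
      show "x \<in> E \<union> F"
      proof (cases "x \<in> E")
        case False
        then have "t k (x i) = f (x i)" if "i < n" for i
          using that xP sample_in_space[OF xP] by (auto simp: E_def t_def not_less)
        then have "real n * \<eta> < (\<Sum>i<n. t k (x i))"
          using x by (simp add: A_def n_def)
        moreover have "real n * (\<integral>y. t k y \<partial>N) \<le> real n * m"
          using tm by (intro mult_left_mono) auto
        ultimately have "real n * \<delta> \<le> (\<Sum>i<n. t k (x i)) - real n * (\<integral>y. t k y \<partial>N)"
          by (simp add: \<delta>_def right_diff_distrib)
        then have "x \<in> F" using xP by (simp add: F_def)
        then show ?thesis by simp
      qed simp
    qed
    then have "P.prob (A k) \<le> P.prob (E \<union> F)" by (intro P.finite_measure_mono) auto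
    also have "\<dots> \<le> P.prob E + P.prob F" by (rule measure_Un_le) auto
    also have "P.prob E \<le> u k"
    proof -
      have "P.prob E \<le> (\<Sum>i<n. P.prob {x \<in> space P. x i \<in> {y \<in> space N. 2 ^ k < f y}})"
        unfolding E_def by (intro P.finite_measure_subadditive_finite) auto
      also have "\<dots> = (\<Sum>i<n. measure N {y \<in> space N. 2 ^ k < f y})"
        by (simp only: measure_def) (subst emeasure_sample, auto)
      also have "\<dots> = u k" by (simp add: u_def n_def)
      finally show ?thesis .
    qed
    also have "P.prob F \<le> v k / \<delta>\<^sup>2"
    proof -
      let ?S = "\<lambda>x. ((\<Sum>i<n. t k (x i)) - real n * (\<integral>y. t k y \<partial>N)) ^ 2"
      have "F = {x \<in> space P. (real n * \<delta>) ^ 2 \<le> ?S x}"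
        unfolding F_def using n \<delta> by (auto simp: abs_le_square_iff[symmetric] abs_mult)
      also have "P.prob \<dots> \<le> (\<integral>x. ?S x \<partial>P) / (real n * \<delta>) ^ 2"
        using second_moment_sum(1)[of "t k" "2 ^ k" n] tb n \<delta>
        by (intro integral_Markov_inequality_measure[where A = "space P"]) auto
      also have "\<dots> \<le> real n * (\<integral>y. t k y ^ 2 \<partial>N) / (real n * \<delta>) ^ 2"
        using second_moment_sum(2)[of "t k" "2 ^ k" n] tb by (intro divide_right_mono) auto
      also have "\<dots> = v k / \<delta>\<^sup>2" using n by (simp add: v_def power_mult_distrib power2_eq_square)
      finally show ?thesis .
    qed
    finally show ?thesis by simp
  qed
  have ind: "integrable N (indicat_real {y \<in> space N. 2 ^ k < f y})" for k :: nat
    by (rule integrable_const_bound[of _ 1]) auto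
  have su: "summable u"
  proof (rule summableI_nonneg_bounded)
    show "0 \<le> u k" for k by (simp add: u_def)
    fix K
    have "(\<Sum>k<K. u k) = (\<integral>y. (\<Sum>k<K. 2 ^ k * indicator {y \<in> space N. 2 ^ k < f y} y) \<partial>N)"
      using ind by (subst Bochner_Integration.integral_sum) (auto simp: u_def)
    also have "\<dots> \<le> (\<integral>y. 2 * f y \<partial>N)"
    proof (rule integral_mono)
      fix y assume y: "y \<in> space N"
      have "(\<Sum>k<K. 2 ^ k * indicator {y \<in> space N. 2 ^ k < f y} y) = (\<Sum>k<K. if 2 ^ k < f y then 2 ^ k else 0 :: real)"
        using y by (intro sum.cong) auto
      then show "(\<Sum>k<K. 2 ^ k * indicator {y \<in> space N. 2 ^ k < f y} y) \<le> 2 * f y"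
        using sum_pow2_below[OF f0[OF y], of K] by simp
    qed (intro Bochner_Integration.integrable_sum integrable_mult_right ind fi)+
    finally show "(\<Sum>k<K. u k) \<le> 2 * m" using fi by (simp add: m_def)
  qed
  have sv: "summable v"
  proof (rule summableI_nonneg_bounded)
    show "0 \<le> v k" for k by (simp add: v_def)
    fix K
    have "(\<Sum>k<K. v k) = (\<integral>y. (\<Sum>k<K. t k y ^ 2 / 2 ^ k) \<partial>N)"
      using t2i by (subst Bochner_Integration.integral_sum) (auto simp: v_def)
    also have "\<dots> \<le> (\<integral>y. 2 * f y \<partial>N)"
    proof (rule integral_mono)
      fix y assume y: "y \<in> space N"
      have "(\<Sum>k<K. t k y ^ 2 / 2 ^ k) = (\<Sum>k<K. if f y \<le> 2 ^ k then f y ^ 2 / 2 ^ k else 0)"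
        by (intro sum.cong) (auto simp: t_def)
      then show "(\<Sum>k<K. t k y ^ 2 / 2 ^ k) \<le> 2 * f y"
        using sum_inverse_pow2_above[OF f0[OF y], of K] by simp
    qed (use fi t2i in \<open>auto intro!: Bochner_Integration.integrable_sum\<close>)
    finally show "(\<Sum>k<K. v k) \<le> 2 * m" using fi by (simp add: m_def)
  qed
  have "summable (\<lambda>k. P.prob (A k))"
    by (rule summable_comparison_test'[OF summable_add[OF su summable_divide[OF sv, of "\<delta>\<^sup>2"]]])
       (use PA in auto)
  then have "AE x in P. \<forall>\<^sub>F k in sequentially. x \<in> space P - A k"
    by (intro borel_cantelli_AE1) (auto simp: P.emeasure_eq_measure)
  then show ?thesis
  proof (rule AE_mp, intro AE_I2 impI)
    fix x assume x: "x \<in> space P" and "\<forall>\<^sub>F k in sequentially. x \<in> space P - A k"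
    then obtain K where K: "\<And>k. K \<le> k \<Longrightarrow> (\<Sum>i<2 ^ k. f (x i)) \<le> 2 ^ k * \<eta>"
      by (auto simp: eventually_sequentially A_def not_less)
    have "(\<Sum>i<n. f (x i)) \<le> 2 * \<eta> * real n" if n: "2 ^ K \<le> n" for n
    proof -
      have "1 \<le> n" using n by (metis one_le_numeral one_le_power order_trans)
      then obtain k where k: "2 ^ k \<le> n" "n < 2 ^ (k + 1)"
        using ex_power_ivl1[of 2 n] by auto
      have "(2 :: nat) ^ K < 2 ^ (k + 1)" using n k by simp
      then have "K < k + 1" by (rule power_less_imp_less_exp[rotated]) simp
      then have "K \<le> k + 1" by simp
      have "(\<Sum>i<n. f (x i)) \<le> (\<Sum>i<2 ^ (k + 1). f (x i))"
        using k f0 sample_in_space[OF x] by (intro sum_mono2) auto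
      also have "\<dots> \<le> 2 ^ (k + 1) * \<eta>" by (rule K) fact
      also have "\<dots> = 2 * \<eta> * 2 ^ k" by simp
      also have "\<dots> \<le> 2 * \<eta> * real n"
        using k(1) m0 m\<eta> by (intro mult_left_mono) (auto simp flip: of_nat_power of_nat_le_iff)
      finally show ?thesis .
    qed
    then show "\<forall>\<^sub>F n in sequentially. (\<Sum>i<n. f (x i)) \<le> 2 * \<eta> * real n"
      by (rule eventually_sequentiallyI)
  qed
qed

end

section \<open>Empirical measures and consistency\<close>

context iid_samples
begin

text \<open>\<open>measure_of\<close> falls back to zero when the given set function is not a
  measure. Recognising it as the image of the uniform distribution on the indices excludes this and
  provides the integrals.\<close>

lemma empirical_measure_eq_distr:
  assumes n: "0 < n" and x: "\<And>i. x i \<in> space N"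
  shows "empirical_measure N n x = distr (uniform_count_measure {..<n}) N x"
proof -
  let ?U = "uniform_count_measure {..<n}"
  have m: "x \<in> measurable ?U N"
    using x by (auto simp: measurable_def space_uniform_count_measure sets_uniform_count_measure)
  have em: "ennreal (1 / real n) * (\<Sum>i<n. emeasure (return N (x i)) S) = emeasure (distr ?U N x) S"
    if S: "S \<in> sets N" for S
  proof -
    have "emeasure (distr ?U N x) S = (\<integral>\<^sup>+ i. indicator S (x i) \<partial>?U)"
      using nn_integral_distr[OF m, of "indicator S"] S by simp
    also have "\<dots> = (\<Sum>i<n. ennreal (1 / real n) * indicator S (x i))"
      unfolding uniform_count_measure_def by (subst nn_integral_point_measure_finite) auto
    finally show ?thesis using S by (simp add: sum_distrib_left)
  qed
  have "empirical_measure N n x = measure_of (space N) (sets N) (emeasure (distr ?U N x))"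
    unfolding empirical_measure_def
    by (rule measure_of_eq[OF sets.space_closed]) (simp only: em sets.sigma_sets_eq)
  also have "\<dots> = distr ?U N x"
    using measure_of_of_measure[of "distr ?U N x"] by simp
  finally show ?thesis .
qed

lemma sets_empirical_measure: "sets (empirical_measure N n x) = sets N"
  and space_empirical_measure: "space (empirical_measure N n x) = space N"
  unfolding empirical_measure_def
  by (simp_all add: sets.space_closed sets_measure_of sets.sigma_sets_eq space_measure_of)

context
  fixes n :: nat and x :: "nat \<Rightarrow> 'a"
  assumes n: "0 < n" and x: "x \<in> space P"
begin

lemma measurable_sample_points: "x \<in> measurable (uniform_count_measure {..<n}) N"
  using sample_in_space[OF x]
  by (auto simp: measurable_def space_uniform_count_measure sets_uniform_count_measure)

lemma prob_space_empirical_measure: "prob_space (empirical_measure N n x)"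
  unfolding empirical_measure_eq_distr[OF n sample_in_space[OF x]]
  using n by (intro prob_space.prob_space_distr[OF prob_space_uniform_count_measure measurable_sample_points])
    (auto simp: lessThan_empty_iff)

lemma nn_integral_empirical_measure:
  assumes "f \<in> borel_measurable N"
  shows "(\<integral>\<^sup>+ y. f y \<partial>empirical_measure N n x) = ennreal (1 / real n) * (\<Sum>i<n. f (x i))"
proof -
  have "(\<integral>\<^sup>+ y. f y \<partial>empirical_measure N n x) = (\<integral>\<^sup>+ i. f (x i) \<partial>uniform_count_measure {..<n})"
    unfolding empirical_measure_eq_distr[OF n sample_in_space[OF x]]
    using assms by (subst nn_integral_distr[OF measurable_sample_points]) auto
  also have "\<dots> = (\<Sum>i<n. ennreal (1 / real n) * f (x i))"
    unfolding uniform_count_measure_def by (subst nn_integral_point_measure_finite) auto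
  finally show ?thesis by (simp add: sum_distrib_left)
qed

lemma measure_empirical_measure:
  assumes "A \<in> sets N"
  shows "measure (empirical_measure N n x) A = (\<Sum>i<n. indicator A (x i)) / real n"
proof -
  have "emeasure (empirical_measure N n x) A = (\<integral>\<^sup>+ y. indicator A y \<partial>empirical_measure N n x)"
    using assms by (simp add: sets_empirical_measure)
  also have "\<dots> = ennreal (1 / real n) * (\<Sum>i<n. indicator A (x i))"
    using assms by (subst nn_integral_empirical_measure) auto
  also have "(\<Sum>i<n. indicator A (x i) :: ennreal) = ennreal (\<Sum>i<n. indicator A (x i))"
    by (simp add: ennreal_indicator flip: sum_ennreal)
  also have "ennreal (1 / real n) * \<dots> = ennreal ((\<Sum>i<n. indicator A (x i)) / real n)"
    by (simp add: sum_nonneg flip: ennreal_mult)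
  finally show ?thesis by (simp add: measure_def sum_nonneg)
qed

end

end

section \<open>Consistency from one partition and a small tail\<close>

context bmt_setting
begin

lemma iid_samples_moments: "\<mu> \<in> moments \<Longrightarrow> iid_samples \<mu>"
  unfolding iid_samples_def by (rule moments_prob)

lemma empirical_measure_moments:
  assumes \<mu>: "\<mu> \<in> moments" and n: "0 < n" and x: "x \<in> space (samples \<mu>)"
  shows "empirical_measure \<mu> n x \<in> moments"
proof -
  interpret iid_samples \<mu> using \<mu> by (rule iid_samples_moments)
  have x0: "x 0 \<in> M" using sample_in_space[OF x] moments_space[OF \<mu>] by simp
  have "(\<lambda>y. ennreal (d (x 0) y powr p)) \<in> borel_measurable \<mu>"
    using borel_measurable_dist[OF \<mu> x0] by measurable
  then have "(\<integral>\<^sup>+ y. ennreal (d (x 0) y powr p) \<partial>empirical_measure \<mu> n x) < \<infinity>"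
    by (subst nn_integral_empirical_measure[OF n x])
       (simp_all add: sum_ennreal ennreal_mult_less_top)
  then show ?thesis
    using prob_space_empirical_measure[OF n x] x0
    by (auto simp: borel_prob_moment_def space_empirical_measure sets_empirical_measure
        moments_space[OF \<mu>] moments_sets[OF \<mu>])
qed

text \<open>Comparing with the maximum costs the factor \<open>2 powr p\<close>. In return
  \<open>x\<close> and \<open>y\<close> are separated, as the functions of one coordinate in
  \<open>nested_coupling\<close> require.\<close>

lemma dist_powr_le:
  assumes "x \<in> M" "y \<in> M" "z \<in> M"
  shows "d x y powr p \<le> 2 powr p * d z x powr p + 2 powr p * d z y powr p"
proof -
  have "d x y \<le> 2 * max (d z x) (d z y)"
    using triangle[of x z y] commute[of x z] assms by (simp add: max_def)
  then have "d x y powr p \<le> (2 * max (d z x) (d z y)) powr p"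
    using p_ge_1 by (intro powr_mono2) auto
  also have "\<dots> = 2 powr p * max (d z x) (d z y) powr p" by (simp add: powr_mult le_max_iff_disj)
  also have "\<dots> \<le> 2 powr p * (d z x powr p + d z y powr p)"
    by (intro mult_left_mono) (auto simp: max_def)
  finally show ?thesis by (simp add: distrib_left)
qed

definition BMT_dist :: "'a measure \<Rightarrow> nat \<Rightarrow> (nat \<Rightarrow> 'a) \<Rightarrow> ennreal" where
  "BMT_dist \<mu> n x = KS_distance p (functional_BMT p \<theta> M d \<mu>)
     (functional_BMT p \<theta> M d (empirical_measure \<mu> n x))"

lemma BMT_dist_le_nested:
  fixes g :: "nat \<Rightarrow> 'i \<Rightarrow> 'k" and D :: "nat \<Rightarrow> real"
  assumes \<mu>: "\<mu> \<in> moments" and n: "0 < n" and x: "x \<in> space (samples \<mu>)" and B: "0 < B"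
    and fin: "finite I" and \<iota>: "\<iota> \<in> M \<rightarrow> I" and m: "\<iota> \<in> measurable \<mu> (count_space UNIV)"
    and nested: "\<And>j i i'. i \<in> I \<Longrightarrow> i' \<in> I \<Longrightarrow> g j i = g j i' \<Longrightarrow> g (Suc j) i = g (Suc j) i'"
    and top: "\<And>i i'. i \<in> I \<Longrightarrow> i' \<in> I \<Longrightarrow> g (Suc J) i = g (Suc J) i'"
    and D: "\<And>j. 0 \<le> D j"
    and \<phi>: "\<phi> \<in> borel_measurable \<mu>" and \<psi>: "\<psi> \<in> borel_measurable \<mu>"
    and cost: "\<And>y z j. y \<in> M \<Longrightarrow> z \<in> M \<Longrightarrow> j \<le> Suc J \<Longrightarrow> g j (\<iota> y) = g j (\<iota> z) \<Longrightarrow>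
      ennreal (d y z powr p) \<le> ennreal (D j) + (\<phi> y + \<psi> z)"
  defines "\<nu> \<equiv> empirical_measure \<mu> n x"
  assumes bound: "ennreal (D 0 + (\<Sum>j\<le>J. D (Suc j) * cell_deviation \<mu> \<nu> (g j ` I) (\<lambda>x. g j (\<iota> x))))
      + ((\<integral>\<^sup>+ y. \<phi> y \<partial>\<mu>) + (\<integral>\<^sup>+ y. \<psi> y \<partial>\<nu>)) \<le> ennreal (B powr p)"
  shows "BMT_dist \<mu> n x \<le> ennreal (L * (modulus + 2) * B)"
proof -
  interpret iid_samples \<mu> using \<mu> by (rule iid_samples_moments)
  have sp: "space \<mu> = M" by (rule moments_space[OF \<mu>])
  have \<nu>: "prob_space \<nu>" "sets \<nu> = sets \<mu>"
    unfolding \<nu>_def by (rule prob_space_empirical_measure[OF n x], rule sets_empirical_measure)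
  obtain h where h: "is_coupling \<mu> \<nu> h"
    and hb: "(\<integral>\<^sup>+ z. ennreal (d (fst z) (snd z) powr p) \<partial>h) \<le>
      ennreal (D 0 + (\<Sum>j\<le>J. D (Suc j) * cell_deviation \<mu> \<nu> (g j ` I) (\<lambda>x. g j (\<iota> x))))
      + ((\<integral>\<^sup>+ y. \<phi> y \<partial>\<mu>) + (\<integral>\<^sup>+ y. \<psi> y \<partial>\<nu>))"
    by (rule nested_coupling[OF prob_space_axioms \<nu>, of I \<iota> g J D \<phi> \<psi> "\<lambda>y z. ennreal (d y z powr p)",
          unfolded sp])
       (rule fin \<iota> m nested top D \<phi> \<psi> cost that; assumption)+
  show ?thesis
    unfolding BMT_dist_def using h order_trans[OF hb bound] unfolding \<nu>_def
    by (rule KS_distance_BMT_le[OF \<mu> empirical_measure_moments[OF \<mu> n x] B])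
qed

text \<open>With \<open>d x0 y powr p\<close> as density, \<open>\<mu>\<close> becomes a finite
  measure. Balls around a countable dense set exhaust \<open>M\<close>, so continuity from above
  applies to the complements of finite unions.\<close>

lemma exists_small_tail:
  assumes \<mu>: "\<mu> \<in> moments" and x0: "x0 \<in> M" and r: "0 < r" and \<eta>: "0 < \<eta>"
  obtains F where "finite F" "F \<subseteq> M"
    "(\<integral>\<^sup>+ y. ennreal (d x0 y powr p) * indicator (M - (\<Union>c\<in>F. mball c r)) y \<partial>\<mu>) < \<eta>"
proof -
  obtain C where C: "countable C" "C \<subseteq> M" "\<And>x r. x \<in> M \<Longrightarrow> r > 0 \<Longrightarrow> \<exists>c\<in>C. d x c < r"
    using separable_dense[OF separable] by blast
  have "C \<noteq> {}" using C(3)[OF x0 r] by auto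
  define c where "c = from_nat_into C"
  have range_c: "range c = C" unfolding c_def using \<open>C \<noteq> {}\<close> C(1) by (rule range_from_nat_into)
  have cM: "c i \<in> M" for i using range_c C(2) by auto
  define U where "U n = M - (\<Union>i<n. mball (c i) r)" for n
  have [measurable]: "mball z r \<in> sets \<mu>" for z using moments_sets[OF \<mu>] by auto
  have [measurable]: "M \<in> sets \<mu>" using moments_space[OF \<mu>] sets.top[of \<mu>] by simp
  have Um [measurable]: "U n \<in> sets \<mu>" for n unfolding U_def by measurable
  have [measurable]: "d x0 \<in> borel_measurable \<mu>" using borel_measurable_dist[OF \<mu> x0] .
  define \<rho> where "\<rho> = density \<mu> (\<lambda>y. ennreal (d x0 y powr p))"
  have em: "emeasure \<rho> A = (\<integral>\<^sup>+ y. ennreal (d x0 y powr p) * indicator A y \<partial>\<mu>)" if "A \<in> sets \<mu>" for A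
    unfolding \<rho>_def using that by (subst emeasure_density) auto
  have fin: "emeasure \<rho> A \<noteq> \<infinity>" for A
  proof -
    have "emeasure \<rho> A \<le> emeasure \<rho> (space \<rho>)" by (rule emeasure_space)
    also have "\<dots> = (\<integral>\<^sup>+ y. ennreal (d x0 y powr p) \<partial>\<mu>)"
      unfolding \<rho>_def by (subst emeasure_density) (auto intro!: nn_integral_cong)
    also have "\<dots> < \<infinity>" by (rule moment_finite[OF \<mu> x0])
    finally show ?thesis by simp
  qed
  have "(\<Inter>n. U n) = {}"
  proof -
    have "\<exists>i. z \<in> mball (c i) r" if zM: "z \<in> M" for z
    proof -
      obtain a where "a \<in> C" "d z a < r" using C(3)[OF zM r] by blast
      then obtain i where "c i = a" using range_c by (metis imageE)
      then show ?thesis using zM cM[of i] \<open>d z a < r\<close> by (auto simp: commute intro!: exI[of _ i])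
    qed
    then show ?thesis by (auto simp: U_def) (meson lessI lessThan_iff)
  qed
  moreover have "(\<lambda>n. emeasure \<rho> (U n)) \<longlonglongrightarrow> emeasure \<rho> (\<Inter>n. U n)"
    by (rule Lim_emeasure_decseq) (use fin in \<open>auto simp: \<rho>_def decseq_def U_def\<close>)
  ultimately have "(\<lambda>n. emeasure \<rho> (U n)) \<longlonglongrightarrow> 0" by simp
  then have "\<forall>\<^sub>F n in sequentially. emeasure \<rho> (U n) < \<eta>" using \<eta> by (rule order_tendstoD)
  then obtain n where "emeasure \<rho> (U n) < \<eta>" by (auto simp: eventually_sequentially)
  then have "(\<integral>\<^sup>+ y. ennreal (d x0 y powr p) * indicator (M - (\<Union>z\<in>c ` {..<n}. mball z r)) y \<partial>\<mu>) < \<eta>"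
    by (simp add: em U_def)
  then show thesis using that[of "c ` {..<n}"] cM by auto
qed

lemma BMT_dist_eventually_le:
  assumes \<mu>: "\<mu> \<in> moments" and e: "0 < e"
  shows "AE x in (samples \<mu>). \<forall>\<^sub>F n in sequentially. BMT_dist \<mu> n x \<le> ennreal e"
proof -
  interpret iid_samples \<mu> using \<mu> by (rule iid_samples_moments)
  have sp: "space \<mu> = M" by (rule moments_space[OF \<mu>])
  define B where "B = e / (L * (modulus + 2))"
  have mod: "0 < L * (modulus + 2)" using L_pos by (simp add: add_nonneg_pos)
  have B: "0 < B" "L * (modulus + 2) * B = e" using mod e by (auto simp: B_def)
  \<comment> \<open>A quarter of the budget \<open>B powr p\<close> for each of three errors: cell
    diameters, deviation of the cell frequencies, and tails.\<close>
  define b where "b = B powr p / 4"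
  have b: "0 < b" using B by (simp add: b_def)
  \<comment> \<open>Cells have diameter at most \<open>2 * r = B / 4\<close>; as
    \<open>p \<ge> 1\<close>, the \<open>p\<close>-th power is at most a quarter of
    \<open>B powr p\<close>.\<close>
  define r where "r = B / 8"
  have r: "0 < r" using B by (simp add: r_def)
  have rb: "(2 * r) powr p \<le> b"
  proof -
    have "(2 * r) powr p = B powr p * (1 / 4) powr p"
      using B by (simp add: r_def flip: powr_mult)
    also have "(1 / 4) powr p \<le> (1 / 4 :: real) powr 1" using p_ge_1 by (intro powr_mono') auto
    finally show ?thesis using B by (simp add: b_def)
  qed
  obtain x0 where x0: "x0 \<in> M" using not_empty sp by auto
  \<comment> \<open>Three shares: \<open>\<mu>\<close> contributes at most \<open>\<eta>\<close> and
    the empirical measure at most \<open>2 * \<eta>\<close>, each multiplied by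
    \<open>2 powr p\<close>.\<close>
  define \<eta> where "\<eta> = b / (3 * 2 powr p)"
  have \<eta>: "0 < \<eta>" using b by (simp add: \<eta>_def)
  obtain F where F: "finite F" "F \<subseteq> M"
    "(\<integral>\<^sup>+ y. ennreal (d x0 y powr p) * indicator (M - (\<Union>c\<in>F. mball c r)) y \<partial>\<mu>) < ennreal \<eta>"
    using exists_small_tail[OF \<mu> x0 r, of "ennreal \<eta>"] \<eta> by auto
  obtain c and N :: nat where c: "F = c ` {..<N}"
    using finite_imp_nat_seg_image_inj_on[OF F(1)] by (auto simp: lessThan_def)
  define U where "U = M - (\<Union>c\<in>F. mball c r)"
  have cM: "i < N \<Longrightarrow> c i \<in> M" for i using F(2) c by auto
  have [measurable]: "mball z r \<in> sets \<mu>" for z using moments_sets[OF \<mu>] by auto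
  have [measurable]: "M \<in> sets \<mu>" using sp sets.top[of \<mu>] by simp
  have [measurable]: "d x0 \<in> borel_measurable \<mu>" using borel_measurable_dist[OF \<mu> x0] .
  have [measurable]: "U \<in> sets \<mu>" unfolding U_def using F(1) by (intro sets.Diff sets.finite_UN) auto
  define f where "f y = d x0 y powr p * indicator U y" for y
  have f0: "0 \<le> f y" for y by (simp add: f_def)
  have [measurable]: "f \<in> borel_measurable \<mu>" unfolding f_def by measurable
  have f_int: "(\<integral>\<^sup>+ y. ennreal (f y) \<partial>\<mu>) < ennreal \<eta>"
    using F(3) by (simp add: f_def U_def ennreal_mult'' ennreal_indicator)
  define R where "R = (\<Sum>i<N. (d x0 (c i) + r) powr p)"
  have R0: "0 \<le> R" unfolding R_def by (intro sum_nonneg) auto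
  have fR: "d x0 y powr p \<le> R + f y" if y: "y \<in> M" for y
  proof (cases "y \<in> U")
    case False
    then obtain i where i: "i < N" "y \<in> mball (c i) r" using y c by (auto simp: U_def)
    have "d x0 y powr p \<le> (d x0 (c i) + r) powr p"
      using i triangle[OF x0 cM[OF i(1)] y] p_ge_1 by (intro powr_mono2) auto
    also have "\<dots> \<le> R" unfolding R_def using i by (intro member_le_sum) auto
    finally show ?thesis using f0[of y] by simp
  qed (use R0 in \<open>simp add: f_def\<close>)
  \<comment> \<open>The first ball that contains \<open>y\<close>, or \<open>N\<close> on the tail
    set \<open>U\<close>: this turns the cover into a partition.\<close>
  define \<iota> where "\<iota> y = (LEAST i. N \<le> i \<or> y \<in> mball (c i) r)" for y
  have \<iota>_le: "\<iota> y \<le> N" for y unfolding \<iota>_def by (rule Least_le) simp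
  have \<iota>_prop: "N \<le> \<iota> y \<or> y \<in> mball (c (\<iota> y)) r" for y
    unfolding \<iota>_def by (rule LeastI[of _ N]) simp
  have \<iota>_N: "y \<in> U" if "\<iota> y = N" "y \<in> M" for y
  proof -
    have "y \<notin> mball (c i) r" if "i < N" for i
      using not_less_Least[of i "\<lambda>i. N \<le> i \<or> y \<in> mball (c i) r"] \<open>\<iota> y = N\<close> that by (simp add: \<iota>_def)
    then show ?thesis using that c by (auto simp: U_def)
  qed
  have \<iota>_m [measurable]: "\<iota> \<in> measurable \<mu> (count_space UNIV)"
    unfolding \<iota>_def by measurable
  \<comment> \<open>Two levels: the cells, then the whole space. On the latter, \<open>R\<close>
    accounts for each point inside the balls and the tail function \<open>f\<close> for each point
    outside.\<close>
  define D where "D j = (case j of 0 \<Rightarrow> (2 * r) powr p | Suc _ \<Rightarrow> 2 powr p * (2 * R))" for j :: nat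
  have D0: "0 \<le> D j" for j using R0 by (auto simp: D_def split: nat.split)
  define g where "g j i = (case j of 0 \<Rightarrow> i | Suc _ \<Rightarrow> 0)" for j i :: nat
  define \<phi> where "\<phi> y = ennreal (2 powr p * f y)" for y
  have [measurable]: "\<phi> \<in> borel_measurable \<mu>" unfolding \<phi>_def by measurable
  have cost: "ennreal (d x y powr p) \<le> ennreal (D j) + (\<phi> x + \<phi> y)"
    if xy: "x \<in> M" "y \<in> M" and "j \<le> Suc 0" "g j (\<iota> x) = g j (\<iota> y)" for x y j
  proof -
    have "d x y powr p \<le> D j + (2 powr p * f x + 2 powr p * f y)"
    proof (cases j)
      case 0
      then have eq: "\<iota> x = \<iota> y" using that by (simp add: g_def)
      show ?thesis
      proof (cases "\<iota> x = N")
        case True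
        \<comment> \<open>The tail cell may be unbounded, so there the tail functions pay for the
          whole distance.\<close>
        then have "x \<in> U" "y \<in> U" using \<iota>_N xy eq by auto
        then show ?thesis using dist_powr_le[OF xy x0] D0[of j] by (simp add: f_def)
      next
        case False
        then have "x \<in> mball (c (\<iota> x)) r" "y \<in> mball (c (\<iota> x)) r"
          using \<iota>_prop[of x] \<iota>_prop[of y] \<iota>_le[of x] eq by auto
        then have "d x y \<le> 2 * r" using triangle[of x "c (\<iota> x)" y] xy by (auto simp: commute)
        then have "d x y powr p \<le> (2 * r) powr p" using p_ge_1 by (intro powr_mono2) auto
        then show ?thesis using 0 f0[of x] f0[of y] by (simp add: D_def add_increasing2)
      qed
    next
      case (Suc j')
      have "d x y powr p \<le> 2 powr p * (R + f x) + 2 powr p * (R + f y)"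
        using dist_powr_le[OF xy x0] fR[OF xy(1)] fR[OF xy(2)]
        by (elim order_trans) (intro add_mono mult_left_mono, auto)
      then show ?thesis using Suc by (simp add: D_def algebra_simps)
    qed
    then show ?thesis
      unfolding \<phi>_def using D0[of j] f0 by (simp add: ennreal_leI flip: ennreal_plus)
  qed
  \<comment> \<open>Makes \<open>N + 1\<close> frequency errors cost at most \<open>b\<close> at the
    coarse level; \<open>R + 1\<close> in place of \<open>R\<close> avoids a division by
    zero.\<close>
  define \<zeta> where "\<zeta> = b / (2 powr p * (2 * (R + 1)) * real (Suc N))"
  have \<zeta>: "0 < \<zeta>" using b R0 by (simp add: \<zeta>_def)
  let ?A = "\<lambda>k. {y \<in> space \<mu>. \<iota> y = k}"
  have "AE x in P. \<forall>\<^sub>F n in sequentially. \<bar>(\<Sum>i<n. indicator (?A k) (x i)) / real n - measure \<mu> (?A k)\<bar> < \<zeta>" for k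
    by (rule frequency_eventually_close[OF _ \<zeta>]) measurable
  then have "AE x in P. \<forall>k. \<forall>\<^sub>F n in sequentially. \<bar>(\<Sum>i<n. indicator (?A k) (x i)) / real n - measure \<mu> (?A k)\<bar> < \<zeta>"
    by (simp add: AE_all_countable)
  moreover have "AE x in P. \<forall>\<^sub>F n in sequentially. (\<Sum>i<n. f (x i)) \<le> 2 * \<eta> * real n"
    by (rule sample_sum_eventually_le[OF _ _ f_int]) (auto simp: f0)
  moreover have "AE x in P. x \<in> space P" by (rule AE_space)
  ultimately show ?thesis
  proof (eventually_elim)
    fix x assume freq: "\<forall>k. \<forall>\<^sub>F n in sequentially. \<bar>(\<Sum>i<n. indicator (?A k) (x i)) / real n - measure \<mu> (?A k)\<bar> < \<zeta>"
      and tail: "\<forall>\<^sub>F n in sequentially. (\<Sum>i<n. f (x i)) \<le> 2 * \<eta> * real n" and x: "x \<in> space P"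
    have "\<forall>\<^sub>F n in sequentially. \<forall>k\<in>{..N}. \<bar>(\<Sum>i<n. indicator (?A k) (x i)) / real n - measure \<mu> (?A k)\<bar> < \<zeta>"
      using freq by (intro eventually_ball_finite) auto
    then show "\<forall>\<^sub>F n in sequentially. BMT_dist \<mu> n x \<le> ennreal e"
      using tail eventually_gt_at_top[of 0]
    proof eventually_elim
      fix n assume close: "\<forall>k\<in>{..N}. \<bar>(\<Sum>i<n. indicator (?A k) (x i)) / real n - measure \<mu> (?A k)\<bar> < \<zeta>"
        and sum: "(\<Sum>i<n. f (x i)) \<le> 2 * \<eta> * real n" and n: "0 < n"
      define \<nu> where "\<nu> = empirical_measure \<mu> n x"
      have "(\<Sum>k\<le>N. \<bar>measure \<mu> (?A k) - measure \<nu> (?A k)\<bar>) \<le> (\<Sum>k\<le>N. \<zeta>)"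
      proof (rule sum_mono)
        fix k assume "k \<in> {..N}"
        moreover have "measure \<nu> (?A k) = (\<Sum>i<n. indicator (?A k) (x i)) / real n"
          unfolding \<nu>_def by (rule measure_empirical_measure[OF n x]) measurable
        ultimately show "\<bar>measure \<mu> (?A k) - measure \<nu> (?A k)\<bar> \<le> \<zeta>"
          using close by (simp add: abs_minus_commute less_imp_le)
      qed
      also have "\<dots> = real (Suc N) * \<zeta>" by simp
      finally have "D 1 * (\<Sum>k\<le>N. \<bar>measure \<mu> (?A k) - measure \<nu> (?A k)\<bar>) \<le> 2 powr p * (2 * R) * (real (Suc N) * \<zeta>)"
        unfolding D_def using R0 by (intro mult_mono) (auto intro!: sum_nonneg)
      also have "\<dots> \<le> 2 powr p * (2 * (R + 1)) * (real (Suc N) * \<zeta>)"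
        using \<zeta> by (intro mult_right_mono mult_left_mono) auto
      also have "\<dots> = b" using R0 by (simp add: \<zeta>_def)
      finally have main: "D 0 + (\<Sum>j\<le>0. D (Suc j) * cell_deviation \<mu> \<nu> (g j ` {..N}) (\<lambda>y. g j (\<iota> y))) \<le> 2 * b"
        using rb by (simp add: g_def D_def cell_deviation_def)
      have \<phi>_int: "(\<integral>\<^sup>+ y. \<phi> y \<partial>Q) = ennreal (2 powr p) * (\<integral>\<^sup>+ y. ennreal (f y) \<partial>Q)"
        if "sets Q = sets \<mu>" for Q
      proof -
        have [measurable]: "f \<in> borel_measurable Q" by (simp add: measurable_cong_sets[OF that refl])
        show ?thesis unfolding \<phi>_def using f0 by (simp add: ennreal_mult nn_integral_cmult)
      qed
      have "(\<integral>\<^sup>+ y. ennreal (f y) \<partial>\<nu>) = ennreal (1 / real n) * (\<Sum>i<n. ennreal (f (x i)))"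
        unfolding \<nu>_def by (rule nn_integral_empirical_measure[OF n x]) measurable
      also have "\<dots> = ennreal (1 / real n * (\<Sum>i<n. f (x i)))"
        using f0 by (simp add: sum_nonneg flip: ennreal_mult)
      also have "\<dots> \<le> ennreal (2 * \<eta>)"
        using sum n by (intro ennreal_leI) (simp add: field_simps)
      finally have "(\<integral>\<^sup>+ y. \<phi> y \<partial>\<mu>) + (\<integral>\<^sup>+ y. \<phi> y \<partial>\<nu>)
          \<le> ennreal (2 powr p) * ennreal \<eta> + ennreal (2 powr p) * ennreal (2 * \<eta>)"
        unfolding \<phi>_int[OF refl] \<phi>_int[OF sets_empirical_measure[of n x], folded \<nu>_def] using f_int
        by (intro add_mono mult_left_mono) auto
      also have "\<dots> = ennreal b"
        using b by (simp add: \<eta>_def flip: ennreal_mult ennreal_plus)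
      finally have "ennreal (D 0 + (\<Sum>j\<le>0. D (Suc j) * cell_deviation \<mu> \<nu> (g j ` {..N}) (\<lambda>y. g j (\<iota> y))))
          + ((\<integral>\<^sup>+ y. \<phi> y \<partial>\<mu>) + (\<integral>\<^sup>+ y. \<phi> y \<partial>\<nu>)) \<le> ennreal (2 * b) + ennreal b"
        by (intro add_mono ennreal_leI main)
      also have "\<dots> \<le> ennreal (B powr p)"
        using b by (simp add: b_def ennreal_leI flip: ennreal_plus)
      finally have "BMT_dist \<mu> n x \<le> ennreal (L * (modulus + 2) * B)"
        unfolding \<nu>_def using \<iota>_le D0 cost
        by (intro BMT_dist_le_nested[OF \<mu> n x B(1), of "{..N}" \<iota> g 0 D \<phi> \<phi>]) (auto simp: g_def)
      then show "BMT_dist \<mu> n x \<le> ennreal e" using B(2) by simp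
    qed
  qed
qed

theorem BMT_dist_consistent:
  assumes \<mu>: "\<mu> \<in> moments"
  shows "AE x in (samples \<mu>). (\<lambda>n. BMT_dist \<mu> n x) \<longlonglongrightarrow> 0"
proof -
  have "AE x in (samples \<mu>). \<forall>m. \<forall>\<^sub>F n in sequentially. BMT_dist \<mu> n x \<le> ennreal (1 / real (Suc m))"
    unfolding AE_all_countable by (intro allI BMT_dist_eventually_le[OF \<mu>]) simp
  then show ?thesis
  proof eventually_elim
    fix x assume *: "\<forall>m. \<forall>\<^sub>F n in sequentially. BMT_dist \<mu> n x \<le> ennreal (1 / real (Suc m))"
    show "(\<lambda>n. BMT_dist \<mu> n x) \<longlonglongrightarrow> 0"
    proof (rule order_tendstoI)
      fix a :: ennreal assume "0 < a"
      then obtain q where q: "0 < q" "q < a" using dense by blast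
      then obtain u where u: "q = ennreal u" "0 < u"
        by (cases q) (auto simp: top_unique)
      obtain m where "1 / real (Suc m) < u" using nat_approx_posE[OF u(2)] by blast
      then have "ennreal (1 / real (Suc m)) \<le> q" using u by (simp add: ennreal_leI)
      then show "\<forall>\<^sub>F n in sequentially. BMT_dist \<mu> n x < a"
        using *[rule_format, of m] q(2) by (auto elim!: eventually_mono)
    qed simp
  qed
qed

end

section \<open>Expected deviation and convergence rate\<close>

context iid_samples
begin

text \<open>The bound \<open>\<bar>z\<bar> \<le> (z ^ 2 / l + l) / 2\<close>, with the same
  \<open>l\<close> for every cell, replaces the Cauchy-Schwarz inequality. The second moments sum to
  at most \<open>1 / n\<close> because the cells partition the space.\<close>

lemma expected_partition_deviation:
  fixes \<kappa> :: "'a \<Rightarrow> 'k"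
  assumes fin: "finite K" and K: "\<kappa> \<in> space N \<rightarrow> K" and [measurable]: "\<kappa> \<in> measurable N (count_space UNIV)"
    and n: "0 < n"
  defines "dev \<equiv> (\<lambda>x. cell_deviation N (empirical_measure N n x) K \<kappa>)"
  shows "integrable P dev" and "(\<integral>x. dev x \<partial>P) \<le> sqrt (real (card K) / real n)"
proof -
  define A where "A k = {y \<in> space N. \<kappa> y = k}" for k
  have [measurable]: "A k \<in> sets N" for k unfolding A_def by measurable
  define S where "S k x = (\<Sum>i<n. indicat_real (A k) (x i))" for k x
  have [measurable]: "S k \<in> borel_measurable P" for k unfolding S_def by measurable
  define z where "z k x = measure N (A k) - S k x / real n" for k x
  have [measurable]: "z k \<in> borel_measurable P" for k unfolding z_def by measurable
  have dev: "dev x = (\<Sum>k\<in>K. \<bar>z k x\<bar>)" if "x \<in> space P" for x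
    using n that by (simp add: dev_def z_def S_def A_def cell_deviation_def measure_empirical_measure)
  have sumA: "(\<Sum>k\<in>K. measure N (A k)) = 1"
  proof -
    have "space N = (\<Union>k\<in>K. A k)" using K by (auto simp: A_def)
    then have "measure N (space N) = (\<Sum>k\<in>K. measure N (A k))"
      by (simp only:) (rule finite_measure_finite_Union[OF fin], auto simp: disjoint_family_on_def A_def)
    then show ?thesis by (simp add: prob_space)
  qed
  have sq: "integrable P (\<lambda>x. z k x ^ 2) \<and> (\<integral>x. z k x ^ 2 \<partial>P) \<le> measure N (A k) / real n" for k
  proof -
    have b: "\<bar>indicat_real (A k) y\<bar> \<le> 1" for y by (simp add: indicator_def)
    have m: "(\<integral>y. indicat_real (A k) y \<partial>N) = measure N (A k)" by simp
    have m2: "(\<integral>y. (indicat_real (A k) y) ^ 2 \<partial>N) = measure N (A k)"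
      by (simp add: power2_eq_square flip: indicator_inter_arith)
    have "(\<lambda>x. z k x ^ 2) = (\<lambda>x. (S k x - real n * measure N (A k)) ^ 2 / (real n) ^ 2)"
    proof
      fix x
      have "z k x = - ((S k x - real n * measure N (A k)) / real n)"
        using n by (simp add: z_def field_simps)
      then show "z k x ^ 2 = (S k x - real n * measure N (A k)) ^ 2 / (real n) ^ 2"
        by (simp add: power_divide)
    qed
    moreover note sm = second_moment_sum[of "indicat_real (A k)" 1 n, OF _ b, unfolded m m2, folded S_def]
    have "integrable P (\<lambda>x. (S k x - real n * measure N (A k)) ^ 2 / (real n) ^ 2)"
      by (intro integrable_divide sm(1)) measurable
    moreover have "(\<integral>x. (S k x - real n * measure N (A k)) ^ 2 / (real n) ^ 2 \<partial>P) \<le> measure N (A k) / real n"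
    proof -
      have "(\<integral>x. (S k x - real n * measure N (A k)) ^ 2 \<partial>P) / (real n) ^ 2 \<le> real n * measure N (A k) / (real n) ^ 2"
        by (intro divide_right_mono sm(2)) auto
      also have "\<dots> = measure N (A k) / real n" using n by (simp add: power2_eq_square)
      finally show ?thesis by simp
    qed
    ultimately show ?thesis by simp
  qed
  have zi: "integrable P (\<lambda>x. \<bar>z k x\<bar>)" for k
    by (rule integrable_abs, rule P.square_integrable_imp_integrable[OF _ conjunct1[OF sq]]) measurable
  show di: "integrable P dev"
    by (rule Bochner_Integration.integrable_cong[THEN iffD2, OF refl dev], assumption)
       (intro Bochner_Integration.integrable_sum zi)
  have cK: "0 < card K" using fin sumA by (auto simp: card_gt_0_iff)
  \<comment> \<open>Minimises \<open>1 / (n * l) + card K * l\<close>.\<close>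
  define l where "l = 1 / sqrt (real n * real (card K))"
  have l: "0 < l" using n cK by (simp add: l_def)
  have "(\<integral>x. dev x \<partial>P) \<le> (\<integral>x. (\<Sum>k\<in>K. (z k x ^ 2 / l + l) / 2) \<partial>P)"
  proof (rule integral_mono[OF di], goal_cases)
    case (2 x)
    show ?case
      unfolding dev[OF 2]
    proof (rule sum_mono)
      fix k
      have "0 \<le> (\<bar>z k x\<bar> - l) ^ 2" by simp
      then have "2 * l * \<bar>z k x\<bar> \<le> z k x ^ 2 + l ^ 2" by (simp add: power2_diff mult_ac)
      then show "\<bar>z k x\<bar> \<le> (z k x ^ 2 / l + l) / 2" using l by (simp add: field_simps power2_eq_square)
    qed
  qed (use sq in auto)
  also have "\<dots> = (\<Sum>k\<in>K. ((\<integral>x. z k x ^ 2 \<partial>P) / l + l) / 2)"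
    using sq by (subst Bochner_Integration.integral_sum) (auto simp: P.prob_space)
  also have "\<dots> \<le> (\<Sum>k\<in>K. (measure N (A k) / real n / l + l) / 2)"
    using sq l by (intro sum_mono divide_right_mono add_right_mono) auto
  also have "\<dots> = (1 / (real n * l) + real (card K) * l) / 2"
    using sumA by (simp add: sum.distrib flip: sum_divide_distrib)
  also have "\<dots> = sqrt (real (card K) / real n)"
  proof -
    define a where "a = sqrt (real n)"
    define b where "b = sqrt (real (card K))"
    have ab: "0 < a" "0 < b" "real n = a * a" "real (card K) = b * b" using n cK by (auto simp: a_def b_def)
    have "l = 1 / (a * b)" by (simp add: l_def real_sqrt_mult a_def b_def)
    then have "1 / (real n * l) = b / a" "real (card K) * l = b / a" using ab by simp_all
    moreover have "sqrt (real (card K) / real n) = b / a" by (simp add: real_sqrt_divide a_def b_def)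
    ultimately show ?thesis by simp
  qed
  finally show "(\<integral>x. dev x \<partial>P) \<le> sqrt (real (card K) / real n)" .
qed

end

text \<open>Linearises the \<open>p\<close>-th root at \<open>c\<close>: up to \<open>c\<close> the
  first term suffices, and above it \<open>G powr (1 / p)\<close> is \<open>G\<close> times a
  nonincreasing power. An affine function of \<open>G\<close> is measurable and has an immediate
  expectation.\<close>

lemma powr_root_bound:
  fixes G c p :: real
  assumes "0 \<le> G" "0 < c" "1 \<le> p"
  shows "G \<le> (c powr (1 / p) + G * c powr (1 / p - 1)) powr p"
proof -
  have *: "G \<le> B powr p" if "G powr (1 / p) \<le> B" for B
  proof -
    have "G = (G powr (1 / p)) powr p" using assms by (simp add: powr_powr)
    also have "\<dots> \<le> B powr p" using that assms by (intro powr_mono2) auto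
    finally show ?thesis .
  qed
  show ?thesis
  proof (rule *, cases "G \<le> c")
    case True
    then have "G powr (1 / p) \<le> c powr (1 / p)" using assms by (intro powr_mono2) auto
    then show "G powr (1 / p) \<le> c powr (1 / p) + G * c powr (1 / p - 1)" using assms by (simp add: add_increasing2)
  next
    case False
    have "G powr (1 / p) = G * G powr (1 / p - 1)"
      using False assms by (simp add: powr_diff)
    also have "\<dots> \<le> G * c powr (1 / p - 1)"
      using False assms by (intro mult_left_mono powr_mono2') auto
    finally show "G powr (1 / p) \<le> c powr (1 / p) + G * c powr (1 / p - 1)"
      by (simp add: add_increasing)
  qed
qed

text \<open>The affine function from \<open>powr_root_bound\<close> is the measurable majorant of
  \<open>f\<close>; it stays positive where \<open>G\<close> vanishes, as the condition on
  \<open>B\<close> demands. At mean \<open>c\<close> its two terms are \<open>c powr (1 / p)\<close>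
  each, whence the factor 2.\<close>

lemma outer_expectation_root_le:
  fixes G :: "'w \<Rightarrow> real"
  assumes P: "prob_space P" and G: "integrable P G" "\<And>x. x \<in> space P \<Longrightarrow> 0 \<le> G x"
    and c: "0 < c" "(\<integral>x. G x \<partial>P) \<le> c" and p: "1 \<le> p" and A: "0 \<le> A"
    and f: "\<And>x B. x \<in> space P \<Longrightarrow> 0 < B \<Longrightarrow> G x \<le> B powr p \<Longrightarrow> f x \<le> ennreal (A * B)"
  shows "outer_expectation P f \<le> ennreal (2 * A * c powr (1 / p))"
proof -
  interpret prob_space P by fact
  define g where "g x = A * (c powr (1 / p) + G x * c powr (1 / p - 1))" for x
  have g0: "x \<in> space P \<Longrightarrow> 0 \<le> g x" for x using A G(2) by (simp add: g_def)
  have gi: "integrable P g" using G(1) by (simp add: g_def[abs_def])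
  have fg: "f x \<le> ennreal (g x)" if x: "x \<in> space P" for x
  proof -
    have "0 < c powr (1 / p) + G x * c powr (1 / p - 1)"
      using c G(2)[OF x] by (simp add: add_pos_nonneg)
    then show ?thesis
      unfolding g_def using powr_root_bound[OF G(2)[OF x] c(1) p] by (intro f[OF x])
  qed
  have "outer_expectation P f \<le> (\<integral>\<^sup>+ x. ennreal (g x) \<partial>P)"
    unfolding outer_expectation_def using fg gi
    by (intro INF_lower) auto
  also have "\<dots> = ennreal (\<integral>x. g x \<partial>P)"
    using gi g0 by (intro nn_integral_eq_integral) auto
  also have "(\<integral>x. g x \<partial>P) = A * (c powr (1 / p) + (\<integral>x. G x \<partial>P) * c powr (1 / p - 1))"
    using G(1) by (simp add: g_def[abs_def] prob_space)
  also have "ennreal \<dots> \<le> ennreal (A * (c powr (1 / p) + c * c powr (1 / p - 1)))"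
    using c A by (intro ennreal_leI mult_left_mono add_left_mono mult_right_mono) auto
  also have "A * (c powr (1 / p) + c * c powr (1 / p - 1)) = 2 * A * c powr (1 / p)"
    using c by (simp add: powr_diff)
  finally show ?thesis .
qed

lemma sum_adjacent_le:
  fixes \<rho> :: "nat \<Rightarrow> real"
  assumes "mono \<rho>"
  shows "(\<Sum>i<l. \<rho> i + \<rho> (Suc i)) \<le> 2 * real l * \<rho> l"
proof -
  have "(\<Sum>i<l. \<rho> i + \<rho> (Suc i)) \<le> (\<Sum>i<l. 2 * \<rho> l)"
    using monoD[OF assms] by (intro sum_mono) (smt (verit) Suc_leI lessThan_iff less_imp_le)
  then show ?thesis by simp
qed

context bmt_setting
begin

text \<open>Cells are defined by chaining: a point gets a centre of the finest cover, that centre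
  one of the next cover no farther away than the sum of the two radii, and so on; points share a
  cell at level \<open>j\<close> when their chains agree there. As the radii increase, the drift
  along a chain is at most \<open>2 * j * \<rho> j\<close>, which gives the diameter
  \<open>(4 * J + 2) * \<rho> j\<close>.\<close>

theorem outer_expectation_multiscale:
  fixes \<rho> :: "nat \<Rightarrow> real" and S F :: "nat \<Rightarrow> 'a set"
  assumes \<mu>: "\<mu> \<in> moments" and n: "0 < n"
    and \<Delta>: "\<And>x y. x \<in> M \<Longrightarrow> y \<in> M \<Longrightarrow> d x y \<le> \<Delta>" "0 \<le> \<Delta>"
    and \<rho>: "mono \<rho>" "\<And>l. 0 \<le> \<rho> l"
    and S: "\<And>l. l \<le> J \<Longrightarrow> S l \<in> sets \<mu>"
    and F: "\<And>l. l \<le> J \<Longrightarrow> finite (F l)" "\<And>l. l \<le> J \<Longrightarrow> F l \<subseteq> M"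
    and cover: "\<And>l. l \<le> J \<Longrightarrow> S l \<subseteq> (\<Union>c\<in>F l. mcball c (\<rho> l))"
  defines "D \<equiv> (\<lambda>j. if j \<le> J then (real (4 * J + 2) * \<rho> j) powr p else \<Delta> powr p)"
  assumes c: "0 < c" "D 0 + (\<Sum>j\<le>J. D (Suc j) * sqrt ((real (card (F j)) + 1) / real n))
      + \<Delta> powr p * (\<Sum>l\<le>J. 1 - measure \<mu> (S l)) \<le> c"
  shows "outer_expectation (samples \<mu>) (BMT_dist \<mu> n)
    \<le> ennreal (2 * (L * (modulus + 2)) * c powr (1 / p))"
proof -
  interpret iid_samples \<mu> using \<mu> by (rule iid_samples_moments)
  have sp: "space \<mu> = M" by (rule moments_space[OF \<mu>])
  \<comment> \<open>Points of \<open>T\<close> are covered at every level, so their chains never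
    break.\<close>
  define T where "T = (\<Inter>l\<le>J. S l)"
  have T [measurable]: "T \<in> sets \<mu>" unfolding T_def using S by (intro sets.finite_INT) auto
  have TS: "l \<le> J \<Longrightarrow> T \<subseteq> S l" for l by (auto simp: T_def)
  have TM: "T \<subseteq> M" using sets.sets_into_space[OF T] sp by simp
  \<comment> \<open>Only centres whose ball meets \<open>T\<close> are kept: such a ball contains a
    point covered at the next level, and this provides a successor.\<close>
  define F' where "F' l = {y \<in> F l. \<exists>x\<in>T. d y x \<le> \<rho> l}" for l
  have F'M: "l \<le> J \<Longrightarrow> F' l \<subseteq> M" and F'F: "F' l \<subseteq> F l" for l using F(2) by (auto simp: F'_def)
  have F'I: "y \<in> F' l" if "y \<in> F l" "x \<in> T" "d y x \<le> \<rho> l" for y l x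
    using that by (auto simp: F'_def)
  have near: "\<exists>y\<in>F l. x \<in> mcball y (\<rho> l)" if "x \<in> T" "l \<le> J" for x l
    using TS[OF that(2)] cover[OF that(2)] that(1) by blast
  define \<phi> where "\<phi> l y = (SOME z. z \<in> F' (Suc l) \<and> d y z \<le> \<rho> l + \<rho> (Suc l))" for l y
  have \<phi>: "\<phi> l y \<in> F' (Suc l) \<and> d y (\<phi> l y) \<le> \<rho> l + \<rho> (Suc l)" if y: "y \<in> F' l" and l: "Suc l \<le> J" for l y
  proof -
    obtain x where x: "x \<in> T" "d y x \<le> \<rho> l" using y by (auto simp: F'_def)
    obtain z where z: "z \<in> F (Suc l)" "x \<in> mcball z (\<rho> (Suc l))" using near[OF x(1) l] by blast
    have "y \<in> M" "z \<in> M" "x \<in> M" using F'M[of l] y l z F(2)[OF l] x TM by auto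
    then have "d y z \<le> \<rho> l + \<rho> (Suc l)" using triangle[of y x z] x z by (auto simp: commute)
    then have "z \<in> F' (Suc l) \<and> d y z \<le> \<rho> l + \<rho> (Suc l)"
      using F'I[OF z(1) x(1)] z by auto
    then show ?thesis unfolding \<phi>_def by (rule someI)
  qed
  define h where "h l y = rec_nat y \<phi> l" for l y
  have h_0: "h 0 y = y" and h_Suc: "h (Suc l) y = \<phi> l (h l y)" for l y by (simp_all add: h_def)
  have h_mem: "h l y \<in> F' l \<and> d y (h l y) \<le> (\<Sum>i<l. \<rho> i + \<rho> (Suc i))"
    if y: "y \<in> F' 0" and "l \<le> J" for y l
    using \<open>l \<le> J\<close>
  proof (induction l)
    case 0
    then show ?case using y F'M[of 0] by (auto simp: h_0)
  next
    case (Suc l)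
    then have IH: "h l y \<in> F' l" "d y (h l y) \<le> (\<Sum>i<l. \<rho> i + \<rho> (Suc i))" by auto
    have "\<phi> l (h l y) \<in> F' (Suc l)" "d (h l y) (\<phi> l (h l y)) \<le> \<rho> l + \<rho> (Suc l)"
      using \<phi>[OF IH(1) Suc.prems] by auto
    moreover have "d y (\<phi> l (h l y)) \<le> d y (h l y) + d (h l y) (\<phi> l (h l y))"
      using y IH(1) calculation(1) F'M[of 0] F'M[of l] F'M[of "Suc l"] Suc.prems
      by (intro triangle) auto
    ultimately show ?case using IH(2) by (simp add: h_Suc)
  qed
  obtain e and N :: nat where e: "F 0 = e ` {..<N}"
    using finite_imp_nat_seg_image_inj_on[OF F(1)[of 0]] by (auto simp: lessThan_def)
  define k where "k x = (LEAST i. N \<le> i \<or> x \<in> mcball (e i) (\<rho> 0))" for x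
  have [measurable]: "mcball z r \<in> sets \<mu>" for z r
  proof -
    have "M - mcball z r \<in> sets \<mu>"
      unfolding moments_sets[OF \<mu>]
      using closedin_mcball[of z r] by (intro openin_in_sets_borel_of) (simp add: closedin_def)
    moreover have "M \<in> sets \<mu>" using sets.top[of \<mu>] by (simp add: sp)
    ultimately have "M - (M - mcball z r) \<in> sets \<mu>" by (rule sets.Diff[rotated])
    moreover have "M - (M - mcball z r) = mcball z r" by auto
    ultimately show ?thesis by simp
  qed
  have [measurable]: "k \<in> measurable \<mu> (count_space UNIV)" unfolding k_def by measurable
  \<comment> \<open>\<open>None\<close> is the one cell of all points outside
    \<open>T\<close>.\<close>
  define \<iota> where "\<iota> x = (if x \<in> T then Some (e (k x)) else None)" for x
  have \<iota>m [measurable]: "\<iota> \<in> measurable \<mu> (count_space UNIV)"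
  proof -
    have "(\<lambda>x. Some (e (k x))) \<in> measurable \<mu> (count_space UNIV)"
      by (rule measurable_compose[of k _ "count_space UNIV"]) auto
    then show ?thesis unfolding \<iota>_def by measurable
  qed
  have k_prop: "e (k x) \<in> F' 0 \<and> d (e (k x)) x \<le> \<rho> 0" if x: "x \<in> T" for x
  proof -
    obtain i where i: "i < N" "x \<in> mcball (e i) (\<rho> 0)" using near[OF x, of 0] e by auto
    have "N \<le> k x \<or> x \<in> mcball (e (k x)) (\<rho> 0)" unfolding k_def by (rule LeastI[of _ i]) (use i in auto)
    moreover have "k x \<le> i" unfolding k_def by (rule Least_le) (use i in auto)
    ultimately show ?thesis using i e F'I[of "e (k x)" 0 x] x by auto
  qed
  define I where "I = insert None (Some ` F' 0)"
  have fin_F': "l \<le> J \<Longrightarrow> finite (F' l)" for l using F(1) F'F finite_subset by blast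
  have finI: "finite I" using fin_F' by (auto simp: I_def)
  have \<iota>I: "\<iota> \<in> space \<mu> \<rightarrow> I" using k_prop by (auto simp: \<iota>_def I_def)
  \<comment> \<open>Beyond level \<open>J\<close> a single class remains, and \<open>D\<close>
    charges it the full \<open>\<Delta> powr p\<close>.\<close>
  define g where "g j o' = (if j \<le> J then map_option (h j) o' else None)" for j o'
  have nested: "g (Suc j) i = g (Suc j) i'" if "g j i = g j i'" for j i i'
    using that by (cases i; cases i') (auto simp: g_def h_Suc split: if_splits)
  have top: "g (Suc J) i = g (Suc J) i'" for i i' by (simp add: g_def)
  have D0: "0 \<le> D j" for j by (simp add: D_def)
  \<comment> \<open>Only the first coordinate is charged: if \<open>x\<close> lies in
    \<open>T\<close> and shares a cell with \<open>y\<close> at a level up to \<open>J\<close>, then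
    \<open>y\<close> lies in \<open>T\<close> as well. So the empirical mass outside
    \<open>T\<close> needs no term of its own.\<close>
  define rest where "rest x = ennreal (\<Delta> powr p) * indicator (M - T) x" for x
  have [measurable]: "M \<in> sets \<mu>" using sp sets.top[of \<mu>] by simp
  have rest_m [measurable]: "rest \<in> borel_measurable \<mu>" unfolding rest_def by measurable
  have cost: "ennreal (d x y powr p) \<le> ennreal (D j) + (rest x + 0)"
    if xyM: "x \<in> M" "y \<in> M" and j: "j \<le> Suc J" and eq: "g j (\<iota> x) = g j (\<iota> y)" for x y j
  proof -
    have big: "d x y powr p \<le> \<Delta> powr p" using \<Delta>(1)[OF xyM] p_ge_1 by (intro powr_mono2) auto
    consider "x \<notin> T" | "Suc J \<le> j" | "x \<in> T" "j \<le> J" by linarith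
    then show ?thesis
    proof cases
      case 1
      then have "rest x = ennreal (\<Delta> powr p)" using xyM by (simp add: rest_def)
      then show ?thesis using big by (simp add: add_increasing ennreal_leI)
    next
      case 2
      then have "D j = \<Delta> powr p" by (simp add: D_def)
      then show ?thesis using big by (simp add: add_increasing2 ennreal_leI)
    next
      case 3
      have yT: "y \<in> T" using 3 eq by (auto simp: g_def \<iota>_def split: if_splits)
      define a b where "a = e (k x)" and "b = e (k y)"
      have ab: "a \<in> F' 0" "d a x \<le> \<rho> 0" "b \<in> F' 0" "d b y \<le> \<rho> 0"
        using k_prop[OF 3(1)] k_prop[OF yT] by (auto simp: a_def b_def)
      have hab: "h j a = h j b" using eq 3 yT by (simp add: g_def \<iota>_def a_def b_def)
      define z where "z = h j a"
      have z: "z \<in> F' j" "d a z \<le> 2 * real j * \<rho> j" "d b z \<le> 2 * real j * \<rho> j"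
        using h_mem[OF ab(1) 3(2)] h_mem[OF ab(3) 3(2)] sum_adjacent_le[OF \<rho>(1), of j]
        by (auto simp: z_def hab)
      have M: "a \<in> M" "b \<in> M" "z \<in> M" using ab z(1) F'M[of 0] F'M[OF 3(2)] by auto
      have "d x y \<le> d a x + d a z + (d b z + d b y)"
        using triangle[of x a y] triangle[of a z y] triangle[of z b y] M xyM
        by (simp add: commute)
      also have "\<dots> \<le> 2 * \<rho> 0 + 4 * real j * \<rho> j" using ab z by simp
      also have "\<dots> \<le> real (4 * J + 2) * \<rho> j"
      proof -
        have "\<rho> 0 \<le> \<rho> j" using monoD[OF \<rho>(1)] by simp
        moreover have "4 * real j * \<rho> j \<le> 4 * real J * \<rho> j"
          using 3(2) \<rho>(2) by (intro mult_right_mono) auto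
        ultimately show ?thesis by (simp add: distrib_right)
      qed
      finally have "d x y powr p \<le> D j"
        using 3(2) p_ge_1 by (simp add: D_def powr_mono2)
      then show ?thesis by (simp add: add_increasing2 ennreal_leI)
    qed
  qed
  have gm: "(\<lambda>x. g j (\<iota> x)) \<in> measurable \<mu> (count_space UNIV)" for j
    by (rule measurable_compose[OF \<iota>m]) simp
  define dev where "dev j x = cell_deviation \<mu> (empirical_measure \<mu> n x) (g j ` I) (\<lambda>y. g j (\<iota> y))" for j x
  have gI: "(\<lambda>x. g j (\<iota> x)) \<in> space \<mu> \<rightarrow> g j ` I" for j using \<iota>I by blast
  have dev_int: "integrable P (dev j)" for j
    unfolding dev_def by (rule expected_partition_deviation(1)[OF finite_imageI[OF finI] gI gm n])
  have dev_le: "(\<integral>x. dev j x \<partial>P) \<le> sqrt ((real (card (F j)) + 1) / real n)" if j: "j \<le> J" for j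
  proof -
    \<comment> \<open>The summand 1 next to \<open>card (F j)\<close> is the cell
      \<open>None\<close>.\<close>
    have "g j ` I \<subseteq> insert None (Some ` F j)"
      using h_mem j F'F[of j] by (fastforce simp: I_def g_def)
    then have "card (g j ` I) \<le> card (insert None (Some ` F j))"
      using F(1)[OF j] by (intro card_mono) auto
    also have "\<dots> = card (F j) + 1" using F(1)[OF j] by (simp add: card_image)
    finally have "sqrt (real (card (g j ` I)) / real n) \<le> sqrt ((real (card (F j)) + 1) / real n)"
      by (intro real_sqrt_le_mono divide_right_mono) auto
    moreover have "(\<integral>x. dev j x \<partial>P) \<le> sqrt (real (card (g j ` I)) / real n)"
      unfolding dev_def by (rule expected_partition_deviation(2)[OF finite_imageI[OF finI] gI gm n])
    ultimately show ?thesis by (rule order_trans[rotated])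
  qed
  define R where "R = \<Delta> powr p * measure \<mu> (M - T)"
  define G where "G x = D 0 + (\<Sum>j\<le>J. D (Suc j) * dev j x) + R" for x
  have dev0: "0 \<le> dev j x" for j x by (auto simp: dev_def cell_deviation_def intro: sum_nonneg)
  have R0: "0 \<le> R" by (simp add: R_def)
  have G0: "0 \<le> G x" for x
    using D0 dev0 R0 unfolding G_def by (intro add_nonneg_nonneg sum_nonneg mult_nonneg_nonneg)
  have rest_int: "(\<integral>\<^sup>+ x. rest x \<partial>\<mu>) = ennreal R"
    unfolding rest_def R_def by (simp add: nn_integral_cmult_indicator emeasure_eq_measure ennreal_mult)
  have key: "BMT_dist \<mu> n x \<le> ennreal (L * (modulus + 2) * B)"
    if x: "x \<in> space P" and B: "0 < B" "G x \<le> B powr p" for x B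
  proof (rule BMT_dist_le_nested[OF \<mu> n x B(1), of I \<iota> g J D rest "\<lambda>_. 0"])
    have "ennreal (D 0 + (\<Sum>j\<le>J. D (Suc j) * dev j x)) + ennreal R = ennreal (G x)"
      unfolding G_def using D0 dev0 R0
      by (intro ennreal_plus[symmetric] add_nonneg_nonneg sum_nonneg mult_nonneg_nonneg)
    also have "\<dots> \<le> ennreal (B powr p)" using B(2) by (rule ennreal_leI)
    finally show "ennreal (D 0 + (\<Sum>j\<le>J. D (Suc j) *
          cell_deviation \<mu> (empirical_measure \<mu> n x) (g j ` I) (\<lambda>x. g j (\<iota> x))))
        + ((\<integral>\<^sup>+ y. rest y \<partial>\<mu>) + (\<integral>\<^sup>+ y. 0 \<partial>empirical_measure \<mu> n x)) \<le> ennreal (B powr p)"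
      by (simp add: rest_int dev_def)
  qed (rule finI \<iota>I[unfolded sp] \<iota>m nested top D0 rest_m borel_measurable_const cost; assumption)+
  have G_int: "integrable P G"
    unfolding G_def using dev_int by (intro Bochner_Integration.integrable_add
        Bochner_Integration.integrable_sum integrable_mult_right) auto
  have "(\<integral>x. G x \<partial>P) = D 0 + (\<Sum>j\<le>J. D (Suc j) * (\<integral>x. dev j x \<partial>P)) + R"
    unfolding G_def using dev_int by (simp add: Bochner_Integration.integral_sum P.prob_space)
  also have "\<dots> \<le> D 0 + (\<Sum>j\<le>J. D (Suc j) * sqrt ((real (card (F j)) + 1) / real n))
      + \<Delta> powr p * (\<Sum>l\<le>J. 1 - measure \<mu> (S l))"
  proof (intro add_mono sum_mono mult_left_mono dev_le)
    have "M - T = (\<Union>l\<le>J. M - S l)" by (auto simp: T_def)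
    then have "measure \<mu> (M - T) \<le> (\<Sum>l\<le>J. measure \<mu> (M - S l))"
      by (simp only:) (rule finite_measure_subadditive_finite, use S in auto)
    also have "\<dots> = (\<Sum>l\<le>J. 1 - measure \<mu> (S l))"
      using S prob_compl by (intro sum.cong refl) (simp flip: sp)
    finally show "R \<le> \<Delta> powr p * (\<Sum>l\<le>J. 1 - measure \<mu> (S l))"
      unfolding R_def by (intro mult_left_mono) auto
  qed (use D0 in auto)
  also have "\<dots> \<le> c" by (rule c(2))
  finally have Gc: "(\<integral>x. G x \<partial>P) \<le> c" .
  show ?thesis
    using L_pos by (intro outer_expectation_root_le[OF P.prob_space_axioms G_int G0 c(1) Gc p_ge_1 _ key]) auto
qed

end

section \<open>Covers supplied by the dimension, and the choice of scales\<close>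

lemma Inf_enat_attained:
  assumes "Inf A = enat m"
  shows "enat m \<in> A"
proof -
  have "A \<noteq> {}" using assms by (auto simp: top_enat_def)
  then have "Inf A \<in> A" by (simp add: Inf_enat_def) (metis LeastI ex_in_conv)
  then show ?thesis using assms by simp
qed

lemma powr_dimension_bound:
  fixes \<epsilon> t :: real
  assumes "0 < \<epsilon>" "\<epsilon> < 1" "ln (real m) / (- ln \<epsilon>) < t" "0 \<le> t"
  shows "real m \<le> \<epsilon> powr (- t)"
proof (cases "m = 0")
  case False
  have "ln (real m) < t * (- ln \<epsilon>)" using assms by (simp add: field_simps)
  then have "exp (ln (real m)) \<le> exp (t * (- ln \<epsilon>))" by simp
  then show ?thesis using False assms by (simp add: powr_def)
qed simp

context bmt_setting
begin

text \<open>\<open>t\<close> is taken strictly between some \<open>s'\<close> of the defining set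
  and \<open>s\<close>. Above the limsup, the bound on covering numbers holds at every small scale;
  below \<open>s\<close>, there is room for later losses.\<close>

lemma dimension_cover:
  assumes \<mu>: "\<mu> \<in> moments" and s: "upper_wasserstein_dim p d \<mu> < ereal s"
  obtains t \<epsilon>\<^sub>0 where "2 * p < t" "t < s" "0 < \<epsilon>\<^sub>0" "\<epsilon>\<^sub>0 \<le> 1"
    "\<And>\<epsilon>. 0 < \<epsilon> \<Longrightarrow> \<epsilon> < \<epsilon>\<^sub>0 \<Longrightarrow> \<exists>S F. S \<in> sets \<mu> \<and> 1 - \<epsilon> powr (t * p / (t - 2 * p)) \<le> measure \<mu> S \<and>
      finite F \<and> F \<subseteq> M \<and> real (card F) \<le> \<epsilon> powr (- t) \<and> S \<subseteq> (\<Union>c\<in>F. mcball c (\<epsilon> / 2))"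
proof -
  obtain s' where s': "2 * p < s'" "s' < s"
    and lim: "Limsup (at_right 0) (\<lambda>\<epsilon>. measure_dim d \<mu> \<epsilon> (\<epsilon> powr (s' * p / (s' - 2 * p)))) \<le> ereal s'"
    using s by (auto simp: upper_wasserstein_dim_def INF_less_iff)
  define t where "t = (s' + s) / 2"
  have t: "s' < t" "t < s" "2 * p < t" using s' by (auto simp: t_def)
  have "Limsup (at_right 0) (\<lambda>\<epsilon>. measure_dim d \<mu> \<epsilon> (\<epsilon> powr (s' * p / (s' - 2 * p)))) < ereal t"
    using lim t(1) by (rule order.strict_trans1[OF _ less_ereal.simps(1)[THEN iffD2]])
  then have "\<forall>\<^sub>F \<epsilon> in at_right 0. measure_dim d \<mu> \<epsilon> (\<epsilon> powr (s' * p / (s' - 2 * p))) < ereal t"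
    by (rule Limsup_lessD)
  then obtain b where b: "0 < b"
    "\<And>\<epsilon>. 0 < \<epsilon> \<Longrightarrow> \<epsilon> < b \<Longrightarrow> measure_dim d \<mu> \<epsilon> (\<epsilon> powr (s' * p / (s' - 2 * p))) < ereal t"
    by (auto simp: eventually_at_right[of 0 1])
  \<comment> \<open>The exponent decreases in \<open>s'\<close>, so at scales below 1 the mass that
    may be discarded only grows when \<open>t\<close> replaces \<open>s'\<close>.\<close>
  have \<beta>: "t * p / (t - 2 * p) \<le> s' * p / (s' - 2 * p)"
  proof -
    have "t * (s' - 2 * p) \<le> s' * (t - 2 * p)"
      using t(1) p_ge_1 by (simp add: algebra_simps)
    then have "p * (t * (s' - 2 * p)) \<le> p * (s' * (t - 2 * p))"
      using p_ge_1 by (intro mult_left_mono) auto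
    then show ?thesis using t s' by (simp add: divide_le_eq le_divide_eq pos_le_divide_eq mult_ac)
  qed
  show thesis
  proof (rule that[of t "min b 1"])
    fix \<epsilon> :: real assume \<epsilon>: "0 < \<epsilon>" "\<epsilon> < min b 1"
    define \<tau> where "\<tau> = \<epsilon> powr (s' * p / (s' - 2 * p))"
    have dim: "measure_dim d \<mu> \<epsilon> \<tau> < ereal t" using b(2)[of \<epsilon>] \<epsilon> by (simp add: \<tau>_def)
    then obtain m where m: "measure_covering_number d \<mu> \<epsilon> \<tau> = enat m" "ln (real m) / (- ln \<epsilon>) < t"
      by (cases "measure_covering_number d \<mu> \<epsilon> \<tau>") (auto simp: measure_dim_def)
    have "enat m \<in> covering_number (space \<mu>) d \<epsilon> ` {S \<in> sets \<mu>. measure \<mu> S \<ge> 1 - \<tau>}"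
      using m(1) unfolding measure_covering_number_def by (rule Inf_enat_attained)
    then obtain S where S: "S \<in> sets \<mu>" "1 - \<tau> \<le> measure \<mu> S" "covering_number M d \<epsilon> S = enat m"
      by (auto simp: moments_space[OF \<mu>])
    have "enat m \<in> (\<lambda>F. enat (card F)) ` {F. finite F \<and> F \<subseteq> M \<and> S \<subseteq> (\<Union>x\<in>F. mcball x (\<epsilon> / 2))}"
      using S(3) unfolding covering_number_def by (rule Inf_enat_attained)
    then obtain F where F: "finite F" "F \<subseteq> M" "S \<subseteq> (\<Union>x\<in>F. mcball x (\<epsilon> / 2))" "card F = m"
      by auto
    have "\<tau> \<le> \<epsilon> powr (t * p / (t - 2 * p))"
      unfolding \<tau>_def using \<epsilon> \<beta> by (intro powr_mono') auto
    moreover have "real m \<le> \<epsilon> powr (- t)"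
      using m(2) \<epsilon> t p_ge_1 by (intro powr_dimension_bound) auto
    ultimately show "\<exists>S F. S \<in> sets \<mu> \<and> 1 - \<epsilon> powr (t * p / (t - 2 * p)) \<le> measure \<mu> S \<and>
      finite F \<and> F \<subseteq> M \<and> real (card F) \<le> \<epsilon> powr (- t) \<and> S \<subseteq> (\<Union>c\<in>F. mcball c (\<epsilon> / 2))"
      using S F by (intro exI[of _ S] exI[of _ F]) auto
  qed (use t b in auto)
qed

text \<open>A single cell suffices: both measures are probabilities, so its deviation vanishes. This
  serves the \<open>n\<close> before the rate takes effect and spaces of diameter zero; as
  \<open>\<Delta> = 0\<close> is allowed, \<open>B\<close> is taken slightly above
  \<open>\<Delta>\<close>.\<close>

lemma outer_expectation_BMT_le_diameter:
  assumes \<mu>: "\<mu> \<in> moments" and n: "0 < n" and \<Delta>: "\<And>x y. x \<in> M \<Longrightarrow> y \<in> M \<Longrightarrow> d x y \<le> \<Delta>" "0 \<le> \<Delta>"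
  shows "outer_expectation (samples \<mu>) (BMT_dist \<mu> n) \<le> ennreal (L * (modulus + 2) * \<Delta>)"
proof -
  interpret iid_samples \<mu> using \<mu> by (rule iid_samples_moments)
  have A: "0 < L * (modulus + 2)" using L_pos by (simp add: add_nonneg_pos)
  have bound: "BMT_dist \<mu> n x \<le> ennreal (L * (modulus + 2) * \<Delta>)" if x: "x \<in> space P" for x
  proof -
    have dev: "cell_deviation \<mu> (empirical_measure \<mu> n x) {()} (\<lambda>_. ()) = 0"
      using prob_space.prob_space[OF prob_space_empirical_measure[OF n x]] prob_space
      by (simp add: cell_deviation_def space_empirical_measure)
    have le: "BMT_dist \<mu> n x \<le> ennreal (L * (modulus + 2) * B)" if B: "\<Delta> < B" for B
    proof (rule BMT_dist_le_nested[OF \<mu> n x, of B "{()}" "\<lambda>_. ()" "\<lambda>_ _. ()" 0 "\<lambda>_. \<Delta> powr p" "\<lambda>_. 0" "\<lambda>_. 0"])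
      show "ennreal (d y z powr p) \<le> ennreal (\<Delta> powr p) + (0 + 0)" if "y \<in> M" "z \<in> M" for y z
        using \<Delta>(1)[OF that] p_ge_1 by (simp add: ennreal_leI powr_mono2)
      have "\<Delta> powr p \<le> B powr p" using B \<Delta>(2) p_ge_1 by (intro powr_mono2) auto
      then show "ennreal (\<Delta> powr p + (\<Sum>j\<le>0. \<Delta> powr p *
            cell_deviation \<mu> (empirical_measure \<mu> n x) ((\<lambda>_. ()) ` {()}) (\<lambda>_. ())))
          + ((\<integral>\<^sup>+ y. 0 \<partial>\<mu>) + (\<integral>\<^sup>+ y. 0 \<partial>empirical_measure \<mu> n x)) \<le> ennreal (B powr p)"
        by (simp add: dev ennreal_leI)
    qed (use \<Delta>(2) B in auto)
    show ?thesis
    proof (rule ennreal_le_epsilon)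
      fix e :: real assume e: "0 < e"
      define B where "B = \<Delta> + e / (L * (modulus + 2))"
      have "L * (modulus + 2) * B = L * (modulus + 2) * \<Delta> + e"
        using A by (simp add: B_def distrib_left)
      moreover have "\<Delta> < B" using A e by (simp add: B_def)
      ultimately show "BMT_dist \<mu> n x \<le> ennreal (L * (modulus + 2) * \<Delta>) + ennreal e"
        using le[of B] A e \<Delta>(2) by (simp add: ennreal_plus)
    qed
  qed
  have "outer_expectation P (BMT_dist \<mu> n) \<le> (\<integral>\<^sup>+ x. ennreal (L * (modulus + 2) * \<Delta>) \<partial>P)"
    unfolding outer_expectation_def using bound by (intro INF_lower) auto
  then show ?thesis by (simp add: P.emeasure_space_1)
qed

theorem BMT_dist_rate:
  assumes \<mu>: "\<mu> \<in> moments" and \<Delta>: "\<And>x y. x \<in> M \<Longrightarrow> y \<in> M \<Longrightarrow> d x y \<le> \<Delta>" "0 < \<Delta>"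
    and s: "upper_wasserstein_dim p d \<mu> < ereal s"
  shows "\<forall>\<^sub>F n in sequentially. outer_expectation (samples \<mu>) (BMT_dist \<mu> n)
    \<le> ennreal (\<Delta> * real n powr (- 1 / s))"
proof -
  obtain t \<epsilon>\<^sub>0 where t: "2 * p < t" "t < s" and \<epsilon>0: "0 < \<epsilon>\<^sub>0" "\<epsilon>\<^sub>0 \<le> 1"
    and cover: "\<And>\<epsilon>. 0 < \<epsilon> \<Longrightarrow> \<epsilon> < \<epsilon>\<^sub>0 \<Longrightarrow> \<exists>S F. S \<in> sets \<mu> \<and> 1 - \<epsilon> powr (t * p / (t - 2 * p)) \<le> measure \<mu> S \<and>
      finite F \<and> F \<subseteq> M \<and> real (card F) \<le> \<epsilon> powr (- t) \<and> S \<subseteq> (\<Union>c\<in>F. mcball c (\<epsilon> / 2))"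
    using dimension_cover[OF \<mu> s] by metis
  have t0: "0 < t" "0 < s" using t p_ge_1 by auto
  \<comment> \<open>The coarsest exponent balances two errors: at scale \<open>n powr (- a)\<close>,
    both the discarded mass (\<open>a_beta\<close>) and the square root of the cover size over
    \<open>n\<close> (\<open>a_t\<close>) become \<open>n powr (- p / t)\<close>.\<close>
  define a where "a = (t - 2 * p) / t\<^sup>2"
  have a: "0 < a" using t t0 by (simp add: a_def)
  have a_beta: "a * (t * p / (t - 2 * p)) = p / t" using t t0 by (simp add: a_def power2_eq_square)
  have a_t: "a * t / 2 - 1 / 2 = - p / t"
  proof -
    have "a * t = (t - 2 * p) / t" using t0 by (simp add: a_def power2_eq_square)
    also have "\<dots> = 1 - 2 * (p / t)" using t0 by (simp add: diff_divide_distrib)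
    finally have "a * t = 1 - 2 * (p / t)" .
    moreover have "- p / t = - (p / t)" by simp
    ultimately show ?thesis by linarith
  qed
  have gap: "0 < 1 / t - 1 / s" using t t0 by (simp add: frac_less2)
  \<comment> \<open>The exponents run over an interval of length
    \<open>1 / t - a = 2 * p / t ^ 2\<close>. Enough equal steps make the step \<open>\<eta>\<close>
    smaller than the gap, independently of \<open>n\<close>.\<close>
  obtain J :: nat where J: "2 * p / t\<^sup>2 / (1 / t - 1 / s) < real J" using reals_Archimedean2 by blast
  have "0 < 2 * p / t\<^sup>2 / (1 / t - 1 / s)" using gap t0 p_ge_1 by simp
  then have J0: "0 < real J" using J by simp
  define \<eta> where "\<eta> = 2 * p / t\<^sup>2 / real J"
  have \<eta>0: "0 < \<eta>" using J0 t0 p_ge_1 by (simp add: \<eta>_def)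
  have \<eta>: "\<eta> < 1 / t - 1 / s"
    unfolding \<eta>_def using J by (simp only: pos_divide_less_eq[OF J0] pos_divide_less_eq[OF gap] mult.commute)
  define \<alpha> where "\<alpha> l = 1 / t - real l * \<eta>" for l :: nat
  have \<alpha>J: "\<alpha> J = a"
  proof -
    have "real J * \<eta> = 2 * p / t\<^sup>2" using J0 by (simp add: \<eta>_def)
    moreover have "a = 1 / t - 2 * p / t\<^sup>2" using t0 by (simp add: a_def diff_divide_distrib power2_eq_square)
    ultimately show ?thesis by (simp add: \<alpha>_def)
  qed
  have \<alpha>_anti: "\<alpha> l' \<le> \<alpha> l" if "l \<le> l'" for l l'
    using that \<eta>0 by (simp add: \<alpha>_def mult_right_mono)
  have \<alpha>_a: "a \<le> \<alpha> l" if "l \<le> J" for l using \<alpha>_anti[OF that] \<alpha>J by simp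
  \<comment> \<open>The exponent actually reached: one step \<open>\<eta>\<close> is lost, yet it
    still exceeds \<open>1 / s\<close>.\<close>
  define u where "u = 1 / t - \<eta>"
  have u: "1 / s < u" "p * u = p / t - p * \<eta>" using \<eta> by (auto simp: u_def right_diff_distrib)
  have pu: "p * u \<le> p / t" using u(2) \<eta>0 p_ge_1 by simp
  define c\<^sub>1 where "c\<^sub>1 = (real (2 * J + 1)) powr p"
  \<comment> \<open>Collects the finest diameter, the separations at levels below \<open>J\<close>
    and at \<open>J\<close>, and the discarded mass. No summand depends on \<open>n\<close>, since
    \<open>J\<close> was fixed before.\<close>
  define C where "C = c\<^sub>1 + (real J * (c\<^sub>1 * 2) + \<Delta> powr p * 2) + \<Delta> powr p * real (J + 1)"
  have c1: "0 < c\<^sub>1" by (simp add: c\<^sub>1_def)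
  have C: "0 < C" unfolding C_def using c1 \<Delta>(2) by (intro add_pos_nonneg) auto
  define A where "A = 2 * (L * (modulus + 2)) * C powr (1 / p)"
  have main: "outer_expectation (samples \<mu>) (BMT_dist \<mu> n) \<le> ennreal (A * real n powr (- u))"
    if n: "0 < n" and small: "real n powr (- a) < \<epsilon>\<^sub>0" for n
  proof -
    have n1: "1 \<le> real n" using n by simp
    have mono_exp: "real n powr x \<le> real n powr y" if "x \<le> y" for x y using n1 that by (intro powr_mono) auto
    define \<epsilon> where "\<epsilon> l = real n powr (- \<alpha> l)" for l
    have \<epsilon>_pos: "0 < \<epsilon> l" for l using n by (simp add: \<epsilon>_def)
    have \<epsilon>_small: "\<epsilon> l < \<epsilon>\<^sub>0" if "l \<le> J" for l
      using mono_exp[of "- \<alpha> l" "- a"] \<alpha>_a[OF that] small by (simp add: \<epsilon>_def)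
    have "\<forall>l. \<exists>SF. l \<le> J \<longrightarrow> fst SF \<in> sets \<mu> \<and> 1 - \<epsilon> l powr (t * p / (t - 2 * p)) \<le> measure \<mu> (fst SF) \<and>
      finite (snd SF) \<and> snd SF \<subseteq> M \<and> real (card (snd SF)) \<le> \<epsilon> l powr (- t) \<and>
      fst SF \<subseteq> (\<Union>c\<in>snd SF. mcball c (\<epsilon> l / 2))"
    proof
      fix l
      show "\<exists>SF. l \<le> J \<longrightarrow> fst SF \<in> sets \<mu> \<and> 1 - \<epsilon> l powr (t * p / (t - 2 * p)) \<le> measure \<mu> (fst SF) \<and>
        finite (snd SF) \<and> snd SF \<subseteq> M \<and> real (card (snd SF)) \<le> \<epsilon> l powr (- t) \<and>
        fst SF \<subseteq> (\<Union>c\<in>snd SF. mcball c (\<epsilon> l / 2))"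
        using cover[OF \<epsilon>_pos \<epsilon>_small, of l] by (cases "l \<le> J") auto
    qed
    then obtain SF where SF: "\<And>l. l \<le> J \<Longrightarrow> fst (SF l) \<in> sets \<mu> \<and>
        1 - \<epsilon> l powr (t * p / (t - 2 * p)) \<le> measure \<mu> (fst (SF l)) \<and>
        finite (snd (SF l)) \<and> snd (SF l) \<subseteq> M \<and> real (card (snd (SF l))) \<le> \<epsilon> l powr (- t) \<and>
        fst (SF l) \<subseteq> (\<Union>c\<in>snd (SF l). mcball c (\<epsilon> l / 2))"
      by metis
    define S where "S l = fst (SF l)" for l
    define F where "F l = snd (SF l)" for l
    define \<rho> where "\<rho> l = \<epsilon> l / 2" for l
    have \<rho>: "mono \<rho>" "0 \<le> \<rho> l" for l
      using \<alpha>_anti mono_exp by (auto simp: \<rho>_def \<epsilon>_def mono_def)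
    define D where "D j = (if j \<le> J then (real (4 * J + 2) * \<rho> j) powr p else \<Delta> powr p)" for j
    have D_eq: "D j = c\<^sub>1 * real n powr (- p * \<alpha> j)" if "j \<le> J" for j
    proof -
      have "real (4 * J + 2) * \<rho> j = real (2 * J + 1) * \<epsilon> j" by (simp add: \<rho>_def)
      then show ?thesis
        using that n by (simp only: D_def c\<^sub>1_def if_True powr_mult \<epsilon>_def powr_powr) (simp add: mult.commute)
    qed
    have root: "sqrt ((real (card (F j)) + 1) / real n) \<le> 2 * real n powr (\<alpha> j * t / 2 - 1 / 2)" if j: "j \<le> J" for j
    proof -
      have "real (card (F j)) \<le> real n powr (\<alpha> j * t)"
        using SF[OF j] by (simp add: F_def \<epsilon>_def powr_powr)
      moreover have "1 \<le> real n powr (\<alpha> j * t)"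
        using n1 \<alpha>_a[OF j] a t0 by (intro ge_one_powr_ge_zero) auto
      \<comment> \<open>The factor 4 exceeds the necessary 2 so that the square root is
        clean.\<close>
      ultimately have "(real (card (F j)) + 1) / real n \<le> 4 * real n powr (\<alpha> j * t) / real n"
        by (intro divide_right_mono) auto
      also have "\<dots> = (2 * real n powr (\<alpha> j * t / 2 - 1 / 2)) ^ 2"
      proof -
        have "(2 * real n powr (\<alpha> j * t / 2 - 1 / 2)) ^ 2
            = 4 * real n powr ((\<alpha> j * t / 2 - 1 / 2) + (\<alpha> j * t / 2 - 1 / 2))"
          unfolding powr_add by (simp add: power2_eq_square)
        also have "(\<alpha> j * t / 2 - 1 / 2) + (\<alpha> j * t / 2 - 1 / 2) = \<alpha> j * t - 1" by simp
        finally show ?thesis using n by (simp add: powr_diff)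
      qed
      finally show ?thesis by (rule real_le_lsqrt[rotated]) simp
    qed
    define q where "q = real n powr (- (p * u))"
    have q0: "0 < q" using n by (simp add: q_def)
    have qt: "real n powr (- (p / t)) \<le> q" unfolding q_def using pu by (intro mono_exp) simp
    have b0: "D 0 \<le> c\<^sub>1 * q"
      unfolding D_eq[OF le0] using qt c1 by (intro mult_left_mono) (simp_all add: \<alpha>_def)
    have b1: "D (Suc j) * sqrt ((real (card (F j)) + 1) / real n) \<le> c\<^sub>1 * 2 * q" if j: "j < J" for j
    proof -
      have "D (Suc j) * sqrt ((real (card (F j)) + 1) / real n)
          \<le> (c\<^sub>1 * real n powr (- p * \<alpha> (Suc j))) * (2 * real n powr (\<alpha> j * t / 2 - 1 / 2))"
        using root[of j] j D_eq[of "Suc j"] c1 by (intro mult_mono) auto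
      also have "\<dots> = c\<^sub>1 * 2 * real n powr (- p * \<alpha> (Suc j) + (\<alpha> j * t / 2 - 1 / 2))"
        unfolding powr_add by simp
      also have "\<dots> \<le> c\<^sub>1 * 2 * q"
      proof -
        \<comment> \<open>As \<open>t > 2 * p\<close>, the exponent grows with
          \<open>\<alpha> j\<close>, so the finest scale is the worst. Charging the diameter of
          level \<open>Suc j\<close> instead of \<open>j\<close> costs \<open>p * \<eta>\<close>,
          whence \<open>- p / t + p * \<eta> = - p * u\<close>.\<close>
        have "\<alpha> j \<le> 1 / t" using \<eta>0 by (simp add: \<alpha>_def)
        then have "\<alpha> j * (t / 2 - p) \<le> 1 / t * (t / 2 - p)" using t by (intro mult_right_mono) auto
        moreover have "1 / t * (t / 2 - p) = 1 / 2 - p / t" using t0 by (simp add: right_diff_distrib)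
        moreover have "\<alpha> j * (t / 2 - p) = \<alpha> j * t / 2 - p * \<alpha> j" by (simp add: right_diff_distrib)
        moreover have "- p * \<alpha> (Suc j) = p * \<eta> - p * \<alpha> j" by (simp add: \<alpha>_def algebra_simps)
        ultimately have "- p * \<alpha> (Suc j) + (\<alpha> j * t / 2 - 1 / 2) \<le> - (p * u)"
          using u(2) by linarith
        then show ?thesis unfolding q_def using c1 by (intro mult_left_mono mono_exp) auto
      qed
      finally show ?thesis .
    qed
    \<comment> \<open>At the last step the cost is the full diameter, with no gain from a small
      cell; the choice of \<open>a\<close> makes the coarsest cover small enough.\<close>
    have b2: "D (Suc J) * sqrt ((real (card (F J)) + 1) / real n) \<le> \<Delta> powr p * 2 * q"
    proof -
      have "sqrt ((real (card (F J)) + 1) / real n) \<le> 2 * real n powr (- (p / t))"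
        using root[of J] a_t by (simp add: \<alpha>J)
      also have "\<dots> \<le> 2 * q" using qt by simp
      finally show ?thesis by (simp add: D_def mult.assoc mult_left_mono)
    qed
    have b3: "1 - measure \<mu> (S l) \<le> q" if l: "l \<le> J" for l
    proof -
      have "1 - measure \<mu> (S l) \<le> \<epsilon> l powr (t * p / (t - 2 * p))" using SF[OF l] by (simp add: S_def)
      also have "\<dots> = real n powr (- (\<alpha> l * (t * p / (t - 2 * p))))" by (simp add: \<epsilon>_def powr_powr)
      also have "\<dots> \<le> real n powr (- (a * (t * p / (t - 2 * p))))"
      proof (rule mono_exp)
        have "0 \<le> t * p / (t - 2 * p)" using t t0 p_ge_1 by simp
        then have "a * (t * p / (t - 2 * p)) \<le> \<alpha> l * (t * p / (t - 2 * p))"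
          by (rule mult_right_mono[OF \<alpha>_a[OF l]])
        then show "- (\<alpha> l * (t * p / (t - 2 * p))) \<le> - (a * (t * p / (t - 2 * p)))" by simp
      qed
      also have "\<dots> \<le> q" using qt unfolding a_beta .
      finally show ?thesis .
    qed
    have "(\<Sum>j\<le>J. D (Suc j) * sqrt ((real (card (F j)) + 1) / real n))
        = (\<Sum>j<J. D (Suc j) * sqrt ((real (card (F j)) + 1) / real n)) + D (Suc J) * sqrt ((real (card (F J)) + 1) / real n)"
      by (simp flip: lessThan_Suc_atMost)
    also have "\<dots> \<le> (\<Sum>j<J. c\<^sub>1 * 2 * q) + \<Delta> powr p * 2 * q"
      using b1 b2 by (intro add_mono sum_mono) auto
    finally have b12: "(\<Sum>j\<le>J. D (Suc j) * sqrt ((real (card (F j)) + 1) / real n)) \<le> (real J * (c\<^sub>1 * 2) + \<Delta> powr p * 2) * q"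
      by (simp add: distrib_right mult.assoc)
    have "(\<Sum>l\<le>J. 1 - measure \<mu> (S l)) \<le> (\<Sum>l\<le>J. q)" using b3 by (intro sum_mono) auto
    then have b4: "\<Delta> powr p * (\<Sum>l\<le>J. 1 - measure \<mu> (S l)) \<le> \<Delta> powr p * (real (J + 1) * q)"
      by (intro mult_left_mono) auto
    have total: "D 0 + (\<Sum>j\<le>J. D (Suc j) * sqrt ((real (card (F j)) + 1) / real n))
        + \<Delta> powr p * (\<Sum>l\<le>J. 1 - measure \<mu> (S l)) \<le> C * q"
      using b0 b12 b4 unfolding C_def by (simp only: distrib_right mult.assoc)
    have "outer_expectation (samples \<mu>) (BMT_dist \<mu> n)
        \<le> ennreal (2 * (L * (modulus + 2)) * (C * q) powr (1 / p))"
      by (rule outer_expectation_multiscale[OF \<mu> n \<Delta>(1) less_imp_le[OF \<Delta>(2)] \<rho>(1) \<rho>(2), of J S F])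
         (use SF C q0 total in \<open>auto simp: S_def F_def \<rho>_def D_def\<close>)
    also have "(C * q) powr (1 / p) = C powr (1 / p) * real n powr (- u)"
      using C q0 p_ge_1 by (simp add: powr_mult q_def powr_powr)
    finally show ?thesis by (simp add: A_def mult.assoc)
  qed
  have nlim: "(\<lambda>n. real n powr (- x)) \<longlonglongrightarrow> 0" if "0 < x" for x :: real
    using that by (intro tendsto_neg_powr filterlim_real_sequentially) auto
  have "\<forall>\<^sub>F n in sequentially. real n powr (- a) < \<epsilon>\<^sub>0"
    using nlim[OF a] \<epsilon>0(1) by (rule order_tendstoD(2))
  \<comment> \<open>The surplus exponent \<open>u - 1 / s\<close> drives every constant below
    \<open>\<Delta>\<close>, which alone remains in the final bound.\<close>
  moreover have "(\<lambda>n. A * real n powr (- (u - 1 / s))) \<longlonglongrightarrow> A * 0"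
    using u by (intro tendsto_mult_left nlim) simp
  then have "\<forall>\<^sub>F n in sequentially. A * real n powr (- (u - 1 / s)) < \<Delta>"
    using \<Delta>(2) by (intro order_tendstoD(2)) auto
  moreover have "\<forall>\<^sub>F n in sequentially. 0 < n" by (rule eventually_gt_at_top)
  ultimately show ?thesis
  proof eventually_elim
    fix n :: nat
    assume n: "real n powr (- a) < \<epsilon>\<^sub>0" "A * real n powr (- (u - 1 / s)) < \<Delta>" "0 < n"
    have "A * real n powr (- u) = A * real n powr (- (u - 1 / s)) * real n powr (- 1 / s)"
      by (simp add: mult.assoc flip: powr_add)
    also have "\<dots> \<le> \<Delta> * real n powr (- 1 / s)" using n by (intro mult_right_mono) auto
    finally have "ennreal (A * real n powr (- u)) \<le> ennreal (\<Delta> * real n powr (- 1 / s))" by (rule ennreal_leI)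
    then show "outer_expectation (samples \<mu>) (BMT_dist \<mu> n) \<le> ennreal (\<Delta> * real n powr (- 1 / s))"
      using main[OF n(3,1)] by (rule order_trans[rotated])
  qed
qed

text \<open>Three cases for the diameter: if infinite, the right side is infinite for
  \<open>n > 0\<close>; if zero, the expectations vanish; if positive and finite, this is
  \<open>BMT_dist_rate\<close>, completed by the diameter bound for small \<open>n\<close>.\<close>

lemma BMT_dist_rate_ediam:
  assumes \<mu>: "\<mu> \<in> moments" and s: "upper_wasserstein_dim p d \<mu> < ereal s"
  shows "\<forall>\<^sub>F n in sequentially. outer_expectation (samples \<mu>) (BMT_dist \<mu> n)
      \<le> ediam M d * ennreal (real n powr (- 1 / s))" (is "\<forall>\<^sub>F n in _. ?E n \<le> _")
    and "\<exists>C'>0. \<forall>n>0. outer_expectation (samples \<mu>) (BMT_dist \<mu> n)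
      \<le> ennreal C' * ediam M d * ennreal (real n powr (- 1 / s))"
proof -
  define A where "A = L * (modulus + 2)"
  have A: "0 < A" using L_pos by (simp add: A_def add_nonneg_pos)
  have "(\<forall>\<^sub>F n in sequentially. ?E n \<le> ediam M d * ennreal (real n powr (- 1 / s))) \<and>
      (\<exists>C'>0. \<forall>n>0. ?E n \<le> ennreal C' * ediam M d * ennreal (real n powr (- 1 / s)))"
  proof (cases "ediam M d")
    case top
    have "ediam M d * ennreal (real n powr (- 1 / s)) = \<top>" if "0 < n" for n
      using that top by (simp add: ennreal_top_mult)
    then show ?thesis
      by (intro conjI exI[of _ 1] eventually_mono[OF eventually_gt_at_top[of 0]]) auto
  next
    case (real \<Delta>)
    have \<Delta>: "d x y \<le> \<Delta>" if "x \<in> M" "y \<in> M" for x y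
    proof -
      have "ennreal (d x y) \<le> ediam M d"
        unfolding ediam_def using that by (intro SUP_upper2[of x] SUP_upper2[of y] order_refl)
      then show ?thesis using real by (simp add: ennreal_le_iff)
    qed
    have crude: "?E n \<le> ennreal (A * \<Delta>)" if "0 < n" for n
      unfolding A_def using real by (intro outer_expectation_BMT_le_diameter[OF \<mu> that \<Delta>]) auto
    show ?thesis
    proof (cases "\<Delta> = 0")
      case True
      then have "?E n = 0" if "0 < n" for n using crude[OF that] by simp
      then show ?thesis
        by (intro conjI exI[of _ 1] eventually_mono[OF eventually_gt_at_top[of 0]]) auto
    next
      case False
      then have pos: "0 < \<Delta>" using real by simp
      note ev = BMT_dist_rate[OF \<mu> \<Delta> pos s]
      have eq: "ediam M d * ennreal (real n powr (- 1 / s)) = ennreal (\<Delta> * real n powr (- 1 / s))" for n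
        using real by (simp add: ennreal_mult)
      obtain N where N: "\<And>n. N \<le> n \<Longrightarrow> ?E n \<le> ennreal (\<Delta> * real n powr (- 1 / s))"
        using ev by (auto simp: eventually_sequentially)
      obtain t where "2 * p < t" "t < s" using dimension_cover[OF \<mu> s] by metis
      then have s0: "0 < s" using p_ge_1 by simp
      \<comment> \<open>For \<open>0 < n < N\<close> the product
        \<open>N powr (1 / s) * n powr (- 1 / s)\<close> is at least 1, so it absorbs the diameter
        bound. Through \<open>N\<close> this constant depends on \<open>\<mu>\<close>.\<close>
      define C' where "C' = max 1 (A * real N powr (1 / s))"
      have "?E n \<le> ennreal (C' * (\<Delta> * real n powr (- 1 / s)))" if n: "0 < n" for n
      proof (cases "N \<le> n")
        case True
        have "1 * (\<Delta> * real n powr (- 1 / s)) \<le> C' * (\<Delta> * real n powr (- 1 / s))"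
          using pos by (intro mult_right_mono) (auto simp: C'_def)
        then show ?thesis using N[OF True] by (simp add: order_trans[OF _ ennreal_leI])
      next
        case False
        have "1 = real n powr (1 / s) * real n powr (- 1 / s)" using n by (simp flip: powr_add)
        also have "\<dots> \<le> real N powr (1 / s) * real n powr (- 1 / s)"
          using False s0 by (intro mult_right_mono powr_mono2) auto
        finally have "A * \<Delta> * 1 \<le> A * \<Delta> * (real N powr (1 / s) * real n powr (- 1 / s))"
          using A pos by (intro mult_left_mono) auto
        also have "\<dots> = A * real N powr (1 / s) * (\<Delta> * real n powr (- 1 / s))" by (simp add: mult_ac)
        also have "\<dots> \<le> C' * (\<Delta> * real n powr (- 1 / s))"
          using pos by (intro mult_right_mono) (auto simp: C'_def)
        finally show ?thesis using crude[OF n] by (simp add: order_trans[OF _ ennreal_leI])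
      qed
      moreover have "ennreal C' * ediam M d * ennreal (real n powr (- 1 / s)) = ennreal (C' * (\<Delta> * real n powr (- 1 / s)))" for n
        using real pos by (simp add: mult.assoc ennreal_mult C'_def)
      moreover have "0 < C'" by (simp add: C'_def)
      ultimately show ?thesis using ev eq by auto
    qed
  qed
  then show "\<forall>\<^sub>F n in sequentially. ?E n \<le> ediam M d * ennreal (real n powr (- 1 / s))"
    and "\<exists>C'>0. \<forall>n>0. ?E n \<le> ennreal C' * ediam M d * ennreal (real n powr (- 1 / s))"
    by auto
qed

end

text \<open>A limsup constrains small scales and thus large \<open>n\<close> only, and the threshold
  from which the uniform constant works may depend on \<open>\<mu>\<close>. The bound for every
  \<open>n > 0\<close> therefore has a constant \<open>C'\<close> of its own, which may depend on
  all data.\<close>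

theorem corollary4p7:
  shows "\<exists>C :: real \<Rightarrow> real \<Rightarrow> real \<Rightarrow> ennreal \<Rightarrow> real.
    (\<forall>s p L K. 0 < C s p L K) \<and>
    (\<forall>(M :: 'a set) d \<mu> \<theta> p L.
       1 \<le> p \<longrightarrow>
       0 < L \<longrightarrow>
       Metric_space M d \<longrightarrow>
       Metric_space.mcomplete M d \<longrightarrow>
       separable_space (Metric_space.mtopology M d) \<longrightarrow>
       connected_space (Metric_space.mtopology M d) \<longrightarrow>
       locally_path_connected_space (Metric_space.mtopology M d) \<longrightarrow>
       connectivity_modulus M d < \<infinity> \<longrightarrow>
       \<mu> \<in> borel_prob_moment M d p \<longrightarrow>
       admissible L M d \<theta> \<longrightarrow>
       (let P = (\<Pi>\<^sub>M i\<in>(UNIV :: nat set). \<mu>);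
            D = (\<lambda>n x. KS_distance p (functional_BMT p \<theta> M d \<mu>)
                          (functional_BMT p \<theta> M d (empirical_measure \<mu> n x)))
        in
          (AE x in P. (\<lambda>n. D n x) \<longlonglongrightarrow> 0) \<and>
          (\<forall>s. upper_wasserstein_dim p d \<mu> < ereal s \<longrightarrow>
             (\<forall>\<^sub>F n in sequentially.
                outer_expectation P (D n)
                  \<le> ennreal (C s p L (connectivity_modulus M d)) * ediam M d
                      * ennreal (real n powr (- 1 / s))) \<and>
             (\<exists>C'>0. \<forall>n>0.
                outer_expectation P (D n)
                  \<le> ennreal C' * ediam M d * ennreal (real n powr (- 1 / s))))))"
proof (intro exI[of _ "\<lambda>_ _ _ _. 1"] conjI allI impI)
  fix M :: "'a set" and d \<mu> \<theta> and p L :: real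
  assume "1 \<le> p" "0 < L" "Metric_space M d" "separable_space (Metric_space.mtopology M d)"
    "connected_space (Metric_space.mtopology M d)"
    "locally_path_connected_space (Metric_space.mtopology M d)"
    "connectivity_modulus M d < \<infinity>" "admissible L M d \<theta>"
  then interpret bmt_setting M d \<theta> p L
    by (intro bmt_setting.intro bmt_setting_axioms.intro)
  assume \<mu>: "\<mu> \<in> moments"
  have D: "(\<lambda>n x. KS_distance p (functional_BMT p \<theta> M d \<mu>)
      (functional_BMT p \<theta> M d (empirical_measure \<mu> n x))) = BMT_dist \<mu>"
    by (simp add: fun_eq_iff BMT_dist_def)
  show "let P = (\<Pi>\<^sub>M i\<in>(UNIV :: nat set). \<mu>);
            D = (\<lambda>n x. KS_distance p (functional_BMT p \<theta> M d \<mu>)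
                          (functional_BMT p \<theta> M d (empirical_measure \<mu> n x)))
        in
          (AE x in P. (\<lambda>n. D n x) \<longlonglongrightarrow> 0) \<and>
          (\<forall>s. upper_wasserstein_dim p d \<mu> < ereal s \<longrightarrow>
             (\<forall>\<^sub>F n in sequentially.
                outer_expectation P (D n)
                  \<le> ennreal 1 * ediam M d
                      * ennreal (real n powr (- 1 / s))) \<and>
             (\<exists>C'>0. \<forall>n>0.
                outer_expectation P (D n)
                  \<le> ennreal C' * ediam M d * ennreal (real n powr (- 1 / s))))"
    unfolding D Let_def ennreal_1 mult_1_left
    by (intro conjI allI impI BMT_dist_consistent BMT_dist_rate_ediam \<mu>)
qed simp

end
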